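(* Let $E$ be a Hermite–Biehler function with no real zeros such that $z\mapsto E(iz)$ is real entire. Let $\mathcal{H}(E)$ be the associated de Branges space with reproducing kernel $K$. Let $A:=\frac12(E+E^* )$ and let $\xi_0$ be the smallest positive real zero of $A$. Then \[ \inf_{F \in \mathcal{H}(E),\ F\neq 0} \frac{\|z \, F\|_{\mathcal{H}(E)}}{\|F\|_{\mathcal{H}(E)}} = \xi_0, \] and the functions attaining this infimum are exactly $\mathfrak{F}(z) = c\big( K(\xi_0, z) + K(\xi_0, -z)\big)$ with $c \in \mathbb{C}\setminus\{0\}$.
   Context: For an entire function $F$, $F^*(z):=\overline{F(\overline{z})}$; $F$ is real entire if it is real on $\mathbb{R}$. An entire $E$ is Hermite–Biehler if $|E(\overline{z})|<|E(z)|$ for all $z$ with $\mathrm{Im}\,z>0$. The de Branges space $\mathcal{H}(E)$ is the space of entire $F$ with $\|F\|^2_{\mathcal{H}(E)}:=\int_{\mathbb{R}}|F(x)|^2|E(x)|^{-2}dx<\infty$ such that $F/E$ and $F^*/E$ have bounded type (quotient of two bounded analytic functions) and non-positive mean type ($\limsup_{y\to\infty}y^{-1}\log|h(iy)|\le 0$) in the upper half-plane; it is a Hilbert space with inner product $\int F\overline{G}|E|^{-2}dx$ and reproducing kernel given by $2\pi i(\overline{w}-z)K(w,z)=E(z)E^*(\overline{w})-E^*(z)E(\overline{w})$. In the ratio, $\|zF\|_{\mathcal{H}(E)}$ denotes $(\int_{\mathbb{R}}|xF(x)|^2|E(x)|^{-2}dx)^{1/2}$, possibly $+\infty$. *)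

theory Defs
  imports "HOL-Complex_Analysis.Complex_Analysis"
begin

definition star_fun :: "(complex \<Rightarrow> complex) \<Rightarrow> complex \<Rightarrow> complex" where
  "star_fun F z = cnj (F (cnj z))"

definition entire :: "(complex \<Rightarrow> complex) \<Rightarrow> bool" where
  "entire F \<longleftrightarrow> F holomorphic_on UNIV"

definition real_entire :: "(complex \<Rightarrow> complex) \<Rightarrow> bool" where
  "real_entire F \<longleftrightarrow> entire F \<and> (\<forall>x::real. F (complex_of_real x) \<in> \<real>)"

definition hermite_biehler :: "(complex \<Rightarrow> complex) \<Rightarrow> bool" where
  "hermite_biehler E \<longleftrightarrow> entire E \<and> (\<forall>z. Im z > 0 \<longrightarrow> norm (E (cnj z)) < norm (E z))"

definition UHP :: "complex set" where
  "UHP = {z. Im z > 0}"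

definition bounded_type :: "(complex \<Rightarrow> complex) \<Rightarrow> bool" where
  "bounded_type h \<longleftrightarrow> (\<exists>f g. f holomorphic_on UHP \<and> g holomorphic_on UHP \<and>
      bounded (f ` UHP) \<and> bounded (g ` UHP) \<and> (\<exists>z\<in>UHP. g z \<noteq> 0) \<and>
      (\<forall>z\<in>UHP. h z * g z = f z))"

definition mean_type_nonpos :: "(complex \<Rightarrow> complex) \<Rightarrow> bool" where
  "mean_type_nonpos h \<longleftrightarrow>
     Limsup at_top (\<lambda>y::real. ereal (ln (norm (h (\<i> * complex_of_real y))) / y)) \<le> 0"

definition dB_normsq :: "(complex \<Rightarrow> complex) \<Rightarrow> (complex \<Rightarrow> complex) \<Rightarrow> ennreal" where
  "dB_normsq E F = (\<integral>\<^sup>+ x. ennreal ((norm (F (complex_of_real x)))\<^sup>2 / (norm (E (complex_of_real x)))\<^sup>2) \<partial>lborel)"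

definition dB_space :: "(complex \<Rightarrow> complex) \<Rightarrow> (complex \<Rightarrow> complex) set" where
  "dB_space E = {F. entire F \<and> dB_normsq E F < \<infinity> \<and>
      bounded_type (\<lambda>z. F z / E z) \<and> mean_type_nonpos (\<lambda>z. F z / E z) \<and>
      bounded_type (\<lambda>z. star_fun F z / E z) \<and> mean_type_nonpos (\<lambda>z. star_fun F z / E z)}"

definition dB_norm :: "(complex \<Rightarrow> complex) \<Rightarrow> (complex \<Rightarrow> complex) \<Rightarrow> ereal" where
  "dB_norm E F = (if dB_normsq E F = \<infinity> then \<infinity> else ereal (sqrt (enn2real (dB_normsq E F))))"

text \<open>Reproducing kernel: 2 pi i (cnj w - z) K(w,z) = E(z)E*(cnj w) - E*(z)E(cnj w);
  on the diagonal z = cnj w the value is the (continuous) limit.\<close>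
definition dB_kernel :: "(complex \<Rightarrow> complex) \<Rightarrow> complex \<Rightarrow> complex \<Rightarrow> complex" where
  "dB_kernel E w z =
     (if z \<noteq> cnj w then
        (E z * star_fun E (cnj w) - star_fun E z * E (cnj w)) / (2 * pi * \<i> * (cnj w - z))
      else
        (deriv (star_fun E) (cnj w) * E (cnj w) - deriv E (cnj w) * star_fun E (cnj w)) / (2 * pi * \<i>))"

definition dB_A :: "(complex \<Rightarrow> complex) \<Rightarrow> complex \<Rightarrow> complex" where
  "dB_A E z = (E z + star_fun E z) / 2"

end

theory Submission
  imports Defs "HOL-Probability.Sinc_Integral" "HOL-Real_Asymp.Real_Asymp"
begin

text \<open>
  Put \<open>\<Theta> = E\<^sup>* / E\<close> and \<open>h = F / E\<close>, and let \<open>\<alpha> < \<beta>\<close> be consecutive real zeros of \<open>A\<close>. If \<open>x F\<close> has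
  finite norm and \<open>p\<close> is a polynomial of degree at most 2, then \<open>p F F\<^sup>* / (E\<^sup>2 (1 + r \<Theta>))\<close> is
  analytic in the upper half-plane, of bounded type and non-positive mean type, and integrable on the
  real line, so its integral vanishes. Since \<open>F F\<^sup>* / E\<^sup>2 = |h|\<^sup>2 \<Theta>\<close> on the line, the real part of
  this says \<open>\<integral> p |h|\<^sup>2 = \<integral> p |h|\<^sup>2 P\<^sub>r\<close> with the Poisson kernel \<open>P\<^sub>r = (1 - r\<^sup>2) / |1 + r \<Theta>|\<^sup>2\<close>, which
  concentrates on the zeros of \<open>A\<close> as \<open>r\<close> tends to 1. With \<open>p = (x - \<alpha>) (x - \<beta>)\<close> only \<open>\<alpha> < x < \<beta>\<close>
  contributes negatively, and that part tends to 0. Hence \<open>F \<mapsto> \<integral> p |h|\<^sup>2\<close> is positive semidefinite.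
  Its null space is spanned by \<open>\<phi> = A / ((z - \<alpha>) (z - \<beta>))\<close>: after subtracting a multiple of \<open>\<phi>\<close> from a
  null vector \<open>F\<close> one may assume \<open>F(\<beta>) = 0\<close>, and the orthogonality of \<open>F\<close> to \<open>F / (z - \<beta>)\<close> gives
  \<open>\<integral> (x - \<alpha>)\<^sup>2 |h|\<^sup>2 = 0\<close>. Rotation invariance means \<open>E\<^sup>*(z) = E(-z)\<close>, so that \<open>A\<close> is even and \<open>\<alpha> = - \<xi>\<^sub>0\<close>,
  \<open>\<beta> = \<xi>\<^sub>0\<close> are admitted; then \<open>p = x\<^sup>2 - \<xi>\<^sub>0\<^sup>2\<close>.

  The vanishing of the integral replaces Nevanlinna factorization by a Phragmen-Lindelof argument: a
  quotient of bounded functions is at most \<open>exp (C (1 + |z|\<^sup>2) / Im z)\<close>, and a primitive of an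
  integrable function is bounded on the real line.
\<close>

subsection \<open>The Schwarz--Pick, Harnack and Hopf lemmas\<close>

lemma holomorphic_factor_linear:
  assumes "f holomorphic_on S" "open S" "f a = 0"
  obtains g where "g holomorphic_on S" "\<And>z. f z = (z - a) * g z"
proof
  show "(\<lambda>z. if z = a then deriv f a else (f z - f a) / (z - a)) holomorphic_on S"
    using assms by (intro pole_lemma_open)
qed (use assms in auto)

lemma Schwarz_Lemma_le:
  assumes "f holomorphic_on ball 0 1" "f 0 = 0" "\<And>z. norm z < 1 \<Longrightarrow> norm (f z) \<le> 1"
    and "norm z < 1"
  shows "norm (f z) \<le> norm z"
proof (rule field_le_mult_one_interval)
  fix t :: real assume t: "0 < t" "t < 1"
  have "norm (complex_of_real t * f w) < 1" if "norm w < 1" for w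
  proof -
    have "t * norm (f w) \<le> t * 1" using assms(3)[OF that] t by (intro mult_left_mono) auto
    then have "t * norm (f w) < 1" using t by linarith
    then show ?thesis using t by (simp add: norm_mult)
  qed
  then have "norm (complex_of_real t * f z) \<le> norm z"
    using assms by (intro Schwarz_Lemma(1)) (auto intro!: holomorphic_intros)
  then show "t * norm (f z) \<le> norm z"
    using t by (simp add: norm_mult)
qed

lemma Schwarz_Pick_zero:
  assumes hol: "f holomorphic_on ball 0 1" and le: "\<And>z. norm z < 1 \<Longrightarrow> norm (f z) \<le> 1"
    and a: "norm a < 1" "f a = 0" and z: "norm z < 1"
  shows "norm (f z) \<le> norm (Moebius_function 0 a z)"
proof -
  let ?M = "Moebius_function 0"
  have ma: "norm (- a) < 1" using a by simp
  have "norm (f (?M (- a) (?M a z))) \<le> norm (?M a z)"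
  proof (rule Schwarz_Lemma_le[where f = "\<lambda>w. f (?M (- a) w)"])
    show "(\<lambda>w. f (?M (- a) w)) holomorphic_on ball 0 1"
      by (rule holomorphic_on_compose_gen[OF Moebius_function_holomorphic[OF ma] hol, unfolded o_def])
         (use Moebius_function_norm_lt_1 ma in auto)
    show "norm (f (?M (- a) w)) \<le> 1" if "norm w < 1" for w
      by (intro le Moebius_function_norm_lt_1 ma that)
    show "norm (?M a z) < 1" by (intro Moebius_function_norm_lt_1 a z)
  qed (use a in \<open>simp add: Moebius_function_of_zero\<close>)
  then show ?thesis using Moebius_function_compose[of "- a" a z] ma z by simp
qed

lemma Harnack_unit_ball:
  assumes hol: "q holomorphic_on ball 0 1" and Re: "\<And>z. norm z < 1 \<Longrightarrow> 0 \<le> Re (q z)"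
    and z: "norm z < 1"
  shows "norm (q z) * (1 - norm z) \<le> norm (q 0) * (1 + norm z)"
proof (rule field_le_epsilon)
  fix e :: real assume e: "e > 0"
  define p where "p w = q w + complex_of_real (e / 2)" for w
  have Re_p: "0 < Re (p w)" if "norm w < 1" for w
    using Re[OF that] e by (simp add: p_def)
  have nz: "p w + cnj (p 0) \<noteq> 0" if "norm w < 1" for w
    using Re_p[OF that] Re_p[of 0] by (auto simp: complex_eq_iff)
  have "norm (p w - p 0) \<le> norm (p w + cnj (p 0))" if "norm w < 1" for w
  proof (rule power2_le_imp_le)
    have "0 \<le> Re (p w) * Re (p 0)" using Re_p[OF that] Re_p[of 0] by simp
    then show "(norm (p w - p 0))\<^sup>2 \<le> (norm (p w + cnj (p 0)))\<^sup>2"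
      unfolding cmod_power2 by (simp add: power2_eq_square algebra_simps)
  qed simp
  then have "norm ((p z - p 0) / (p z + cnj (p 0))) \<le> norm z"
    using nz z hol
    by (intro Schwarz_Lemma_le[where f = "\<lambda>w. (p w - p 0) / (p w + cnj (p 0))"])
       (auto simp: p_def norm_divide intro!: holomorphic_intros)
  then have "norm (p z - p 0) \<le> norm z * norm (p z + cnj (p 0))"
    using nz[OF z] by (simp add: norm_divide divide_simps)
  also have "\<dots> \<le> norm z * (norm (p z) + norm (p 0))"
    using norm_triangle_ineq[of "p z" "cnj (p 0)"] by (intro mult_left_mono) auto
  finally have "norm (p z) * (1 - norm z) \<le> norm (p 0) * (1 + norm z)"
    using norm_triangle_ineq2[of "p z" "p 0"] by (simp add: algebra_simps)
  moreover have "(norm (q z) - e / 2) * (1 - norm z) \<le> norm (p z) * (1 - norm z)"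
    using norm_diff_ineq[of "q z" "complex_of_real (e / 2)"] e z by (intro mult_right_mono) (auto simp: p_def)
  moreover have "norm (p 0) * (1 + norm z) \<le> (norm (q 0) + e / 2) * (1 + norm z)"
    using norm_triangle_ineq[of "q 0" "complex_of_real (e / 2)"] e
    by (intro mult_right_mono) (auto simp: p_def)
  ultimately have "(norm (q z) - e / 2) * (1 - norm z) \<le> (norm (q 0) + e / 2) * (1 + norm z)"
    by linarith
  then show "norm (q z) * (1 - norm z) \<le> norm (q 0) * (1 + norm z) + e"
    by (simp add: field_simps)
qed

lemma Harnack_ball:
  assumes hol: "q holomorphic_on ball c R" and Re: "\<And>z. z \<in> ball c R \<Longrightarrow> 0 \<le> Re (q z)"
    and z: "z \<in> ball c R"
  shows "norm (q z) * (R - dist c z) \<le> norm (q c) * (R + dist c z)"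
proof -
  have R: "R > 0" using z by (meson mem_ball zero_le_dist le_less_trans)
  define w where "w = (z - c) / R"
  have w: "norm w = dist c z / R"
    using R by (simp add: w_def norm_divide dist_norm norm_minus_commute)
  have in_ball: "c + R * u \<in> ball c R" if "norm u < 1" for u :: complex
    using that R by (simp add: dist_norm norm_mult)
  have "norm (q (c + R * w)) * (1 - norm w) \<le> norm (q (c + complex_of_real R * 0)) * (1 + norm w)"
  proof (rule Harnack_unit_ball)
    show "(\<lambda>u. q (c + R * u)) holomorphic_on ball 0 1"
      by (rule holomorphic_on_compose_gen[OF _ hol, unfolded o_def])
         (use in_ball in \<open>auto intro!: holomorphic_intros\<close>)
    show "0 \<le> Re (q (c + R * u))" if "norm u < 1" for u :: complex
      using Re[OF in_ball[OF that]] .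
    show "norm w < 1" using z R by (simp add: w)
  qed
  moreover have "c + R * w = z" using R by (simp add: w_def)
  ultimately have "norm (q z) * (1 - norm w) * R \<le> norm (q c) * (1 + norm w) * R"
    using R by simp
  then show ?thesis using R by (simp add: w algebra_simps)
qed

lemma Harnack_radius_lower_bound:
  assumes hol: "g holomorphic_on ball c R" and Re: "\<And>z. z \<in> ball c R \<Longrightarrow> 0 < Re (g z)"
    and p: "dist c p = R" and R: "R > 0" and t: "0 < t" "t < 1"
  shows "norm (g c) * t \<le> 2 * norm (g (p + complex_of_real t * (c - p)))"
proof -
  define z where "z = p + complex_of_real t * (c - p)"
  have "c - z = complex_of_real (1 - t) * (c - p)" by (simp add: z_def algebra_simps)
  then have dist_z: "dist c z = (1 - t) * R"
    using t p unfolding dist_norm by (simp add: norm_mult del: of_real_diff)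
  have ball: "z \<in> ball c R" "c \<in> ball c R" using t R by (simp_all add: dist_z)
  have nz: "g w \<noteq> 0" if "w \<in> ball c R" for w using Re[OF that] by auto
  have "norm (1 / g z) * (R - dist c z) \<le> norm (1 / g c) * (R + dist c z)"
  proof (rule Harnack_ball[OF _ _ ball(1)])
    show "(\<lambda>z. 1 / g z) holomorphic_on ball c R" using nz by (intro holomorphic_intros hol) auto
    show "0 \<le> Re (1 / g w)" if "w \<in> ball c R" for w
      using Re[OF that] by (simp add: Re_divide)
  qed
  also have "\<dots> \<le> norm (1 / g c) * (2 * R)"
    using t R by (intro mult_left_mono) (auto simp: dist_z)
  finally show ?thesis
    using nz[OF ball(1)] nz[OF ball(2)] R unfolding z_def[symmetric]
    by (simp add: norm_divide dist_z field_simps)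
qed

lemma Hopf_boundary_derivative:
  assumes hol: "g holomorphic_on ball c R" and Re: "\<And>z. z \<in> ball c R \<Longrightarrow> 0 < Re (g z)"
    and p: "dist c p = R" "g p = 0" and R: "R > 0"
    and deriv: "(g has_field_derivative d) (at p)"
  shows "d \<noteq> 0"
proof
  assume "d = 0"
  define z where "z t = p + complex_of_real t * (c - p)" for t
  have lower: "norm (g c) / (2 * R) \<le> norm ((g (z t) - g p) / (z t - p))" if t: "0 < t" "t < 1" for t
  proof -
    have "norm (g c) * t / (2 * (t * R)) \<le> 2 * norm (g (z t)) / (2 * (t * R))"
      using Harnack_radius_lower_bound[OF hol Re p(1) R t] t R
      unfolding z_def by (intro divide_right_mono) auto
    then show ?thesis
      using t p by (simp add: z_def norm_divide norm_mult dist_norm)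
  qed
  have z_lim: "filterlim z (at p) (at_right 0)"
  proof (rule filterlim_atI)
    have "(z \<longlongrightarrow> p + complex_of_real 0 * (c - p)) (at_right 0)"
      unfolding z_def by (intro tendsto_intros)
    then show "(z \<longlongrightarrow> p) (at_right 0)" by simp
    show "\<forall>\<^sub>F t in at_right 0. z t \<noteq> p"
      using eventually_at_right_less[of 0]
      by eventually_elim (use p R in \<open>auto simp: z_def dist_norm\<close>)
  qed
  have "((\<lambda>w. (g w - g p) / (w - p)) \<longlongrightarrow> 0) (at p)"
    using deriv \<open>d = 0\<close> by (simp add: has_field_derivative_iff)
  then have "((\<lambda>t. (g (z t) - g p) / (z t - p)) \<longlongrightarrow> 0) (at_right 0)"
    by (rule filterlim_compose[OF _ z_lim])
  moreover have "\<forall>\<^sub>F t in at_right 0. norm (g c) / (2 * R) \<le> norm ((g (z t) - g p) / (z t - p))"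
    using eventually_at_right_real[OF zero_less_one] by eventually_elim (rule lower, auto)
  ultimately have "norm (g c) / (2 * R) \<le> norm (0 :: complex)"
    by (intro tendsto_lowerbound[OF tendsto_norm]) auto
  moreover have "0 < norm (g c)" using Re[of c] R by auto
  then have "0 < norm (g c) / (2 * R)" using R by simp
  ultimately show False by simp
qed

subsection \<open>Functions of bounded type\<close>

lemma norm_le_1_if_norm_mult_Moebius_le_1:
  assumes k: "k holomorphic_on ball 0 1" and a: "norm a < 1"
    and le: "\<And>z. norm z < 1 \<Longrightarrow> norm (k z * Moebius_function 0 a z) \<le> 1"
    and z: "norm z < 1"
  shows "norm (k z) \<le> 1"
proof -
  let ?M = "Moebius_function 0 a"
  have off_a: "norm (k w) \<le> 1" if w: "norm w < 1" "w \<noteq> a" for w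
  proof -
    have "norm (k w * ?M w) \<le> norm (?M w)"
      by (rule Schwarz_Pick_zero[where f = "\<lambda>w. k w * ?M w"])
         (use le a w in \<open>auto intro!: holomorphic_intros k Moebius_function_holomorphic
           simp: Moebius_function_eq_zero\<close>)
    moreover have "?M w \<noteq> 0"
      using Moebius_function_compose[of "- a" a w] Moebius_function_of_zero[of 0 "- a"] a w by auto
    ultimately show ?thesis by (simp add: norm_mult)
  qed
  show ?thesis
  proof (cases "z = a")
    case True
    have "isCont k a"
      using k a by (intro continuous_on_interior[OF holomorphic_on_imp_continuous_on]) auto
    then have lim: "((\<lambda>w. norm (k w)) \<longlongrightarrow> norm (k a)) (at a)"
      by (intro tendsto_norm) (simp add: isCont_def)
    have "\<forall>\<^sub>F w in at a. w \<in> ball 0 1 - {a}"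
      using a by (intro eventually_at_in_open) auto
    then have "\<forall>\<^sub>F w in at a. norm (k w) \<le> 1"
      by eventually_elim (use off_a in auto)
    then show ?thesis using tendsto_upperbound[OF lim] True by simp
  qed (use off_a z in auto)
qed

lemma Blaschke_factor_divide:
  assumes g: "g holomorphic_on ball 0 1" and a: "norm a < 1" "g a = 0"
  obtains k where "k holomorphic_on ball 0 1" "\<And>z. norm z < 1 \<Longrightarrow> g z = k z * Moebius_function 0 a z"
proof -
  obtain G where G: "G holomorphic_on ball 0 1" "\<And>z. g z = (z - a) * G z"
    using holomorphic_factor_linear[OF g _ a(2)] by blast
  have nz: "1 - cnj a * z \<noteq> 0" if "norm z < 1" for z
    using norm_mult_less[of "cnj a" 1 z 1] a(1) that by auto
  show thesis
  proof
    show "(\<lambda>z. G z * (1 - cnj a * z)) holomorphic_on ball 0 1"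
      by (intro holomorphic_intros G(1))
    show "g z = G z * (1 - cnj a * z) * Moebius_function 0 a z" if "norm z < 1" for z
      using nz[OF that] by (simp add: G(2) Moebius_function_simple)
  qed
qed

lemma Harnack_zero_free:
  assumes g: "g holomorphic_on ball 0 \<rho>" and nz: "\<And>z. norm z < \<rho> \<Longrightarrow> g z \<noteq> 0"
    and le: "\<And>z. norm z < \<rho> \<Longrightarrow> norm (g z) \<le> 1" and w: "norm w < \<rho>"
  shows "norm (g 0) powr ((\<rho> + norm w) / (\<rho> - norm w)) \<le> norm (g w)"
proof -
  have \<rho>: "\<rho> > 0" using w norm_ge_zero[of w] by linarith
  obtain l where l: "l holomorphic_on ball 0 \<rho>" "\<And>z. z \<in> ball 0 \<rho> \<Longrightarrow> g z = exp (l z)"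
    using contractible_imp_holomorphic_log[OF g convex_imp_contractible[OF convex_ball]] nz by auto
  define q where "q z = \<i> * Im (l 0) - l z" for z
  have Re_q: "Re (q z) = - ln (norm (g z))" "0 \<le> Re (q z)" if "norm z < \<rho>" for z
    using l(2)[of z] le[OF that] that by (simp_all add: q_def)
  have "q 0 = complex_of_real (Re (q 0))" by (simp add: q_def complex_eq_iff)
  then have "norm (q 0) = - ln (norm (g 0))"
    using Re_q[of 0] \<rho> by (metis abs_of_nonneg norm_of_real norm_zero)
  moreover have "norm (q w) * (\<rho> - dist 0 w) \<le> norm (q 0) * (\<rho> + dist 0 w)"
  proof (rule Harnack_ball)
    show "q holomorphic_on ball 0 \<rho>" unfolding q_def by (intro holomorphic_intros l(1))
  qed (use Re_q(2) w in auto)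
  moreover have "- ln (norm (g w)) * (\<rho> - norm w) \<le> norm (q w) * (\<rho> - norm w)"
    using complex_Re_le_cmod[of "q w"] Re_q(1)[OF w] w by (intro mult_right_mono) auto
  ultimately have "- ln (norm (g w)) * (\<rho> - norm w) \<le> - ln (norm (g 0)) * (\<rho> + norm w)"
    by simp
  then have "(\<rho> + norm w) / (\<rho> - norm w) * ln (norm (g 0)) \<le> ln (norm (g w))"
    using w by (simp add: field_simps)
  then show ?thesis
    using nz[OF w] nz[of 0] \<rho> by (simp add: powr_def ln_ge_iff)
qed

lemma Blaschke_factor_divide_bounded:
  assumes f: "f holomorphic_on ball 0 1" and g: "g holomorphic_on ball 0 1"
    and g_le: "\<And>z. norm z < 1 \<Longrightarrow> norm (g z) \<le> 1"
    and fg_le: "\<And>z. norm z < 1 \<Longrightarrow> norm (f z * g z) \<le> 1"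
    and a: "norm a < 1" "g a = 0"
  obtains k where "k holomorphic_on ball 0 1" "\<And>z. norm z < 1 \<Longrightarrow> norm (k z) \<le> 1"
    "\<And>z. norm z < 1 \<Longrightarrow> norm (f z * k z) \<le> 1" "norm (g 0) = norm (k 0) * norm a"
proof -
  obtain k where k: "k holomorphic_on ball 0 1"
      "\<And>z. norm z < 1 \<Longrightarrow> g z = k z * Moebius_function 0 a z"
    using Blaschke_factor_divide[OF g a] by blast
  show thesis
  proof (rule that[OF k(1)])
    show "norm (k z) \<le> 1" if "norm z < 1" for z
      by (rule norm_le_1_if_norm_mult_Moebius_le_1[OF k(1) a(1) _ that]) (use g_le k(2) in auto)
    show "norm (f z * k z) \<le> 1" if "norm z < 1" for z
      by (rule norm_le_1_if_norm_mult_Moebius_le_1[where k = "\<lambda>z. f z * k z", OF _ a(1) _ that])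
         (use fg_le k f in \<open>auto intro!: holomorphic_intros simp: mult.assoc\<close>)
    show "norm (g 0) = norm (k 0) * norm a"
      using k(2)[of 0] by (simp add: Moebius_function_of_zero norm_mult)
  qed
qed

text \<open>Dividing \<open>g\<close> by a Blaschke factor at a zero in \<open>ball 0 \<rho>\<close> multiplies \<open>norm (g 0)\<close> by more than
  \<open>1 / \<rho>\<close>, so after at most \<open>n\<close> divisions \<open>g\<close> is zero-free there.\<close>
lemma norm_mult_powr_le_1_radius:
  assumes \<rho>: "0 < \<rho>" "\<rho> < 1" and w: "norm w < \<rho>" and f: "f holomorphic_on ball 0 1"
    and "g holomorphic_on ball 0 1" "\<And>z. norm z < 1 \<Longrightarrow> norm (g z) \<le> 1"
    and "\<And>z. norm z < 1 \<Longrightarrow> norm (f z * g z) \<le> 1" and "\<rho> ^ n < norm (g 0)"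
  shows "norm (f w) * norm (g 0) powr ((\<rho> + norm w) / (\<rho> - norm w)) \<le> 1"
  using assms(5-)
proof (induction n arbitrary: g)
  case 0
  from 0(2)[of 0] 0(4) show ?case by simp
next
  case (Suc n)
  let ?t = "(\<rho> + norm w) / (\<rho> - norm w)"
  show ?case
  proof (cases "\<exists>a. norm a < \<rho> \<and> g a = 0")
    case False
    have "norm (f w) * norm (g 0) powr ?t \<le> norm (f w) * norm (g w)"
    proof (intro mult_left_mono Harnack_zero_free w)
      show "g holomorphic_on ball 0 \<rho>"
        using Suc.prems(1) by (rule holomorphic_on_subset) (use \<rho> in auto)
    qed (use False Suc.prems(2) \<rho> in auto)
    also have "\<dots> \<le> 1" using Suc.prems(3)[of w] w \<rho> by (simp add: norm_mult)
    finally show ?thesis .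
  next
    case True
    then obtain a where a: "norm a < \<rho>" "g a = 0" by blast
    then have a1: "norm a < 1" using \<rho> by simp
    obtain k where k: "k holomorphic_on ball 0 1" "\<And>z. norm z < 1 \<Longrightarrow> norm (k z) \<le> 1"
        "\<And>z. norm z < 1 \<Longrightarrow> norm (f z * k z) \<le> 1" and g0: "norm (g 0) = norm (k 0) * norm a"
      using Blaschke_factor_divide_bounded[OF f Suc.prems(1-3) a1 a(2)] by blast
    have "\<rho> ^ n * \<rho> < norm (k 0) * \<rho>"
      using Suc.prems(4) a(1) mult_left_mono[of "norm a" \<rho> "norm (k 0)"] by (simp add: g0 mult.commute)
    then have "\<rho> ^ n < norm (k 0)" using \<rho> by simp
    then have "norm (f w) * norm (k 0) powr ?t \<le> 1" using Suc.IH k by blast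
    moreover have "?t \<ge> 0" using w \<rho> by simp
    then have "norm (f w) * norm (g 0) powr ?t \<le> norm (f w) * norm (k 0) powr ?t"
      using a1 by (intro mult_left_mono powr_mono2) (auto simp: g0 mult_left_le)
    ultimately show ?thesis by linarith
  qed
qed

lemma norm_mult_powr_le_1:
  assumes f: "f holomorphic_on ball 0 1" and g: "g holomorphic_on ball 0 1"
    and g_le: "\<And>z. norm z < 1 \<Longrightarrow> norm (g z) \<le> 1"
    and fg_le: "\<And>z. norm z < 1 \<Longrightarrow> norm (f z * g z) \<le> 1"
    and g0: "g 0 \<noteq> 0" and w: "norm w < 1"
  shows "norm (f w) * norm (g 0) powr ((1 + norm w) / (1 - norm w)) \<le> 1"
proof (rule tendsto_upperbound)
  show "((\<lambda>\<rho>. norm (f w) * norm (g 0) powr ((\<rho> + norm w) / (\<rho> - norm w)))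
      \<longlongrightarrow> norm (f w) * norm (g 0) powr ((1 + norm w) / (1 - norm w))) (at_left 1)"
    using w g0 by (intro tendsto_intros) auto
  show "\<forall>\<^sub>F \<rho> in at_left 1. norm (f w) * norm (g 0) powr ((\<rho> + norm w) / (\<rho> - norm w)) \<le> 1"
    using eventually_at_left_real[OF w]
  proof eventually_elim
    case (elim \<rho>)
    then have \<rho>: "norm w < \<rho>" "0 < \<rho>" "\<rho> < 1" by (auto intro: le_less_trans[OF norm_ge_zero])
    obtain n where "\<rho> ^ n < norm (g 0)"
      using real_arch_pow_inv[of "norm (g 0)" \<rho>] g0 \<rho> by auto
    then show ?case using norm_mult_powr_le_1_radius \<rho> f g g_le fg_le by blast
  qed
qed simp

definition half_plane_scale :: "complex \<Rightarrow> real" where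
  \<comment> \<open>twice the hyperbolic cosine of the hyperbolic distance from \<open>\<i>\<close> to \<open>z\<close>\<close>
  "half_plane_scale z = (1 + (norm z)\<^sup>2) / Im z"

definition half_plane_growth :: "(complex \<Rightarrow> complex) \<Rightarrow> bool" where
  "half_plane_growth f \<longleftrightarrow> (\<exists>C\<ge>0. \<forall>z\<in>UHP. norm (f z) \<le> exp (C * half_plane_scale z))"

definition cayley :: "complex \<Rightarrow> complex \<Rightarrow> complex" where
  "cayley z0 w = (z0 - cnj z0 * w) / (1 - w)"

lemma cayley_in_UHP:
  assumes "z0 \<in> UHP" "norm w < 1"
  shows "cayley z0 w \<in> UHP"
proof -
  have "Im (cayley z0 w) = Im ((z0 - cnj z0 * w) * cnj (1 - w)) / (norm (1 - w))\<^sup>2"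
    unfolding cayley_def by (subst complex_div_cnj) (simp add: Im_divide_of_real)
  also have "Im ((z0 - cnj z0 * w) * cnj (1 - w)) = Im z0 * (1 - (norm w)\<^sup>2)"
    unfolding cmod_power2 by (simp add: power2_eq_square algebra_simps)
  also have "0 < Im z0 * (1 - (norm w)\<^sup>2) / (norm (1 - w))\<^sup>2"
  proof -
    have "w \<noteq> 1" "(norm w)\<^sup>2 < 1" using assms(2) by (auto simp: abs_square_less_1)
    then show ?thesis using assms(1) by (simp add: UHP_def)
  qed
  finally show ?thesis by (simp add: UHP_def)
qed

lemma cayley_holomorphic: "cayley z0 holomorphic_on ball 0 1"
  unfolding cayley_def by (intro holomorphic_intros) auto

lemma cayley_preimage:
  assumes z0: "z0 \<in> UHP" and z: "z \<in> UHP"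
  obtains w where "norm w < 1" "cayley z0 w = z"
    "(1 + norm w) / (1 - norm w) \<le> (1 + (norm z0)\<^sup>2) / Im z0 * half_plane_scale z"
proof
  define w where "w = (z - z0) / (z - cnj z0)"
  have pos: "Im z0 > 0" "Im z > 0" using z0 z by (auto simp: UHP_def)
  have nz: "z - cnj z0 \<noteq> 0" "z0 - cnj z0 \<noteq> 0" using pos by (auto simp: complex_eq_iff)
  have "(norm (z - cnj z0))\<^sup>2 - (norm (z - z0))\<^sup>2 = 4 * Im z * Im z0"
    unfolding cmod_power2 by (simp add: power2_eq_square algebra_simps)
  then have w2: "1 - (norm w)\<^sup>2 = 4 * Im z * Im z0 / (norm (z - cnj z0))\<^sup>2"
    using nz by (simp add: w_def norm_divide power_divide diff_divide_eq_iff)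
  then have w2_pos: "0 < 1 - (norm w)\<^sup>2" using pos nz by simp
  then show w1: "norm w < 1" by (simp add: abs_square_less_1)
  have "1 - w = (z0 - cnj z0) / (z - cnj z0)" "z0 - cnj z0 * w = z * (z0 - cnj z0) / (z - cnj z0)"
    using nz by (simp_all add: w_def field_simps)
  then show "cayley z0 w = z" using nz by (simp add: cayley_def)
  have "(1 + norm w) / (1 - norm w) = (1 + norm w)\<^sup>2 / (1 - (norm w)\<^sup>2)"
    using w1 w2_pos by (simp add: frac_eq_eq) (simp add: power2_eq_square algebra_simps)
  also have "\<dots> \<le> 2\<^sup>2 / (1 - (norm w)\<^sup>2)"
    using w1 w2_pos by (intro divide_right_mono power_mono) auto
  also have "\<dots> = (norm (z - cnj z0))\<^sup>2 / (Im z0 * Im z)"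
    using pos nz by (simp add: w2)
  also have "\<dots> \<le> ((1 + (norm z0)\<^sup>2) * (1 + (norm z)\<^sup>2)) / (Im z0 * Im z)"
  proof (rule divide_right_mono)
    have "norm (z - cnj z0) \<le> norm z + norm z0" using norm_triangle_ineq4[of z "cnj z0"] by simp
    then have "(norm (z - cnj z0))\<^sup>2 \<le> (norm z + norm z0)\<^sup>2" by (simp add: power_mono)
    also have "\<dots> \<le> (1 + (norm z0)\<^sup>2) * (1 + (norm z)\<^sup>2)"
      using zero_le_power2[of "1 - norm z * norm z0"] by (simp add: power2_eq_square algebra_simps)
    finally show "(norm (z - cnj z0))\<^sup>2 \<le> \<dots>" .
  qed (use pos in simp)
  finally show "(1 + norm w) / (1 - norm w) \<le> (1 + (norm z0)\<^sup>2) / Im z0 * half_plane_scale z"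
    by (simp add: half_plane_scale_def)
qed

lemma bounded_type_imp_half_plane_growth:
  assumes bt: "bounded_type h" and hol: "h holomorphic_on UHP"
  shows "half_plane_growth h"
proof -
  obtain f g where f: "f holomorphic_on UHP" "bounded (f ` UHP)"
    and g: "g holomorphic_on UHP" "bounded (g ` UHP)" and "\<exists>z\<in>UHP. g z \<noteq> 0"
    and hg: "\<And>z. z \<in> UHP \<Longrightarrow> h z * g z = f z"
    using bt unfolding bounded_type_def by blast
  then obtain z0 where z0: "z0 \<in> UHP" "g z0 \<noteq> 0" by blast
  obtain B where B: "B > 0" "\<And>z. z \<in> UHP \<Longrightarrow> norm (f z) \<le> B \<and> norm (g z) \<le> B"
    using f(2) g(2) bounded_Un[of "f ` UHP" "g ` UHP"] unfolding bounded_pos by auto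
  define L where "L = - ln (norm (g z0) / B)"
  have L: "L \<ge> 0" using B(2)[OF z0(1)] B(1) z0(2) by (simp add: L_def)
  define C where "C = L * ((1 + (norm z0)\<^sup>2) / Im z0)"
  have "norm (h z) \<le> exp (C * half_plane_scale z)" if "z \<in> UHP" for z
  proof -
    obtain w where w: "norm w < 1" "cayley z0 w = z"
      "(1 + norm w) / (1 - norm w) \<le> (1 + (norm z0)\<^sup>2) / Im z0 * half_plane_scale z"
      using cayley_preimage[OF z0(1) \<open>z \<in> UHP\<close>] by blast
    have comp: "(\<lambda>w. k (cayley z0 w)) holomorphic_on ball 0 1" if "k holomorphic_on UHP" for k
      by (rule holomorphic_on_compose_gen[OF cayley_holomorphic that, unfolded o_def])
         (use cayley_in_UHP[OF z0(1)] in auto)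
    have cayley_0: "cayley z0 0 = z0" by (simp add: cayley_def)
    let ?t = "(1 + norm w) / (1 - norm w)"
    have "norm (h (cayley z0 w)) * norm (g (cayley z0 0) / B) powr ?t \<le> 1"
      by (rule norm_mult_powr_le_1[where f = "\<lambda>w. h (cayley z0 w)" and g = "\<lambda>w. g (cayley z0 w) / B"])
         (use B hg cayley_in_UHP[OF z0(1)] z0(2) w(1) in
           \<open>auto intro!: holomorphic_intros comp hol g(1) simp: norm_divide cayley_0\<close>)
    then have "norm (h z) * exp (- (?t * L)) \<le> 1"
      using B(1) z0(2) by (simp add: w(2) cayley_0 powr_def L_def norm_divide)
    then have "norm (h z) \<le> exp (?t * L)" by (simp add: exp_minus field_simps)
    also have "?t * L \<le> C * half_plane_scale z"
      using mult_right_mono[OF w(3) L] by (simp add: C_def mult_ac)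
    finally show ?thesis by simp
  qed
  moreover have "C \<ge> 0" using L z0(1) by (simp add: C_def UHP_def)
  ultimately show ?thesis unfolding half_plane_growth_def by blast
qed

subsection \<open>Phragmen--Lindelof principles\<close>

lemma continuous_on_mult_vanishing:
  fixes f g :: "'a::metric_space \<Rightarrow> 'b::real_normed_algebra"
  assumes f: "continuous_on (T - P) f" and bdd: "\<And>x. x \<in> T - P \<Longrightarrow> norm (f x) \<le> B"
    and g: "continuous_on T g" and zero: "\<And>x. x \<in> P \<Longrightarrow> g x = 0" and P: "closed P"
  shows "continuous_on T (\<lambda>x. if x \<in> P then 0 else f x * g x)"
  unfolding continuous_on_eq_continuous_within
proof
  let ?h = "\<lambda>x. if x \<in> P then 0 else f x * g x"
  fix x assume x: "x \<in> T"
  show "continuous (at x within T) ?h"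
  proof (cases "x \<in> P")
    case True
    have "((\<lambda>w. \<bar>B\<bar> * norm (g w)) \<longlongrightarrow> \<bar>B\<bar> * norm (g x)) (at x within T)"
      using g x by (intro tendsto_intros) (simp add: continuous_on)
    then have lim: "((\<lambda>w. \<bar>B\<bar> * norm (g w)) \<longlongrightarrow> 0) (at x within T)" using True by (simp add: zero)
    have "norm (?h w) \<le> \<bar>B\<bar> * norm (g w)" if "w \<in> T" for w
    proof (cases "w \<in> P")
      case False
      then have "norm (f w) * norm (g w) \<le> \<bar>B\<bar> * norm (g w)"
        using bdd[of w] that by (intro mult_right_mono) auto
      then show ?thesis using False norm_mult_ineq[of "f w" "g w"] by simp
    qed simp
    then have "\<forall>\<^sub>F w in at x within T. norm (?h w) \<le> \<bar>B\<bar> * norm (g w)"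
      unfolding eventually_at_filter by (intro always_eventually) simp
    then have "(?h \<longlongrightarrow> 0) (at x within T)" by (rule Lim_null_comparison[OF _ lim])
    then show ?thesis using True by (simp add: continuous_within)
  next
    case False
    have "continuous_on (T - P) (\<lambda>x. f x * g x)"
      by (intro continuous_on_mult f continuous_on_subset[OF g]) auto
    then have "continuous_on (T - P) ?h" by (rule continuous_on_eq) auto
    then have "continuous (at x within T - P) ?h"
      using False x by (auto simp: continuous_on_eq_continuous_within)
    moreover have "at x within T - P = at x within T"
      using False P by (intro at_within_nhd[where S = "- P"]) auto
    ultimately show ?thesis by simp
  qed
qed

lemma maximum_modulus_frontier_mult_vanishing:
  fixes f p :: "complex \<Rightarrow> complex"
  assumes V: "open V" "bounded V" and P: "closed P" "P \<inter> V = {}"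
    and hol: "f holomorphic_on V" "p holomorphic_on V"
    and cont: "continuous_on (closure V - P) f" "continuous_on (closure V) p"
    and bdd: "\<And>z. z \<in> closure V - P \<Longrightarrow> norm (f z) \<le> B"
    and fr: "\<And>z. z \<in> frontier V - P \<Longrightarrow> norm (f z) \<le> 1"
    and zero: "\<And>z. z \<in> P \<Longrightarrow> p z = 0" and D: "0 \<le> D" "\<And>z. z \<in> frontier V \<Longrightarrow> norm (p z) \<le> D"
    and z: "z \<in> V"
  shows "norm (f z * p z) \<le> D"
proof -
  define G where "G w = (if w \<in> P then 0 else f w * p w)" for w
  have "norm (G z) \<le> D"
  proof (rule maximum_modulus_frontier[where f = G and S = V])
    have "G holomorphic_on V \<longleftrightarrow> (\<lambda>w. f w * p w) holomorphic_on V"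
      by (rule holomorphic_cong) (use P in \<open>auto simp: G_def\<close>)
    then show "G holomorphic_on interior V"
      using hol V by (auto simp: interior_open intro!: holomorphic_intros)
    show "continuous_on (closure V) G"
      unfolding G_def by (rule continuous_on_mult_vanishing[OF cont(1) bdd cont(2) zero P(1)])
    show "norm (G w) \<le> D" if w: "w \<in> frontier V" for w
    proof (cases "w \<in> P")
      case False
      then have "norm (f w) * norm (p w) \<le> 1 * D"
        using fr[of w] D(2) w by (intro mult_mono) auto
      then show ?thesis using False by (simp add: G_def norm_mult)
    qed (use D in \<open>simp add: G_def\<close>)
  qed (use V z in auto)
  moreover have "z \<notin> P" using P(2) z by auto
  ultimately show ?thesis by (simp add: G_def)
qed

text \<open>The maximum principle is applied to \<open>f ^ n\<close> times the polynomial with zero set \<open>P\<close>, and \<open>n\<close>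
  tends to infinity.\<close>
lemma maximum_modulus_frontier_finite_exceptions:
  fixes f :: "complex \<Rightarrow> complex"
  assumes V: "open V" "bounded V" and P: "finite P" "P \<inter> V = {}"
    and hol: "f holomorphic_on V" and cont: "continuous_on (closure V - P) f"
    and bdd: "\<And>z. z \<in> closure V - P \<Longrightarrow> norm (f z) \<le> B"
    and fr: "\<And>z. z \<in> frontier V - P \<Longrightarrow> norm (f z) \<le> S"
    and S: "S > 0" and z: "z \<in> V"
  shows "norm (f z) \<le> S"
proof (rule ccontr)
  assume neg: "\<not> norm (f z) \<le> S"
  define p where "p w = (\<Prod>a\<in>P. w - a)" for w
  have p_zero: "p w = 0 \<longleftrightarrow> w \<in> P" for w using P(1) by (auto simp: p_def)
  have cont_p: "continuous_on X p" for X unfolding p_def by (intro continuous_intros)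
  have "bounded (p ` closure V)"
    using V by (intro compact_imp_bounded compact_continuous_image cont_p) (simp add: compact_closure)
  then obtain D where D: "D > 0" "\<And>w. w \<in> closure V \<Longrightarrow> norm (p w) \<le> D"
    unfolding bounded_pos by auto
  have power_bound: "(norm (f z) / S) ^ n * norm (p z) \<le> D" for n
  proof -
    have "norm ((f z / S) ^ n * p z) \<le> D"
    proof (rule maximum_modulus_frontier_mult_vanishing[where f = "\<lambda>w. (f w / S) ^ n", OF V _ P(2)])
      show "p holomorphic_on V" unfolding p_def by (intro holomorphic_intros)
      show "norm ((f w / S) ^ n) \<le> (B / S) ^ n" if "w \<in> closure V - P" for w
        using bdd[OF that] S by (simp add: norm_power norm_divide power_mono divide_right_mono)
      show "norm ((f w / S) ^ n) \<le> 1" if "w \<in> frontier V - P" for w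
        using fr[OF that] S by (simp add: norm_power norm_divide power_le_one)
      show "norm (p w) \<le> D" if "w \<in> frontier V" for w
        using D(2)[of w] that by (simp add: frontier_def)
    qed (use S P(1) p_zero cont_p hol cont D(1) z in
        \<open>auto intro!: continuous_intros holomorphic_intros finite_imp_closed\<close>)
    then show ?thesis using S by (simp add: norm_mult norm_power norm_divide)
  qed
  have "1 < norm (f z) / S" using neg S by simp
  then obtain n where "D / norm (p z) < (norm (f z) / S) ^ n"
    using real_arch_pow by blast
  moreover have "0 < norm (p z)" using P(2) z p_zero by auto
  ultimately show False using power_bound[of n] by (simp add: field_simps)
qed

abbreviation closed_UHP :: "complex set" where
  "closed_UHP \<equiv> {z. 0 \<le> Im z}"

abbreviation quadrant :: "complex set" where
  "quadrant \<equiv> {z. 0 < Re z \<and> 0 < Im z}"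

abbreviation closed_quadrant :: "complex set" where
  "closed_quadrant \<equiv> {z. 0 \<le> Re z \<and> 0 \<le> Im z}"

lemma closed_UHP_cases:
  assumes "0 \<le> Im z"
  obtains (interior) "z \<in> UHP" | (real) x where "z = complex_of_real x"
proof (cases "Im z = 0")
  case True
  then have "z = complex_of_real (Re z)" by (simp add: complex_eq_iff)
  then show thesis by (rule real)
qed (use assms interior in \<open>simp add: UHP_def\<close>)

lemma Im_divide_power2_diff_nonpos:
  fixes \<rho> :: real
  assumes "0 \<le> Im u"
  shows "Im (2 * u / (u\<^sup>2 - \<rho>\<^sup>2)) \<le> 0"
proof -
  have "Im (2 * u / (u\<^sup>2 - \<rho>\<^sup>2)) = Im (2 * u * cnj (u\<^sup>2 - \<rho>\<^sup>2)) / (norm (u\<^sup>2 - \<rho>\<^sup>2))\<^sup>2"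
    by (subst complex_div_cnj) (simp add: Im_divide_of_real)
  also have "Im (2 * u * cnj (u\<^sup>2 - \<rho>\<^sup>2)) = - (2 * Im u * ((norm u)\<^sup>2 + \<rho>\<^sup>2))"
    unfolding cmod_power2 by (simp add: power2_eq_square algebra_simps)
  also have "\<dots> / (norm (u\<^sup>2 - \<rho>\<^sup>2))\<^sup>2 \<le> 0"
    using assms by (intro divide_nonpos_nonneg) auto
  finally show ?thesis .
qed

lemma divide_power2_diff_on_circle:
  assumes "norm u = \<rho>" "Im u \<noteq> 0"
  shows "2 * u / (u\<^sup>2 - (complex_of_real \<rho>)\<^sup>2) = - \<i> / Im u"
proof -
  have "(complex_of_real \<rho>)\<^sup>2 = u * cnj u"
    using assms(1) complex_norm_square[of u] by simp
  then have "u\<^sup>2 - (complex_of_real \<rho>)\<^sup>2 = u * (u - cnj u)"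
    by (simp add: power2_eq_square algebra_simps)
  moreover have "u \<noteq> 0" using assms(2) by auto
  ultimately show ?thesis
    using assms(2) by (simp add: complex_diff_cnj divide_simps)
qed

text \<open>With \<open>u = w\<^sup>2\<close>, the multiplier has modulus at most 1 in the quadrant and exactly
  \<open>exp (- M / Im u)\<close> on the arc \<open>|w| = R\<close>, which compensates the growth of a function of modulus at
  most \<open>exp (M / Im u)\<close> there.\<close>
definition arc_multiplier :: "real \<Rightarrow> real \<Rightarrow> complex \<Rightarrow> complex" where
  "arc_multiplier M R w = exp (- \<i> * M * (2 * w\<^sup>2 / ((w\<^sup>2)\<^sup>2 - (complex_of_real (R\<^sup>2))\<^sup>2)))"

lemma norm_arc_multiplier:
  "norm (arc_multiplier M R w) = exp (M * Im (2 * w\<^sup>2 / ((w\<^sup>2)\<^sup>2 - (complex_of_real (R\<^sup>2))\<^sup>2)))"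
proof -
  have "Re (- \<i> * M * u) = M * Im u" for u by simp
  then show ?thesis unfolding arc_multiplier_def norm_exp_eq_Re by (simp only:)
qed

lemma norm_arc_multiplier_le_1:
  assumes "0 \<le> M" "w \<in> closed_quadrant"
  shows "norm (arc_multiplier M R w) \<le> 1"
proof -
  have "0 \<le> Im (w\<^sup>2)" using assms(2) by (simp add: power2_eq_square)
  then have "Im (2 * w\<^sup>2 / ((w\<^sup>2)\<^sup>2 - (complex_of_real (R\<^sup>2))\<^sup>2)) \<le> 0"
    using Im_divide_power2_diff_nonpos[of "w\<^sup>2" "R\<^sup>2"] by simp
  then show ?thesis using assms(1) by (simp add: norm_arc_multiplier mult_nonneg_nonpos)
qed

lemma norm_arc_multiplier_on_arc:
  assumes "w \<in> quadrant" "norm w = R"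
  shows "norm (arc_multiplier M R w) = exp (- (M / Im (w\<^sup>2)))"
proof -
  have "Im (w\<^sup>2) \<noteq> 0" using assms(1) by (simp add: power2_eq_square)
  then have "2 * w\<^sup>2 / ((w\<^sup>2)\<^sup>2 - (complex_of_real (R\<^sup>2))\<^sup>2) = - \<i> / Im (w\<^sup>2)"
    using assms(2) by (intro divide_power2_diff_on_circle) (simp_all add: norm_power)
  then show ?thesis by (simp add: norm_arc_multiplier)
qed

lemma norm_arc_multiplier_ge:
  assumes "0 \<le> M" "norm z < R"
  shows "exp (- (M * (2 * (norm z)\<^sup>2 / (R ^ 4 - (norm z) ^ 4)))) \<le> norm (arc_multiplier M R z)"
proof -
  define k where "k = 2 * z\<^sup>2 / ((z\<^sup>2)\<^sup>2 - (complex_of_real (R\<^sup>2))\<^sup>2)"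
  have "R ^ 4 - (norm z) ^ 4 \<le> norm ((z\<^sup>2)\<^sup>2 - (complex_of_real (R\<^sup>2))\<^sup>2)"
    using norm_triangle_ineq2[of "(complex_of_real (R\<^sup>2))\<^sup>2" "(z\<^sup>2)\<^sup>2"]
    by (simp add: norm_minus_commute norm_power flip: power_mult)
  moreover have "0 < R ^ 4 - (norm z) ^ 4" using assms(2) by (simp add: power_strict_mono)
  ultimately have "norm k \<le> 2 * (norm z)\<^sup>2 / (R ^ 4 - (norm z) ^ 4)"
    unfolding k_def norm_divide norm_mult by (intro frac_le) (auto simp: norm_power)
  then have "- (2 * (norm z)\<^sup>2 / (R ^ 4 - (norm z) ^ 4)) \<le> Im k"
    using abs_Im_le_cmod[of k] by linarith
  then have "M * - (2 * (norm z)\<^sup>2 / (R ^ 4 - (norm z) ^ 4)) \<le> M * Im k"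
    using assms(1) by (rule mult_left_mono)
  then show ?thesis by (simp add: norm_arc_multiplier k_def)
qed

lemma arc_multiplier_pole:
  assumes "w \<in> closed_quadrant - {complex_of_real R, \<i> * R}" "R > 0"
  shows "(w\<^sup>2)\<^sup>2 - (complex_of_real (R\<^sup>2))\<^sup>2 \<noteq> 0"
proof
  assume "(w\<^sup>2)\<^sup>2 - (complex_of_real (R\<^sup>2))\<^sup>2 = 0"
  then have "w\<^sup>2 = complex_of_real (R\<^sup>2) \<or> w\<^sup>2 = - complex_of_real (R\<^sup>2)"
    by (simp only: right_minus_eq power2_eq_iff)
  then have "w\<^sup>2 = (complex_of_real R)\<^sup>2 \<or> w\<^sup>2 = (\<i> * R)\<^sup>2"
    by (simp add: power_mult_distrib)
  then have "w = R \<or> w = - R \<or> w = \<i> * R \<or> w = - (\<i> * R)" by (auto simp: power2_eq_iff)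
  then show False using assms by auto
qed

lemma arc_multiplier_holomorphic:
  assumes "S \<subseteq> closed_quadrant - {complex_of_real R, \<i> * R}" "R > 0"
  shows "arc_multiplier M R holomorphic_on S"
  unfolding arc_multiplier_def[abs_def]
  by (intro holomorphic_intros arc_multiplier_pole[OF _ assms(2)] subsetD[OF assms(1)])

lemma closed_quadrant_cases:
  assumes "w \<in> closed_quadrant"
  obtains (real) x where "0 \<le> x" "w = complex_of_real x" | (imag) y where "0 \<le> y" "w = \<i> * complex_of_real y"
    | (interior) "w \<in> quadrant"
proof -
  consider "Im w = 0" | "Re w = 0" | "w \<in> quadrant" using assms by force
  then show thesis
  proof cases
    case 1
    then have "w = complex_of_real (Re w)" by (simp add: complex_eq_iff)
    then show thesis using assms by (intro real[of "Re w"]) auto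
  next
    case 2
    then have "w = \<i> * complex_of_real (Im w)" by (simp add: complex_eq_iff)
    then show thesis using assms by (intro imag[of "Im w"]) auto
  qed (rule interior)
qed

lemma open_quarter_disc: "open (quadrant \<inter> ball 0 R)"
  by (intro open_Int open_Collect_conj open_Collect_less continuous_intros open_ball)

lemma compact_quarter_disc: "compact (closed_quadrant \<inter> cball 0 R)"
  by (intro closed_Int_compact closed_Collect_conj closed_Collect_le continuous_intros compact_cball)

lemma quarter_disc_bound:
  fixes g :: "complex \<Rightarrow> complex"
  assumes cont: "continuous_on closed_quadrant g" and hol: "g holomorphic_on quadrant"
    and real: "\<And>x. 0 \<le> x \<Longrightarrow> norm (g (complex_of_real x)) \<le> S"
    and imag: "\<And>y. 0 \<le> y \<Longrightarrow> norm (g (\<i> * complex_of_real y)) \<le> S"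
    and arc: "\<And>w. w \<in> quadrant \<Longrightarrow> norm w = R \<Longrightarrow> norm (g w) \<le> exp (M / Im (w\<^sup>2))"
    and S: "S \<ge> 1" and M: "M \<ge> 0" and z: "z \<in> quadrant" "norm z < R"
  shows "norm (g z) \<le> S * exp (M * (2 * (norm z)\<^sup>2 / (R ^ 4 - (norm z) ^ 4)))"
proof -
  have R: "R > 0" using z(2) norm_ge_zero[of z] by linarith
  let ?m = "arc_multiplier M R"
  define V Q P where "V = quadrant \<inter> ball 0 R" and "Q = closed_quadrant \<inter> cball 0 R"
    and "P = {complex_of_real R, \<i> * R}"
  have V: "open V" "bounded V" unfolding V_def by (auto intro: open_quarter_disc bounded_Int)
  have V_subset: "V \<subseteq> Q - P" using R by (auto simp: V_def Q_def P_def)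
  have compact_Q: "compact Q" unfolding Q_def by (rule compact_quarter_disc)
  have closure_V: "closure V \<subseteq> Q"
    using V_subset compact_imp_closed[OF compact_Q] by (intro closure_minimal) auto
  have cont_Q: "continuous_on Q g" by (rule continuous_on_subset[OF cont]) (auto simp: Q_def)
  have "bounded (g ` Q)" by (intro compact_imp_bounded compact_continuous_image cont_Q compact_Q)
  then obtain B where B: "\<And>w. w \<in> Q \<Longrightarrow> norm (g w) \<le> B" by (auto simp: bounded_iff)
  have hol_m: "?m holomorphic_on X" if "X \<subseteq> Q - P" for X
    using that R by (intro arc_multiplier_holomorphic) (auto simp: Q_def P_def)
  have norm_gm: "norm (g w * ?m w) \<le> norm (g w)" if "w \<in> Q" for w
    unfolding norm_mult using M that by (intro mult_left_le norm_arc_multiplier_le_1) (auto simp: Q_def)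
  have "norm (g z * ?m z) \<le> S"
  proof (rule maximum_modulus_frontier_finite_exceptions[where f = "\<lambda>w. g w * ?m w" and P = P, OF V])
    show "(\<lambda>w. g w * ?m w) holomorphic_on V"
      by (intro holomorphic_on_mult holomorphic_on_subset[OF hol] hol_m V_subset) (auto simp: V_def)
    show "continuous_on (closure V - P) (\<lambda>w. g w * ?m w)"
      using closure_V
      by (intro continuous_on_mult continuous_on_subset[OF cont_Q] holomorphic_on_imp_continuous_on hol_m) auto
    show "norm (g w * ?m w) \<le> B" if "w \<in> closure V - P" for w
      using order_trans[OF norm_gm B] that closure_V by auto
    show "norm (g w * ?m w) \<le> S" if "w \<in> frontier V - P" for w
    proof -
      have w: "w \<in> Q" "w \<notin> V" using that closure_V V by (auto simp: frontier_def interior_open)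
      from w(1) have "w \<in> closed_quadrant" by (simp add: Q_def)
      then show ?thesis
      proof (cases rule: closed_quadrant_cases)
        case interior
        then have "norm w = R" using w by (auto simp: V_def Q_def)
        then have "norm (g w * ?m w) \<le> exp (M / Im (w\<^sup>2)) * exp (- (M / Im (w\<^sup>2)))"
          using arc interior by (simp add: norm_mult norm_arc_multiplier_on_arc)
        then show ?thesis using S by (simp flip: exp_add)
      qed (use order_trans[OF norm_gm[OF w(1)]] real imag in auto)
    qed
  qed (use z S R in \<open>auto simp: V_def P_def\<close>)
  moreover have "norm (g z) * exp (- (M * (2 * (norm z)\<^sup>2 / (R ^ 4 - (norm z) ^ 4)))) \<le> norm (g z * ?m z)"
    unfolding norm_mult by (intro mult_left_mono norm_arc_multiplier_ge M z(2)) simp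
  ultimately have "norm (g z) * exp (- (M * (2 * (norm z)\<^sup>2 / (R ^ 4 - (norm z) ^ 4)))) \<le> S"
    by linarith
  then show ?thesis by (simp add: exp_minus field_simps)
qed

lemma Phragmen_Lindelof_quadrant:
  fixes g :: "complex \<Rightarrow> complex"
  assumes cont: "continuous_on closed_quadrant g" and hol: "g holomorphic_on quadrant"
    and real: "\<And>x. 0 \<le> x \<Longrightarrow> norm (g (complex_of_real x)) \<le> S"
    and imag: "\<And>y. 0 \<le> y \<Longrightarrow> norm (g (\<i> * complex_of_real y)) \<le> S"
    and growth: "\<And>w. w \<in> quadrant \<Longrightarrow> norm (g w) \<le> exp (M (norm w) / Im (w\<^sup>2))"
    and M: "\<And>R. 0 \<le> R \<Longrightarrow> 0 \<le> M R" "((\<lambda>R. M R / R ^ 4) \<longlongrightarrow> 0) at_top"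
    and S: "S \<ge> 1" and z: "z \<in> quadrant"
  shows "norm (g z) \<le> S"
proof -
  define a where "a = norm z"
  have "((\<lambda>R. R ^ 4 * (2 * a\<^sup>2 / (R ^ 4 - a ^ 4))) \<longlongrightarrow> 2 * a\<^sup>2) at_top" by real_asymp
  with M(2) have "((\<lambda>R. M R / R ^ 4 * (R ^ 4 * (2 * a\<^sup>2 / (R ^ 4 - a ^ 4)))) \<longlongrightarrow> 0 * (2 * a\<^sup>2)) at_top"
    by (rule tendsto_mult)
  then have "((\<lambda>R. S * exp (M R / R ^ 4 * (R ^ 4 * (2 * a\<^sup>2 / (R ^ 4 - a ^ 4)))))
      \<longlongrightarrow> S * exp (0 * (2 * a\<^sup>2))) at_top"
    by (intro tendsto_mult_left tendsto_exp)
  moreover have "\<forall>\<^sub>F R in at_top. norm (g z) \<le> S * exp (M R / R ^ 4 * (R ^ 4 * (2 * a\<^sup>2 / (R ^ 4 - a ^ 4))))"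
    using eventually_gt_at_top[of a] eventually_gt_at_top[of 0]
  proof eventually_elim
    case (elim R)
    have "norm (g z) \<le> S * exp (M R * (2 * a\<^sup>2 / (R ^ 4 - a ^ 4)))"
      unfolding a_def
      by (rule quarter_disc_bound[OF cont hol real imag _ S]) (use growth M z elim in \<open>auto simp: a_def\<close>)
    then show ?case using elim by simp
  qed
  ultimately have "norm (g z) \<le> S * exp (0 * (2 * a\<^sup>2))" by (intro tendsto_lowerbound) auto
  then show ?thesis by simp
qed

lemma half_plane_scale_ge:
  assumes "z \<in> UHP"
  shows "2 \<le> half_plane_scale z" "norm z \<le> half_plane_scale z" "1 / Im z \<le> half_plane_scale z"
proof -
  have y: "0 < Im z" "Im z \<le> norm z" using abs_Im_le_cmod[of z] assms by (auto simp: UHP_def)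
  have "2 * norm z \<le> 1 + (norm z)\<^sup>2" using sum_squares_bound[of 1 "norm z"] by simp
  then show "2 \<le> half_plane_scale z" using y by (simp add: half_plane_scale_def le_divide_eq)
  have "norm z * Im z \<le> norm z * norm z" using y by (intro mult_left_mono) auto
  then show "norm z \<le> half_plane_scale z" using y
    by (simp add: half_plane_scale_def field_simps power2_eq_square)
  show "1 / Im z \<le> half_plane_scale z" using y by (simp add: half_plane_scale_def divide_right_mono)
qed

lemma half_plane_scale_le_off_imag_axis:
  assumes w: "Re w \<noteq> 0" "0 < Im w"
  shows "half_plane_scale w \<le> 2 * (1 + (norm w)\<^sup>2) * norm w / (2 * \<bar>Re w\<bar> * Im w)"
proof -
  have "half_plane_scale w * 1 \<le> half_plane_scale w * (norm w / \<bar>Re w\<bar>)"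
    using w abs_Re_le_cmod[of w] by (intro mult_left_mono) (auto simp: half_plane_scale_def)
  then show ?thesis using w by (simp add: half_plane_scale_def field_simps)
qed

lemma Phragmen_Lindelof_quadrant_cubic:
  assumes "continuous_on closed_quadrant g" "g holomorphic_on quadrant"
    and "\<And>x. 0 \<le> x \<Longrightarrow> norm (g (complex_of_real x)) \<le> S"
    and "\<And>y. 0 \<le> y \<Longrightarrow> norm (g (\<i> * complex_of_real y)) \<le> S"
    and "\<And>w. w \<in> quadrant \<Longrightarrow> norm (g w) \<le> exp (C * (2 * (1 + (norm w)\<^sup>2) * norm w) / Im (w\<^sup>2))"
    and C: "0 \<le> C" and "S \<ge> 1" "z \<in> quadrant"
  shows "norm (g z) \<le> S"
proof (rule Phragmen_Lindelof_quadrant[where g = g and M = "\<lambda>R. C * (2 * (1 + R\<^sup>2) * R)"])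
  show "((\<lambda>R. C * (2 * (1 + R\<^sup>2) * R) / R ^ 4) \<longlongrightarrow> 0) at_top" by real_asymp
qed (use assms in auto)

lemma Phragmen_Lindelof_axes:
  assumes cont: "continuous_on closed_UHP g" and hol: "g holomorphic_on UHP"
    and growth: "half_plane_growth g"
    and real: "\<And>x. norm (g (complex_of_real x)) \<le> S"
    and imag: "\<And>y. 0 \<le> y \<Longrightarrow> norm (g (\<i> * complex_of_real y)) \<le> S"
    and S: "S \<ge> 1" and z: "0 \<le> Im z"
  shows "norm (g z) \<le> S"
proof -
  obtain C where C: "C \<ge> 0" "\<And>z. z \<in> UHP \<Longrightarrow> norm (g z) \<le> exp (C * half_plane_scale z)"
    using growth unfolding half_plane_growth_def by blast
  have off_axis: "norm (g w) \<le> exp (C * (2 * (1 + (norm w)\<^sup>2) * norm w) / (2 * \<bar>Re w\<bar> * Im w))"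
    if w: "Re w \<noteq> 0" "0 < Im w" for w
    using C(2)[of w] w mult_left_mono[OF half_plane_scale_le_off_imag_axis[OF w] C(1)]
    by (simp add: UHP_def order_trans)
  have right: "norm (g w) \<le> S" if "w \<in> quadrant" for w
  proof (rule Phragmen_Lindelof_quadrant_cubic[OF _ _ real imag _ C(1) S that])
    show "norm (g w) \<le> exp (C * (2 * (1 + (norm w)\<^sup>2) * norm w) / Im (w\<^sup>2))" if "w \<in> quadrant" for w
      using off_axis[of w] that by (simp add: power2_eq_square mult_ac)
  qed (auto simp: UHP_def intro: continuous_on_subset[OF cont] holomorphic_on_subset[OF hol])
  have left: "norm (g (\<i> * w)) \<le> S" if "w \<in> quadrant" for w
  proof (rule Phragmen_Lindelof_quadrant_cubic[where g = "\<lambda>w. g (\<i> * w)", OF _ _ imag _ _ C(1) S that])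
    show "continuous_on closed_quadrant (\<lambda>w. g (\<i> * w))"
      by (rule continuous_on_compose2[OF cont]) (auto intro!: continuous_intros)
    show "(\<lambda>w. g (\<i> * w)) holomorphic_on quadrant"
      by (rule holomorphic_on_compose_gen[OF _ hol, unfolded o_def])
         (auto simp: UHP_def intro!: holomorphic_intros)
    show "norm (g (\<i> * w)) \<le> exp (C * (2 * (1 + (norm w)\<^sup>2) * norm w) / Im (w\<^sup>2))" if "w \<in> quadrant" for w
      using off_axis[of "\<i> * w"] that by (simp add: norm_mult power2_eq_square mult_ac)
    show "norm (g (\<i> * (\<i> * complex_of_real y))) \<le> S" for y
      using real[of "- y"] by (simp flip: mult.assoc)
  qed
  show ?thesis
  proof (cases "0 \<le> Re z")
    case True
    then have "z \<in> closed_quadrant" using z by simp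
    then show ?thesis by (cases rule: closed_quadrant_cases) (use real imag right in auto)
  next
    case False
    then have "- \<i> * z \<in> closed_quadrant" using z by simp
    then have "norm (g (\<i> * (- \<i> * z))) \<le> S"
    proof (cases rule: closed_quadrant_cases)
      case (imag y)
      then show ?thesis using real[of "- y"] by (simp only:) (simp flip: mult.assoc)
    next
      case (real x)
      then show ?thesis using imag[of x] by (simp only:)
    qed (rule left)
    then show ?thesis by (simp flip: mult.assoc)
  qed
qed

lemma Phragmen_Lindelof_bounded:
  assumes cont: "continuous_on closed_UHP g" and hol: "g holomorphic_on UHP"
    and bdd: "\<And>z. 0 \<le> Im z \<Longrightarrow> norm (g z) \<le> B"
    and real: "\<And>x. norm (g (complex_of_real x)) \<le> S" and S: "S \<ge> 1" and z: "0 \<le> Im z"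
  shows "norm (g z) \<le> S"
  using z
proof (cases rule: closed_UHP_cases)
  case interior
  define L where "L = ln (max B 1)"
  have Im_square: "0 < Im (w\<^sup>2)" "Im (w\<^sup>2) \<le> (norm w)\<^sup>2" if "w \<in> quadrant" for w
    using that abs_Im_le_cmod[of "w\<^sup>2"] by (auto simp: norm_power) (simp add: power2_eq_square)
  have "norm (g ((csqrt z)\<^sup>2)) \<le> S"
  proof (rule Phragmen_Lindelof_quadrant[where g = "\<lambda>w. g (w\<^sup>2)" and M = "\<lambda>R. L * R\<^sup>2"])
    show "continuous_on closed_quadrant (\<lambda>w. g (w\<^sup>2))"
      by (rule continuous_on_compose2[OF cont]) (auto simp: power2_eq_square intro!: continuous_intros)
    show "(\<lambda>w. g (w\<^sup>2)) holomorphic_on quadrant"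
      by (rule holomorphic_on_compose_gen[OF _ hol, unfolded o_def])
         (use Im_square in \<open>auto simp: UHP_def intro!: holomorphic_intros\<close>)
    show "norm (g ((complex_of_real x)\<^sup>2)) \<le> S" for x using real[of "x\<^sup>2"] by simp
    show "norm (g ((\<i> * complex_of_real y)\<^sup>2)) \<le> S" for y
      using real[of "- y\<^sup>2"] by (simp add: power_mult_distrib)
    show "norm (g (w\<^sup>2)) \<le> exp (L * (norm w)\<^sup>2 / Im (w\<^sup>2))" if "w \<in> quadrant" for w
    proof -
      have "L * Im (w\<^sup>2) \<le> L * (norm w)\<^sup>2"
        using Im_square[OF that] by (intro mult_left_mono) (auto simp: L_def)
      then have "exp L \<le> exp (L * (norm w)\<^sup>2 / Im (w\<^sup>2))"
        using Im_square(1)[OF that] by (simp add: le_divide_eq)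
      moreover have "norm (g (w\<^sup>2)) \<le> exp L" using bdd[of "w\<^sup>2"] Im_square(1)[OF that] by (simp add: L_def)
      ultimately show ?thesis by linarith
    qed
    show "((\<lambda>R. L * R\<^sup>2 / R ^ 4) \<longlongrightarrow> 0) at_top" by real_asymp
    have "0 < Im z" using interior by (simp add: UHP_def)
    then have "0 < 2 * Re (csqrt z) * Im (csqrt z)"
      using arg_cong[OF power2_csqrt[of z], of Im] by (simp add: power2_eq_square)
    moreover have "0 \<le> Re (csqrt z)" using csqrt_principal[of z] by auto
    ultimately show "csqrt z \<in> quadrant" by (auto simp: zero_less_mult_iff)
  qed (use S in \<open>auto simp: L_def\<close>)
  then show ?thesis by simp
qed (use real in simp)

subsection \<open>Tame functions on the upper half-plane\<close>

definition imag_axis_subexp :: "(complex \<Rightarrow> complex) \<Rightarrow> bool" where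
  "imag_axis_subexp f \<longleftrightarrow>
     (\<forall>\<epsilon>>0. \<forall>\<^sub>F y in at_top. norm (f (\<i> * complex_of_real y)) \<le> exp (\<epsilon> * y))"

definition tame :: "(complex \<Rightarrow> complex) \<Rightarrow> bool" where
  "tame f \<longleftrightarrow> half_plane_growth f \<and> imag_axis_subexp f"

lemma mean_type_nonpos_imp_imag_axis_subexp:
  assumes "mean_type_nonpos h"
  shows "imag_axis_subexp h"
  unfolding imag_axis_subexp_def
proof (intro allI impI)
  fix \<epsilon> :: real assume e: "\<epsilon> > 0"
  have "Limsup at_top (\<lambda>y::real. ereal (ln (norm (h (\<i> * complex_of_real y))) / y)) < ereal \<epsilon>"
    using assms e unfolding mean_type_nonpos_def by (simp add: le_less_trans)
  then have "\<forall>\<^sub>F y in at_top. ereal (ln (norm (h (\<i> * complex_of_real y))) / y) < ereal \<epsilon>"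
    by (rule Limsup_lessD)
  then show "\<forall>\<^sub>F y in at_top. norm (h (\<i> * complex_of_real y)) \<le> exp (\<epsilon> * y)"
    using eventually_gt_at_top[of 0]
  proof eventually_elim
    case (elim y)
    then have ln_le: "ln (norm (h (\<i> * complex_of_real y))) \<le> \<epsilon> * y" by (simp add: field_simps)
    show ?case
    proof (cases "h (\<i> * complex_of_real y) = 0")
      case False
      then have "norm (h (\<i> * complex_of_real y)) = exp (ln (norm (h (\<i> * complex_of_real y))))" by simp
      also have "\<dots> \<le> exp (\<epsilon> * y)" using ln_le by simp
      finally show ?thesis .
    qed simp
  qed
qed

lemma half_plane_growth_mult:
  assumes "half_plane_growth f" "half_plane_growth g"
  shows "half_plane_growth (\<lambda>z. f z * g z)"
proof -
  obtain C D where CD: "C \<ge> 0" "D \<ge> 0"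
    and le: "\<And>z. z \<in> UHP \<Longrightarrow> norm (f z) \<le> exp (C * half_plane_scale z)"
      "\<And>z. z \<in> UHP \<Longrightarrow> norm (g z) \<le> exp (D * half_plane_scale z)"
    using assms unfolding half_plane_growth_def by blast
  have "norm (f z * g z) \<le> exp ((C + D) * half_plane_scale z)" if "z \<in> UHP" for z
    unfolding norm_mult distrib_right exp_add using le that by (intro mult_mono) auto
  then show ?thesis using CD unfolding half_plane_growth_def by (metis add_nonneg_nonneg)
qed

lemma half_plane_growth_add:
  assumes "half_plane_growth f" "half_plane_growth g"
  shows "half_plane_growth (\<lambda>z. f z + g z)"
proof -
  obtain C D where CD: "C \<ge> 0" "D \<ge> 0"
    and le: "\<And>z. z \<in> UHP \<Longrightarrow> norm (f z) \<le> exp (C * half_plane_scale z)"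
      "\<And>z. z \<in> UHP \<Longrightarrow> norm (g z) \<le> exp (D * half_plane_scale z)"
    using assms unfolding half_plane_growth_def by blast
  have "norm (f z + g z) \<le> exp ((C + D + 1) * half_plane_scale z)" if z: "z \<in> UHP" for z
  proof -
    let ?s = "half_plane_scale z"
    have s: "2 \<le> ?s" "2 \<le> exp ?s"
      using half_plane_scale_ge(1)[OF z] exp_ge_add_one_self[of ?s] by linarith+
    have "norm (f z + g z) \<le> exp (C * ?s) + exp (D * ?s)"
      using norm_triangle_mono le z by blast
    also have "\<dots> \<le> exp ((C + D) * ?s) + exp ((C + D) * ?s)"
      using CD s by (intro add_mono iffD2[OF exp_le_cancel_iff] mult_right_mono) auto
    also have "\<dots> = 2 * exp ((C + D) * ?s)" by simp
    also have "\<dots> \<le> exp ?s * exp ((C + D) * ?s)"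
      using s by (intro mult_right_mono) auto
    also have "\<dots> = exp ((C + D + 1) * ?s)" by (simp add: algebra_simps flip: exp_add)
    finally show ?thesis .
  qed
  moreover have "0 \<le> C + D + 1" using CD by simp
  ultimately show ?thesis unfolding half_plane_growth_def by blast
qed

lemma half_plane_growth_if_le_scale:
  assumes "\<And>z. z \<in> UHP \<Longrightarrow> norm (f z) \<le> B * half_plane_scale z"
  shows "half_plane_growth f"
proof -
  have "norm (f z) \<le> exp ((\<bar>B\<bar> + 1) * half_plane_scale z)" if z: "z \<in> UHP" for z
  proof -
    let ?s = "half_plane_scale z"
    have s: "2 \<le> ?s" using half_plane_scale_ge(1)[OF z] .
    have "norm (f z) \<le> (\<bar>B\<bar> + 1) * ?s"
      using assms[OF z] s mult_right_mono[of B "\<bar>B\<bar> + 1" ?s] by linarith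
    also have "\<dots> \<le> exp \<dots>" using exp_ge_add_one_self[of "(\<bar>B\<bar> + 1) * ?s"] by linarith
    finally show ?thesis .
  qed
  moreover have "0 \<le> \<bar>B\<bar> + 1" by simp
  ultimately show ?thesis unfolding half_plane_growth_def by blast
qed

lemma tame_cong:
  assumes "tame f" and eq: "\<And>z. z \<in> UHP \<Longrightarrow> f z = g z"
  shows "tame g"
proof -
  have "imag_axis_subexp g"
    unfolding imag_axis_subexp_def
  proof (intro allI impI)
    fix \<epsilon> :: real assume "\<epsilon> > 0"
    then have "\<forall>\<^sub>F y in at_top. norm (f (\<i> * complex_of_real y)) \<le> exp (\<epsilon> * y)"
      using assms(1) unfolding tame_def imag_axis_subexp_def by blast
    then show "\<forall>\<^sub>F y in at_top. norm (g (\<i> * complex_of_real y)) \<le> exp (\<epsilon> * y)"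
      using eventually_gt_at_top[of 0] by eventually_elim (simp add: UHP_def flip: eq)
  qed
  then show ?thesis using assms(1) by (simp add: tame_def half_plane_growth_def eq)
qed

lemma tame_mult:
  assumes "tame f" "tame g"
  shows "tame (\<lambda>z. f z * g z)"
proof -
  have "imag_axis_subexp (\<lambda>z. f z * g z)"
    unfolding imag_axis_subexp_def
  proof (intro allI impI)
    fix \<epsilon> :: real assume "\<epsilon> > 0"
    then have "\<epsilon> / 2 > 0" by simp
    with assms have "\<forall>\<^sub>F y in at_top. norm (f (\<i> * complex_of_real y)) \<le> exp (\<epsilon> / 2 * y)"
      "\<forall>\<^sub>F y in at_top. norm (g (\<i> * complex_of_real y)) \<le> exp (\<epsilon> / 2 * y)"
      unfolding tame_def imag_axis_subexp_def by blast+
    then show "\<forall>\<^sub>F y in at_top. norm (f (\<i> * complex_of_real y) * g (\<i> * complex_of_real y)) \<le> exp (\<epsilon> * y)"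
    proof eventually_elim
      case (elim y)
      then have "norm (f (\<i> * complex_of_real y)) * norm (g (\<i> * complex_of_real y))
          \<le> exp (\<epsilon> / 2 * y) * exp (\<epsilon> / 2 * y)"
        by (intro mult_mono) auto
      then show ?case by (simp add: norm_mult flip: exp_add)
    qed
  qed
  then show ?thesis using assms half_plane_growth_mult unfolding tame_def by blast
qed

lemma tame_add:
  assumes "tame f" "tame g"
  shows "tame (\<lambda>z. f z + g z)"
proof -
  have "imag_axis_subexp (\<lambda>z. f z + g z)"
    unfolding imag_axis_subexp_def
  proof (intro allI impI)
    fix \<epsilon> :: real assume e: "\<epsilon> > 0"
    then have "\<epsilon> / 2 > 0" by simp
    with assms have "\<forall>\<^sub>F y in at_top. norm (f (\<i> * complex_of_real y)) \<le> exp (\<epsilon> / 2 * y)"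
      "\<forall>\<^sub>F y in at_top. norm (g (\<i> * complex_of_real y)) \<le> exp (\<epsilon> / 2 * y)"
      unfolding tame_def imag_axis_subexp_def by blast+
    moreover have "\<forall>\<^sub>F y in at_top. 2 * exp (\<epsilon> / 2 * y) \<le> exp (\<epsilon> * y)" using e by real_asymp
    ultimately show "\<forall>\<^sub>F y in at_top. norm (f (\<i> * complex_of_real y) + g (\<i> * complex_of_real y))
        \<le> exp (\<epsilon> * y)"
    proof eventually_elim
      case (elim y)
      then show ?case
        using norm_triangle_mono[OF elim(1,2)] by linarith
    qed
  qed
  then show ?thesis using assms half_plane_growth_add unfolding tame_def by blast
qed

lemma tame_if_le_scale:
  assumes le: "\<And>z. z \<in> UHP \<Longrightarrow> norm (f z) \<le> B * half_plane_scale z"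
  shows "tame f"
proof -
  have "imag_axis_subexp f"
    unfolding imag_axis_subexp_def
  proof (intro allI impI)
    fix \<epsilon> :: real assume "\<epsilon> > 0"
    then have "\<forall>\<^sub>F y in at_top. B * ((1 + y\<^sup>2) / y) \<le> exp (\<epsilon> * y)" by real_asymp
    then show "\<forall>\<^sub>F y in at_top. norm (f (\<i> * complex_of_real y)) \<le> exp (\<epsilon> * y)"
      using eventually_gt_at_top[of 0]
    proof eventually_elim
      case (elim y)
      then show ?case
        using le[of "\<i> * complex_of_real y"] by (simp add: UHP_def half_plane_scale_def norm_mult)
    qed
  qed
  then show ?thesis using half_plane_growth_if_le_scale[OF le] by (simp add: tame_def)
qed

lemma tame_bounded:
  assumes "\<And>z. z \<in> UHP \<Longrightarrow> norm (f z) \<le> B"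
  shows "tame f"
proof (rule tame_if_le_scale)
  fix z assume z: "z \<in> UHP"
  have "0 \<le> B" using assms[OF z] norm_ge_zero[of "f z"] by linarith
  then have "B * 1 \<le> B * half_plane_scale z"
    using half_plane_scale_ge(1)[OF z] by (intro mult_left_mono) auto
  then show "norm (f z) \<le> B * half_plane_scale z" using assms[OF z] by simp
qed

lemma tame_const: "tame (\<lambda>_. c)"
  by (rule tame_bounded[where B = "norm c"]) simp

lemma tame_ident: "tame (\<lambda>z. z)"
  by (rule tame_if_le_scale[where B = 1]) (simp add: half_plane_scale_ge)

lemma tame_inverse_linear: "tame (\<lambda>z. 1 / (z - complex_of_real a))"
proof (rule tame_if_le_scale)
  fix z assume z: "z \<in> UHP"
  have "Im z \<le> norm (z - complex_of_real a)" using abs_Im_le_cmod[of "z - complex_of_real a"] by simp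
  then have "norm (1 / (z - complex_of_real a)) \<le> 1 / Im z"
    using z by (simp add: norm_divide UHP_def frac_le)
  also have "\<dots> \<le> 1 * half_plane_scale z" using half_plane_scale_ge(3)[OF z] by simp
  finally show "norm (1 / (z - complex_of_real a)) \<le> 1 * half_plane_scale z" .
qed

lemma bounded_type_imp_tame:
  assumes "bounded_type h" "mean_type_nonpos h" "h holomorphic_on UHP"
  shows "tame h"
  unfolding tame_def
  using bounded_type_imp_half_plane_growth[OF assms(1,3)] mean_type_nonpos_imp_imag_axis_subexp[OF assms(2)] ..

lemma imag_axis_bounded_if_subexp:
  assumes cont: "continuous_on closed_UHP g" and subexp: "imag_axis_subexp g" and e: "\<epsilon> > 0"
  obtains K where "\<And>y. 0 \<le> y \<Longrightarrow> norm (g (\<i> * complex_of_real y)) \<le> K * exp (\<epsilon> * y)"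
proof -
  obtain Y where Y: "\<And>y. y \<ge> Y \<Longrightarrow> norm (g (\<i> * complex_of_real y)) \<le> exp (\<epsilon> * y)"
    using subexp e unfolding imag_axis_subexp_def eventually_at_top_linorder by blast
  have "bounded ((\<lambda>y. g (\<i> * complex_of_real y)) ` {0..Y})"
    by (intro compact_imp_bounded compact_continuous_image continuous_on_compose2[OF cont]
      continuous_intros) auto
  then obtain K where "K > 0" and K: "\<And>y. y \<in> {0..Y} \<Longrightarrow> norm (g (\<i> * complex_of_real y)) \<le> K"
    unfolding bounded_pos by auto
  have "norm (g (\<i> * complex_of_real y)) \<le> max K 1 * exp (\<epsilon> * y)" if y: "0 \<le> y" for y
  proof (cases "y \<le> Y")
    case True
    have "norm (g (\<i> * complex_of_real y)) * 1 \<le> max K 1 * exp (\<epsilon> * y)"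
      using K[of y] True y e by (intro mult_mono) auto
    then show ?thesis by simp
  next
    case False
    have "1 * exp (\<epsilon> * y) \<le> max K 1 * exp (\<epsilon> * y)" by (intro mult_right_mono) auto
    moreover have "norm (g (\<i> * complex_of_real y)) \<le> exp (\<epsilon> * y)" using Y[of y] False by simp
    ultimately show ?thesis by linarith
  qed
  then show thesis by (rule that)
qed

theorem Phragmen_Lindelof_half_plane:
  assumes cont: "continuous_on closed_UHP g" and hol: "g holomorphic_on UHP" and tame: "tame g"
    and real: "\<And>x. norm (g (complex_of_real x)) \<le> S" and S: "S \<ge> 1" and z: "0 \<le> Im z"
  shows "norm (g z) \<le> S"
proof (rule tendsto_lowerbound)
  have "norm (g z) \<le> S * exp (\<epsilon> * Im z)" if e: "\<epsilon> > 0" for \<epsilon>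
  proof -
    define h where "h w = g w * exp (\<i> * complex_of_real \<epsilon> * w)" for w
    have norm_h: "norm (h w) = norm (g w) * exp (- (\<epsilon> * Im w))" for w
      by (simp add: h_def norm_mult)
    have cont_h: "continuous_on closed_UHP h" unfolding h_def by (intro continuous_intros cont)
    have hol_h: "h holomorphic_on UHP" unfolding h_def by (intro holomorphic_intros hol)
    have real_h: "norm (h (complex_of_real x)) \<le> S" for x using real by (simp add: norm_h)
    obtain K where K: "\<And>y. 0 \<le> y \<Longrightarrow> norm (g (\<i> * complex_of_real y)) \<le> K * exp (\<epsilon> * y)"
      using imag_axis_bounded_if_subexp[OF cont _ e] tame unfolding tame_def by blast
    have "norm (h w) \<le> max S K" if "0 \<le> Im w" for w
    proof (rule Phragmen_Lindelof_axes[OF cont_h hol_h _ _ _ _ that])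
      have "tame (\<lambda>w. exp (\<i> * complex_of_real \<epsilon> * w))"
        by (rule tame_bounded[where B = 1]) (use e in \<open>auto simp: UHP_def\<close>)
      then show "half_plane_growth h"
        unfolding h_def using tame by (intro half_plane_growth_mult) (auto simp: tame_def)
      show "norm (h (\<i> * complex_of_real y)) \<le> max S K" if "0 \<le> y" for y
      proof -
        have "norm (h (\<i> * complex_of_real y)) \<le> K * exp (\<epsilon> * y) * exp (- (\<epsilon> * y))"
          using K[OF that] by (simp add: norm_h)
        then show ?thesis by (simp add: mult.assoc flip: exp_add)
      qed
    qed (use real_h S in \<open>auto simp: le_max_iff_disj\<close>)
    then have "norm (h z) \<le> S"
      by (rule Phragmen_Lindelof_bounded[OF cont_h hol_h _ real_h S z])
    then show ?thesis by (simp add: norm_h exp_minus field_simps)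
  qed
  then show "\<forall>\<^sub>F \<epsilon> in at_right 0. norm (g z) \<le> S * exp (\<epsilon> * Im z)"
    using eventually_at_right_less by (rule eventually_mono[rotated])
  have "((\<lambda>\<epsilon>. S * exp (\<epsilon> * Im z)) \<longlongrightarrow> S * exp (0 * Im z)) (at_right 0)"
    by (intro tendsto_intros)
  then show "((\<lambda>\<epsilon>. S * exp (\<epsilon> * Im z)) \<longlongrightarrow> S) (at_right 0)" by simp
qed simp

subsection \<open>Vanishing integrals\<close>

lemma closed_UHP_primitive:
  assumes cont: "continuous_on closed_UHP f" and hol: "f holomorphic_on UHP"
  obtains U where "\<And>z. 0 \<le> Im z \<Longrightarrow> (U has_field_derivative f z) (at z within closed_UHP)"
proof -
  have "interior closed_UHP = UHP"
    using interior_halfspace_ge[of "\<i>" 0] by (simp add: inner_complex_def UHP_def)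
  moreover have "open UHP" unfolding UHP_def by (rule open_halfspace_Im_gt)
  ultimately have "f field_differentiable at x" if "x \<in> interior closed_UHP - {}" for x
    using hol that by (auto simp: holomorphic_on_imp_differentiable_at)
  then obtain U where "\<And>z. z \<in> closed_UHP \<Longrightarrow> (U has_field_derivative f z) (at z within closed_UHP)"
    using holomorphic_convex_primitive[OF convex_halfspace_Im_ge finite.emptyI cont] by metis
  then show thesis by (intro that[of U]) simp
qed

lemma continuous_on_closed_UHP_primitive:
  assumes "\<And>z. 0 \<le> Im z \<Longrightarrow> (U has_field_derivative f z) (at z within closed_UHP)"
  shows "continuous_on closed_UHP U"
  unfolding continuous_on_eq_continuous_within
proof
  fix z assume "z \<in> closed_UHP"
  then have "(U has_field_derivative f z) (at z within closed_UHP)" using assms by blast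
  then show "continuous (at z within closed_UHP) U" by (rule DERIV_continuous)
qed

lemma holomorphic_on_UHP_primitive:
  assumes "\<And>z. 0 \<le> Im z \<Longrightarrow> (U has_field_derivative f z) (at z within closed_UHP)"
  shows "U holomorphic_on UHP"
  unfolding holomorphic_on_def field_differentiable_def
proof
  fix z assume "z \<in> UHP"
  then have "(U has_field_derivative f z) (at z within UHP)"
    by (intro has_field_derivative_subset[OF assms]) (auto simp: UHP_def)
  then show "\<exists>f'. (U has_field_derivative f') (at z within UHP)" ..
qed

lemma has_integral_real_segment:
  assumes U: "\<And>z. 0 \<le> Im z \<Longrightarrow> (U has_field_derivative f z) (at z within closed_UHP)" and "a \<le> b"
  shows "((\<lambda>x. f (complex_of_real x)) has_integral (U b - U a)) {a..b}"
proof (rule fundamental_theorem_of_calculus[OF \<open>a \<le> b\<close>])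
  fix x assume "x \<in> {a..b}"
  have "(complex_of_real has_vector_derivative 1) (at x within {a..b})"
    using has_vector_derivative_of_real[OF DERIV_ident] by simp
  moreover have "(U has_field_derivative f (complex_of_real x))
      (at (complex_of_real x) within complex_of_real ` {a..b})"
    by (rule has_field_derivative_subset[OF U]) auto
  ultimately have "((U \<circ> complex_of_real) has_vector_derivative (1 * f (complex_of_real x)))
      (at x within {a..b})"
    by (rule field_vector_diff_chain_within)
  then show "((\<lambda>x. U (complex_of_real x)) has_vector_derivative f (complex_of_real x)) (at x within {a..b})"
    by (simp add: o_def)
qed

lemma norm_primitive_real_le:
  assumes int: "integrable lborel (\<lambda>x. f (complex_of_real x))"
    and U: "\<And>z. 0 \<le> Im z \<Longrightarrow> (U has_field_derivative f z) (at z within closed_UHP)"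
  shows "norm (U (complex_of_real x)) \<le> norm (U 0) + (LINT x|lborel. norm (f (complex_of_real x)))"
proof -
  have segment: "norm (U (complex_of_real b) - U (complex_of_real a))
      \<le> (LINT x|lborel. norm (f (complex_of_real x)))"
    if "a \<le> b" for a b
  proof -
    have si: "set_integrable lborel {a..b} (\<lambda>x. f (complex_of_real x))"
      unfolding set_integrable_def using int by (rule integrable_mult_indicator[rotated]) simp
    have "U (complex_of_real b) - U (complex_of_real a) = (LINT x:{a..b}|lborel. f (complex_of_real x))"
      using set_borel_integral_eq_integral(2)[OF si] has_integral_real_segment[OF U that]
      by (simp add: integral_unique)
    also have "norm \<dots> \<le> (LINT x|lborel. norm (indicator {a..b} x *\<^sub>R f (complex_of_real x)))"
      unfolding set_lebesgue_integral_def by (rule integral_norm_bound)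
    also have "\<dots> \<le> (LINT x|lborel. norm (f (complex_of_real x)))"
      using si int unfolding set_integrable_def
      by (intro integral_mono integrable_norm) (auto simp: indicator_def)
    finally show ?thesis .
  qed
  have "norm (U (complex_of_real x) - U 0) \<le> (LINT x|lborel. norm (f (complex_of_real x)))"
    using segment[of 0 x] segment[of x 0] by (cases "0 \<le> x") (auto simp: norm_minus_commute)
  then show ?thesis using norm_triangle_sub[of "U (complex_of_real x)" "U 0"] by linarith
qed

lemma norm_primitive_diff_le:
  assumes U: "\<And>z. 0 \<le> Im z \<Longrightarrow> (U has_field_derivative f z) (at z within closed_UHP)"
    and ab: "0 \<le> Im a" "0 \<le> Im b" and le: "\<And>w. w \<in> closed_segment a b \<Longrightarrow> norm (f w) \<le> B"
  shows "norm (U b - U a) \<le> B * norm (b - a)"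
proof (rule field_differentiable_bound[OF convex_closed_segment[of a b] _ le])
  have "closed_segment a b \<subseteq> closed_UHP"
    using ab by (intro closed_segment_subset convex_halfspace_Im_ge) auto
  then show "(U has_field_derivative f w) (at w within closed_segment a b)"
    if "w \<in> closed_segment a b" for w
    using that by (intro has_field_derivative_subset[OF U]) auto
qed auto

text \<open>The set \<open>half_plane_scale w \<le> s\<close> is a hyperbolic disc about \<open>\<i>\<close>, hence a Euclidean disc, so it
  contains the segment from \<open>\<i>\<close> to each of its points.\<close>
lemma half_plane_scale_segment_le:
  assumes z: "z \<in> UHP" and w: "w \<in> closed_segment \<i> z"
  shows "w \<in> UHP" "half_plane_scale w \<le> half_plane_scale z"
proof -
  define s where "s = half_plane_scale z"
  obtain t where t: "0 \<le> t" "t \<le> 1" "w = (1 - t) *\<^sub>R \<i> + t *\<^sub>R z"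
    using w by (auto simp: closed_segment_def)
  have Im_z: "0 < Im z" using z by (simp add: UHP_def)
  have Im_w: "Im w = (1 - t) + t * Im z" by (simp add: t(3))
  then have pos: "0 < Im w" using Im_z t(1,2) by (cases "t = 0") (auto intro: add_nonneg_pos)
  then show "w \<in> UHP" by (simp add: UHP_def)
  have norm_z: "(norm z)\<^sup>2 = s * Im z - 1" using Im_z by (simp add: s_def half_plane_scale_def)
  have "2 \<le> s" unfolding s_def by (rule half_plane_scale_ge(1)[OF z])
  have "(norm w)\<^sup>2 = (1 - t) + t * (norm z)\<^sup>2 - t * (1 - t) * (norm (z - \<i>))\<^sup>2"
    unfolding t(3) cmod_power2 by (simp add: power2_eq_square algebra_simps)
  also have "\<dots> \<le> (1 - t) + t * (norm z)\<^sup>2" using t by simp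
  also have "\<dots> \<le> s * Im w - 1"
    using mult_right_mono[OF \<open>2 \<le> s\<close>, of "1 - t"] t unfolding norm_z Im_w by (simp add: algebra_simps)
  finally show "half_plane_scale w \<le> half_plane_scale z"
    using pos by (simp add: half_plane_scale_def[of w] s_def[symmetric] divide_le_eq)
qed

lemma half_plane_growth_primitive:
  assumes growth: "half_plane_growth f"
    and U: "\<And>z. 0 \<le> Im z \<Longrightarrow> (U has_field_derivative f z) (at z within closed_UHP)"
  shows "half_plane_growth U"
proof -
  obtain C where C: "C \<ge> 0" "\<And>z. z \<in> UHP \<Longrightarrow> norm (f z) \<le> exp (C * half_plane_scale z)"
    using growth unfolding half_plane_growth_def by blast
  define D where "D = norm (U \<i>) + 2"
  have "norm (U z) \<le> exp ((C + D) * half_plane_scale z)" if z: "z \<in> UHP" for z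
  proof -
    let ?s = "half_plane_scale z"
    have s: "2 \<le> ?s" "norm z \<le> ?s" using half_plane_scale_ge z by auto
    have "norm (U z - U \<i>) \<le> exp (C * ?s) * norm (z - \<i>)"
    proof (rule norm_primitive_diff_le[OF U])
      fix w assume w: "w \<in> closed_segment \<i> z"
      have "norm (f w) \<le> exp (C * half_plane_scale w)" using C(2) half_plane_scale_segment_le(1)[OF z w] .
      also have "\<dots> \<le> exp (C * ?s)"
        using half_plane_scale_segment_le(2)[OF z w] C(1) by (simp add: mult_left_mono)
      finally show "norm (f w) \<le> exp (C * ?s)" .
    qed (use z in \<open>auto simp: UHP_def\<close>)
    also have "\<dots> \<le> exp (C * ?s) * (2 * ?s)"
      using norm_triangle_ineq4[of z \<i>] s by (intro mult_left_mono) auto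
    finally have "norm (U z) \<le> norm (U \<i>) * 1 + exp (C * ?s) * (2 * ?s)"
      using norm_triangle_sub[of "U z" "U \<i>"] by linarith
    also have "\<dots> \<le> norm (U \<i>) * (exp (C * ?s) * ?s) + exp (C * ?s) * (2 * ?s)"
    proof -
      have "1 * 1 \<le> exp (C * ?s) * ?s" using C(1) s by (intro mult_mono) auto
      then show ?thesis by (intro add_mono mult_left_mono) auto
    qed
    also have "\<dots> = exp (C * ?s) * (D * ?s)" by (simp add: D_def algebra_simps)
    also have "\<dots> \<le> exp (C * ?s) * exp (D * ?s)"
    proof (rule mult_left_mono)
      show "D * ?s \<le> exp (D * ?s)" using exp_ge_add_one_self[of "D * ?s"] by linarith
    qed simp
    finally show ?thesis by (simp add: distrib_right exp_add)
  qed
  moreover have "0 \<le> C + D" using C(1) by (simp add: D_def)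
  ultimately show ?thesis unfolding half_plane_growth_def by blast
qed

lemma imag_axis_subexp_primitive:
  assumes subexp: "imag_axis_subexp f"
    and U: "\<And>z. 0 \<le> Im z \<Longrightarrow> (U has_field_derivative f z) (at z within closed_UHP)"
  shows "imag_axis_subexp U"
  unfolding imag_axis_subexp_def
proof (intro allI impI)
  fix \<epsilon> :: real assume e: "\<epsilon> > 0"
  then have "\<epsilon> / 2 > 0" by simp
  then obtain Y where "\<And>y. y \<ge> Y \<Longrightarrow> norm (f (\<i> * complex_of_real y)) \<le> exp (\<epsilon> / 2 * y)"
    using subexp unfolding imag_axis_subexp_def eventually_at_top_linorder by blast
  then obtain Y where Y: "Y \<ge> 0" "\<And>y. y \<ge> Y \<Longrightarrow> norm (f (\<i> * complex_of_real y)) \<le> exp (\<epsilon> / 2 * y)"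
    by (metis max.bounded_iff max.cobounded2)
  define K where "K = norm (U (\<i> * complex_of_real Y))"
  have "\<forall>\<^sub>F y in at_top. K + exp (\<epsilon> / 2 * y) * (y - Y) \<le> exp (\<epsilon> * y)" using e by real_asymp
  then show "\<forall>\<^sub>F y in at_top. norm (U (\<i> * complex_of_real y)) \<le> exp (\<epsilon> * y)"
    using eventually_ge_at_top[of Y]
  proof eventually_elim
    case (elim y)
    have "norm (U (\<i> * complex_of_real y) - U (\<i> * complex_of_real Y))
        \<le> exp (\<epsilon> / 2 * y) * norm (\<i> * complex_of_real y - \<i> * complex_of_real Y)"
    proof (rule norm_primitive_diff_le[OF U])
      fix w assume "w \<in> closed_segment (\<i> * complex_of_real Y) (\<i> * complex_of_real y)"
      then obtain t where t: "0 \<le> t" "t \<le> 1"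
        "w = (1 - t) *\<^sub>R (\<i> * complex_of_real Y) + t *\<^sub>R (\<i> * complex_of_real y)"
        by (auto simp: closed_segment_def)
      define v where "v = Y + t * (y - Y)"
      have "w = \<i> * complex_of_real v" by (simp add: t(3) v_def scaleR_conv_of_real algebra_simps)
      moreover have "Y \<le> v" using t elim by (simp add: v_def)
      moreover have "v \<le> y" using t elim mult_right_mono[of t 1 "y - Y"] by (simp add: v_def)
      ultimately have "norm (f w) \<le> exp (\<epsilon> / 2 * v)" using Y(2) by simp
      also have "\<dots> \<le> exp (\<epsilon> / 2 * y)" using e \<open>v \<le> y\<close> by simp
      finally show "norm (f w) \<le> exp (\<epsilon> / 2 * y)" .
    qed (use Y elim in auto)
    also have "norm (\<i> * complex_of_real y - \<i> * complex_of_real Y) = y - Y"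
      using elim norm_of_real[of "y - Y"]
      unfolding right_diff_distrib[symmetric] norm_mult of_real_diff[symmetric] by simp
    finally show ?case
      using elim(1) norm_triangle_sub[of "U (\<i> * complex_of_real y)" "U (\<i> * complex_of_real Y)"]
      by (simp add: K_def)
  qed
qed

lemma norm_le_norm_add_imag:
  assumes "0 \<le> Im z" "0 \<le> T"
  shows "norm z \<le> norm (z + \<i> * complex_of_real T)"
proof (rule power2_le_imp_le)
  show "(norm z)\<^sup>2 \<le> (norm (z + \<i> * complex_of_real T))\<^sup>2"
    using assms unfolding cmod_power2 by (simp add: power2_eq_square algebra_simps)
qed simp

text \<open>The integral equals the one along the semicircle \<open>|z| = R\<close>, where the integrand is \<open>O(1 / R\<^sup>2)\<close>.\<close>
lemma norm_integral_divide_square_le: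
  fixes R T :: real
  assumes cont: "continuous_on closed_UHP U" and hol: "U holomorphic_on UHP"
    and le: "\<And>z. 0 \<le> Im z \<Longrightarrow> norm (U z) \<le> B" and R: "R > 0" and T: "T > 0"
  shows "norm (integral {- R..R} (\<lambda>x. U (complex_of_real x) / (complex_of_real x + \<i> * T)\<^sup>2)) \<le> B * pi / R"
proof -
  let ?f = "\<lambda>z. U z / (z + \<i> * complex_of_real T)\<^sup>2"
  let ?p = "part_circlepath 0 R 0 pi"
  have B: "0 \<le> B" using order_trans[OF norm_ge_zero le[of 0]] by simp
  have nz: "z + \<i> * complex_of_real T \<noteq> 0" if "0 \<le> Im z" for z
    using that T by (auto simp: complex_eq_iff)
  have "continuous_on closed_UHP ?f" using nz by (intro continuous_intros cont) auto
  moreover have "?f holomorphic_on UHP" using nz by (intro holomorphic_intros hol) (auto simp: UHP_def)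
  ultimately obtain Y where Y: "\<And>z. 0 \<le> Im z \<Longrightarrow> (Y has_field_derivative ?f z) (at z within closed_UHP)"
    using closed_UHP_primitive by blast
  have path: "path_image ?p \<subseteq> closed_UHP"
    using R by (auto simp: path_image_part_circlepath' closed_segment_eq_real_ivl Im_exp sin_ge_zero)
  have "(?f has_contour_integral (Y (pathfinish ?p) - Y (pathstart ?p))) ?p"
    by (rule contour_integral_primitive[OF _ _ path]) (use Y in auto)
  then have "norm (Y (pathfinish ?p) - Y (pathstart ?p)) \<le> B / R\<^sup>2 * R * (pi - 0)"
  proof (rule has_contour_integral_bound_part_circlepath)
    show "norm (?f z) \<le> B / R\<^sup>2" if "z \<in> path_image ?p" for z
    proof -
      have z: "norm z = R" "0 \<le> Im z"
        using path_image_part_circlepath_subset'[of R 0 0 pi] R path that by auto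
      then have "R\<^sup>2 \<le> (norm (z + \<i> * complex_of_real T))\<^sup>2"
        using norm_le_norm_add_imag[of z T] R T by (intro power_mono) auto
      then show ?thesis
        unfolding norm_divide norm_power using le[OF z(2)] B R by (intro frac_le) auto
    qed
  qed (use R B in auto)
  moreover have "integral {- R..R} (\<lambda>x. ?f (complex_of_real x)) = Y R - Y (- R)"
    using has_integral_real_segment[OF Y, of "- R" R] R by (simp add: integral_unique)
  ultimately show ?thesis using R by (simp add: norm_minus_commute power2_eq_square)
qed

lemma norm_integral_resolvent_le:
  fixes R T :: real
  assumes U: "\<And>z. 0 \<le> Im z \<Longrightarrow> (U has_field_derivative f z) (at z within closed_UHP)"
    and le: "\<And>z. 0 \<le> Im z \<Longrightarrow> norm (U z) \<le> B" and R: "R > 0" and T: "T > 0"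
  shows "norm (integral {- R..R} (\<lambda>x. f (complex_of_real x) / (complex_of_real x + \<i> * T))) \<le> B * (2 + pi) / R"
proof -
  let ?d = "\<lambda>z. z + \<i> * complex_of_real T"
  have nz: "?d z \<noteq> 0" if "0 \<le> Im z" for z using that T by (auto simp: complex_eq_iff)
  have cont: "continuous_on closed_UHP U" by (rule continuous_on_closed_UHP_primitive[OF U])
  have hol: "U holomorphic_on UHP" by (rule holomorphic_on_UHP_primitive[OF U])
  have deriv: "((\<lambda>z. U z / ?d z) has_field_derivative f z / ?d z - U z / (?d z)\<^sup>2) (at z within closed_UHP)"
    if "0 \<le> Im z" for z
    using nz[OF that]
    by (auto intro!: derivative_eq_intros U that simp: divide_simps power2_eq_square)
  have parts: "((\<lambda>x. f (complex_of_real x) / ?d (complex_of_real x)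
      - U (complex_of_real x) / (?d (complex_of_real x))\<^sup>2)
      has_integral (U R / ?d R - U (- R) / ?d (- R))) {- R..R}"
    using has_integral_real_segment[OF deriv, of "- R" R] R by simp
  have "(\<lambda>x. U (complex_of_real x) / (?d (complex_of_real x))\<^sup>2) integrable_on {- R..R}"
    using nz by (intro integrable_continuous_real continuous_intros continuous_on_compose2[OF cont]) auto
  from has_integral_add[OF parts integrable_integral[OF this]]
  have "((\<lambda>x. f (complex_of_real x) / ?d (complex_of_real x)) has_integral
      (U R / ?d R - U (- R) / ?d (- R)
        + integral {- R..R} (\<lambda>x. U (complex_of_real x) / (?d (complex_of_real x))\<^sup>2))) {- R..R}"
    by simp
  then have "integral {- R..R} (\<lambda>x. f (complex_of_real x) / ?d (complex_of_real x))
      = U R / ?d R - U (- R) / ?d (- R)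
        + integral {- R..R} (\<lambda>x. U (complex_of_real x) / (?d (complex_of_real x))\<^sup>2)"
    by (rule integral_unique)
  also have "norm \<dots> \<le> B / R + B / R + B * pi / R"
  proof (intro norm_triangle_mono norm_triangle_le_diff)
    have boundary: "norm (U (complex_of_real x) / ?d (complex_of_real x)) \<le> B / R" if "\<bar>x\<bar> = R" for x
    proof -
      have "R \<le> norm (?d (complex_of_real x))" using abs_Re_le_cmod[of "?d (complex_of_real x)"] that by simp
      then show ?thesis
        using le[of "complex_of_real x"] R order_trans[OF norm_ge_zero le[of "complex_of_real x"]]
        by (auto simp: norm_divide intro!: frac_le)
    qed
    show "norm (U R / ?d R) + norm (U (- R) / ?d (- R)) \<le> B / R + B / R"
      using boundary[of R] boundary[of "- R"] R by simp
  qed (rule norm_integral_divide_square_le[OF cont hol le R T])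
  also have "\<dots> = B * (2 + pi) / R" by (simp add: distrib_left add_divide_distrib)
  finally show ?thesis .
qed

lemma bounded_primitive_if_tame:
  assumes cont: "continuous_on closed_UHP f" and hol: "f holomorphic_on UHP" and tame: "tame f"
    and int: "integrable lborel (\<lambda>x. f (complex_of_real x))"
  obtains U B where "\<And>z. 0 \<le> Im z \<Longrightarrow> (U has_field_derivative f z) (at z within closed_UHP)"
    "\<And>z. 0 \<le> Im z \<Longrightarrow> norm (U z) \<le> B"
proof -
  obtain U where U: "\<And>z. 0 \<le> Im z \<Longrightarrow> (U has_field_derivative f z) (at z within closed_UHP)"
    using closed_UHP_primitive[OF cont hol] by blast
  define B where "B = max 1 (norm (U 0) + (LINT x|lborel. norm (f (complex_of_real x))))"
  have "norm (U z) \<le> B" if "0 \<le> Im z" for z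
  proof (rule Phragmen_Lindelof_half_plane[OF continuous_on_closed_UHP_primitive[OF U]
    holomorphic_on_UHP_primitive[OF U]])
    show "tame U"
      using tame half_plane_growth_primitive[OF _ U] imag_axis_subexp_primitive[OF _ U] by (simp add: tame_def)
    show "norm (U (complex_of_real x)) \<le> B" for x
      using norm_primitive_real_le[OF int U] by (simp add: B_def le_max_iff_disj)
  qed (use that in \<open>auto simp: B_def\<close>)
  with U show thesis by (rule that)
qed

definition resolvent_cutoff :: "nat \<Rightarrow> real \<Rightarrow> complex" where
  "resolvent_cutoff n x
      = indicator {- (real n)\<^sup>2..(real n)\<^sup>2} x * (\<i> * of_nat n / (complex_of_real x + \<i> * of_nat n))"

lemma norm_resolvent_cutoff_le: "norm (resolvent_cutoff n x) \<le> 1"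
  using abs_Im_le_cmod[of "complex_of_real x + \<i> * of_nat n"]
  by (simp add: resolvent_cutoff_def indicator_def norm_divide norm_mult divide_le_eq_1)

lemma measurable_resolvent_cutoff: "resolvent_cutoff n \<in> borel_measurable lborel"
  unfolding resolvent_cutoff_def[abs_def] by measurable

lemma tendsto_resolvent_cutoff: "(\<lambda>n. resolvent_cutoff n x) \<longlonglongrightarrow> 1"
proof (rule Lim_transform_eventually)
  have "(\<lambda>n. complex_of_real x / of_nat n) \<longlonglongrightarrow> 0" by (rule lim_const_over_n)
  then have "(\<lambda>n. \<i> / (complex_of_real x / of_nat n + \<i>)) \<longlonglongrightarrow> \<i> / (0 + \<i>)"
    by (intro tendsto_intros) auto
  then show "(\<lambda>n. \<i> / (complex_of_real x / of_nat n + \<i>)) \<longlonglongrightarrow> 1" by simp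
  have "\<forall>\<^sub>F n in sequentially. \<bar>x\<bar> \<le> (real n)\<^sup>2" by real_asymp
  then show "\<forall>\<^sub>F n in sequentially. \<i> / (complex_of_real x / of_nat n + \<i>) = resolvent_cutoff n x"
    using eventually_gt_at_top[of 0]
    by eventually_elim (simp add: resolvent_cutoff_def indicator_def abs_le_iff field_simps)
qed

lemma integral_resolvent_cutoff_tendsto:
  fixes f :: "real \<Rightarrow> complex"
  assumes int: "integrable lborel f"
  shows "(\<lambda>n. LINT x|lborel. f x * resolvent_cutoff n x) \<longlonglongrightarrow> (LINT x|lborel. f x)"
proof (rule integral_dominated_convergence[where w = "\<lambda>x. norm (f x)"])
  show "AE x in lborel. (\<lambda>n. f x * resolvent_cutoff n x) \<longlonglongrightarrow> f x"
    using tendsto_mult[OF tendsto_const tendsto_resolvent_cutoff] by (intro AE_I2) simp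
  show "(\<lambda>x. f x * resolvent_cutoff n x) \<in> borel_measurable lborel" for n
    by (intro borel_measurable_times borel_measurable_integrable[OF int] measurable_resolvent_cutoff)
  show "AE x in lborel. norm (f x * resolvent_cutoff n x) \<le> norm (f x)" for n
    unfolding norm_mult by (intro AE_I2 mult_left_le norm_resolvent_cutoff_le) simp
qed (use int in auto)

lemma integral_resolvent_cutoff_eq:
  fixes f :: "real \<Rightarrow> complex"
  assumes int: "integrable lborel f"
  shows "(LINT x|lborel. f x * resolvent_cutoff n x)
    = \<i> * of_nat n * integral {- (real n)\<^sup>2..(real n)\<^sup>2} (\<lambda>x. f x / (complex_of_real x + \<i> * real n))"
proof -
  let ?I = "{- (real n)\<^sup>2..(real n)\<^sup>2}"
    and ?g = "\<lambda>x. f x * (\<i> * of_nat n / (complex_of_real x + \<i> * of_nat n))"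
  have cutoff: "f x * resolvent_cutoff n x = indicator ?I x *\<^sub>R ?g x" for x
    by (simp add: resolvent_cutoff_def indicator_def)
  have "integrable lborel (\<lambda>x. f x * resolvent_cutoff n x)"
  proof (rule Bochner_Integration.integrable_bound[OF int])
    show "(\<lambda>x. f x * resolvent_cutoff n x) \<in> borel_measurable lborel"
      by (intro borel_measurable_times borel_measurable_integrable[OF int] measurable_resolvent_cutoff)
    show "AE x in lborel. norm (f x * resolvent_cutoff n x) \<le> norm (f x)"
      unfolding norm_mult by (intro AE_I2 mult_left_le norm_resolvent_cutoff_le) simp
  qed
  then have "set_integrable lborel ?I ?g" unfolding set_integrable_def cutoff .
  then have "(LINT x|lborel. f x * resolvent_cutoff n x) = integral ?I ?g"
    using set_borel_integral_eq_integral(2) unfolding set_lebesgue_integral_def cutoff by blast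
  also have "\<dots> = \<i> * of_nat n * integral ?I (\<lambda>x. f x / (complex_of_real x + \<i> * real n))"
    unfolding integral_mult_right[symmetric] by (simp add: mult_ac)
  finally show ?thesis .
qed

text \<open>Integrating \<open>f\<close> against \<open>\<i> n / (x + \<i> n)\<close> by parts over \<open>[- n\<^sup>2, n\<^sup>2]\<close> leaves terms of size
  \<open>O(1 / n)\<close>, because a primitive of \<open>f\<close> is bounded in the half-plane.\<close>
theorem integral_eq_0_if_tame:
  assumes cont: "continuous_on closed_UHP f" and hol: "f holomorphic_on UHP" and tame: "tame f"
    and int: "integrable lborel (\<lambda>x. f (complex_of_real x))"
  shows "(LINT x|lborel. f (complex_of_real x)) = 0"
proof -
  obtain U B where U: "\<And>z. 0 \<le> Im z \<Longrightarrow> (U has_field_derivative f z) (at z within closed_UHP)"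
    and B: "\<And>z. 0 \<le> Im z \<Longrightarrow> norm (U z) \<le> B"
    using bounded_primitive_if_tame[OF cont hol tame int] by blast
  have "(\<lambda>n. LINT x|lborel. f (complex_of_real x) * resolvent_cutoff n x) \<longlonglongrightarrow> 0"
  proof (rule Lim_null_comparison)
    show "(\<lambda>n. B * (2 + pi) / real n) \<longlonglongrightarrow> 0" by real_asymp
    show "\<forall>\<^sub>F n in sequentially. norm (LINT x|lborel. f (complex_of_real x) * resolvent_cutoff n x)
        \<le> B * (2 + pi) / real n"
      using eventually_gt_at_top[of 0]
    proof eventually_elim
      case (elim n)
      have "norm (LINT x|lborel. f (complex_of_real x) * resolvent_cutoff n x)
          \<le> real n * (B * (2 + pi) / (real n)\<^sup>2)"
        unfolding integral_resolvent_cutoff_eq[OF int] norm_mult using elim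
        by (simp only: norm_ii norm_of_nat mult_1_left)
           (intro mult_left_mono norm_integral_resolvent_le[OF U B], auto)
      then show ?case using elim by (simp add: power2_eq_square)
    qed
  qed
  then show ?thesis
    using LIMSEQ_unique integral_resolvent_cutoff_tendsto[OF int] by blast
qed

subsection \<open>Real entire functions and bounded type\<close>

lemma star_fun_holomorphic:
  assumes "F holomorphic_on UNIV"
  shows "star_fun F holomorphic_on UNIV"
proof -
  have "(cnj \<circ> F \<circ> cnj) holomorphic_on UNIV"
    by (rule holomorphic_on_compose_cnj_cnj) (use assms in auto)
  then show ?thesis by (simp add: star_fun_def[abs_def] o_def)
qed

lemma entire_eq_if_eq_on_Reals:
  assumes "F holomorphic_on UNIV" "G holomorphic_on UNIV"
    and eq: "\<And>x. F (complex_of_real x) = G (complex_of_real x)"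
  shows "F z = G z"
proof -
  have "F z - G z = 0"
  proof (rule analytic_continuation[of "\<lambda>z. F z - G z" UNIV \<real> 0])
    show "(\<lambda>z. F z - G z) holomorphic_on UNIV" by (intro holomorphic_intros assms)
    have "\<real> \<noteq> {x}" for x :: complex using Reals_0 Reals_1 by (metis singletonD zero_neq_one)
    then show "(0 :: complex) islimpt \<real>"
      by (intro connected_imp_perfect convex_connected convex_Reals) auto
    show "F w - G w = 0" if "w \<in> \<real>" for w using that eq by (auto elim: Reals_cases)
  qed auto
  then show ?thesis by simp
qed

lemma entire_eq_0_if_AE_zero:
  assumes F: "F holomorphic_on UNIV" and ae: "AE x in lborel. F (complex_of_real x) = 0"
  shows "F = (\<lambda>_. 0)"
proof
  fix z
  have "continuous_on UNIV (\<lambda>x. F (complex_of_real x))"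
    by (rule continuous_on_compose2[OF holomorphic_on_imp_continuous_on[OF F]])
      (auto intro!: continuous_intros)
  then have op: "open {x. F (complex_of_real x) \<noteq> 0}"
    by (rule open_Collect_neq) (rule continuous_on_const)
  then have "{x. F (complex_of_real x) \<noteq> 0} \<in> null_sets lborel"
    using ae by (subst AE_iff_null_sets) simp_all
  then have "negligible {x. F (complex_of_real x) \<noteq> 0}"
    by (simp add: negligible_iff_null_sets null_sets_completionI)
  then have "{x. F (complex_of_real x) \<noteq> 0} = {}" using open_not_negligible[OF op] by blast
  then have "F (complex_of_real x) = 0" for x by auto
  then show "F z = 0" using entire_eq_if_eq_on_Reals[OF F holomorphic_on_const] by blast
qed

lemma bounded_type_if_bounded:
  assumes "h holomorphic_on UHP" "\<And>z. z \<in> UHP \<Longrightarrow> norm (h z) \<le> B"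
  shows "bounded_type h"
  unfolding bounded_type_def
proof (intro exI conjI)
  show "bounded (h ` UHP)" using assms(2) by (auto simp: bounded_iff)
  show "\<exists>z\<in>UHP. (1 :: complex) \<noteq> 0" by (intro bexI[of _ \<i>]) (auto simp: UHP_def)
qed (use assms(1) in \<open>auto simp: bounded_iff\<close>)

lemma norm_linear_over_shift_le:
  assumes z: "z \<in> UHP"
  shows "1 \<le> norm (z + \<i>)" "norm ((z - a) / (z + \<i>)) \<le> 1 + norm (a + \<i>)"
proof -
  show shift: "1 \<le> norm (z + \<i>)"
    using abs_Im_le_cmod[of "z + \<i>"] z by (simp add: UHP_def)
  have "norm (z - a) \<le> norm (z + \<i>) * 1 + norm (a + \<i>) * 1"
    using norm_triangle_ineq4[of "z + \<i>" "a + \<i>"] by simp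
  also have "\<dots> \<le> norm (z + \<i>) * 1 + norm (a + \<i>) * norm (z + \<i>)"
    using shift by (intro add_mono mult_left_mono) auto
  finally have "norm (z - a) \<le> (1 + norm (a + \<i>)) * norm (z + \<i>)" by (simp add: algebra_simps)
  moreover have "0 < norm (z + \<i>)" using shift by linarith
  ultimately show "norm ((z - a) / (z + \<i>)) \<le> 1 + norm (a + \<i>)"
    unfolding norm_divide by (simp only: pos_divide_le_eq)
qed

lemma bounded_type_divide_linear:
  fixes a :: real
  assumes k: "bounded_type k" and eq: "\<And>z. z \<in> UHP \<Longrightarrow> h z * (z - complex_of_real a) = k z"
  shows "bounded_type h"
proof -
  obtain f g where f: "f holomorphic_on UHP" "bounded (f ` UHP)"
    and g: "g holomorphic_on UHP" "bounded (g ` UHP)"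
    and nz: "\<exists>z\<in>UHP. g z \<noteq> 0" and fg: "\<And>z. z \<in> UHP \<Longrightarrow> k z * g z = f z"
    using k unfolding bounded_type_def by blast
  obtain B where B: "B > 0" "\<And>z. z \<in> UHP \<Longrightarrow> norm (f z) \<le> B" "\<And>z. z \<in> UHP \<Longrightarrow> norm (g z) \<le> B"
    using f(2) g(2) bounded_Un[of "f ` UHP" "g ` UHP"] unfolding bounded_pos by auto
  have shift_nz: "z + \<i> \<noteq> 0" if "z \<in> UHP" for z using norm_linear_over_shift_le(1)[OF that] by auto
  let ?g = "\<lambda>z. (z - complex_of_real a) / (z + \<i>) * g z" and ?f = "\<lambda>z. f z / (z + \<i>)"
  show ?thesis
    unfolding bounded_type_def
  proof (intro exI conjI ballI)
    show "?f holomorphic_on UHP" "?g holomorphic_on UHP"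
      using shift_nz by (auto intro!: holomorphic_intros f g)
    have "norm (?f z) \<le> B / 1" if "z \<in> UHP" for z
      unfolding norm_divide using B norm_linear_over_shift_le(1) that by (intro frac_le) auto
    then show "bounded (?f ` UHP)" unfolding bounded_iff by blast
    have "norm (?g z) \<le> (1 + norm (a + \<i>)) * B" if "z \<in> UHP" for z
      unfolding norm_mult using B norm_linear_over_shift_le(2) that by (intro mult_mono) auto
    then show "bounded (?g ` UHP)" unfolding bounded_iff by blast
    obtain z where "z \<in> UHP" "g z \<noteq> 0" using nz by blast
    then show "\<exists>z\<in>UHP. ?g z \<noteq> 0" using shift_nz by (intro bexI[of _ z]) (auto simp: UHP_def)
    show "h z * ?g z = ?f z" if "z \<in> UHP" for z
    proof -
      have "h z * ?g z = h z * (z - complex_of_real a) * g z / (z + \<i>)" by simp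
      then show ?thesis using fg eq that by simp
    qed
  qed
qed

lemma mean_type_nonpos_if_bounded:
  assumes "\<forall>\<^sub>F y in at_top. norm (h (\<i> * complex_of_real y)) \<le> B"
  shows "mean_type_nonpos h"
proof -
  have "\<forall>\<^sub>F y in at_top. ereal (ln (norm (h (\<i> * complex_of_real y))) / y) \<le> ereal (ln (max 1 B) / y)"
    using assms eventually_gt_at_top[of 0]
  proof eventually_elim
    case (elim y)
    have "ln (norm (h (\<i> * complex_of_real y))) \<le> ln (max 1 B)"
      using elim(1) by (cases "h (\<i> * complex_of_real y) = 0") (auto intro: ln_mono)
    then show ?case using elim(2) by (simp add: divide_right_mono)
  qed
  then have "Limsup at_top (\<lambda>y::real. ereal (ln (norm (h (\<i> * complex_of_real y))) / y))
      \<le> Limsup at_top (\<lambda>y::real. ereal (ln (max 1 B) / y))"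
    by (rule Limsup_mono)
  also have "((\<lambda>y::real. ln (max 1 B) / y) \<longlongrightarrow> 0) at_top" by real_asymp
  then have "Limsup at_top (\<lambda>y::real. ereal (ln (max 1 B) / y)) = ereal 0"
    by (intro lim_imp_Limsup tendsto_ereal) auto
  finally show ?thesis by (simp add: mean_type_nonpos_def zero_ereal_def)
qed

subsection \<open>The Poisson kernel\<close>

definition poisson_kernel :: "real \<Rightarrow> complex \<Rightarrow> real" where
  \<comment> \<open>with pole at \<open>-1\<close>: it tends to 0 as \<open>r\<close> tends to 1, except at \<open>t = -1\<close>\<close>
  "poisson_kernel r t = (1 - r\<^sup>2) / (norm (1 + complex_of_real r * t))\<^sup>2"

lemma norm_1_plus_scaled_ge:
  assumes "0 \<le> r" "norm t \<le> 1"
  shows "1 - r \<le> norm (1 + complex_of_real r * t)"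
proof -
  have "norm (complex_of_real r * t) \<le> r * 1"
    using assms by (simp add: norm_mult mult_left_le)
  then show ?thesis using norm_triangle_ineq2[of 1 "- (complex_of_real r * t)"] by simp
qed

lemma poisson_kernel_nonneg: "0 \<le> r \<Longrightarrow> r < 1 \<Longrightarrow> 0 \<le> poisson_kernel r t"
  unfolding poisson_kernel_def by (intro divide_nonneg_nonneg) (auto simp: power_le_one_iff)

lemma poisson_kernel_eq:
  assumes r: "0 \<le> r" "r < 1" and t: "norm t = 1"
  shows "poisson_kernel r t = 1 - 2 * r * Re (t / (1 + complex_of_real r * t))"
proof -
  let ?d = "1 + complex_of_real r * t"
  have unit: "(Re t)\<^sup>2 + (Im t)\<^sup>2 = 1" using t by (simp add: cmod_power2[symmetric])
  have "(norm ?d)\<^sup>2 = 1 + 2 * r * Re t + r\<^sup>2 * ((Re t)\<^sup>2 + (Im t)\<^sup>2)"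
    unfolding cmod_power2 by (simp add: power2_eq_square algebra_simps)
  then have norm_d: "(norm ?d)\<^sup>2 = 1 + 2 * r * Re t + r\<^sup>2" by (simp add: unit)
  have "Re (t / ?d) = Re (t * cnj ?d) / (norm ?d)\<^sup>2"
    by (subst complex_div_cnj) (simp add: Re_divide_of_real)
  also have "Re (t * cnj ?d) = Re t + r * ((Re t)\<^sup>2 + (Im t)\<^sup>2)"
    by (simp add: power2_eq_square algebra_simps)
  finally have Re_quotient: "Re (t / ?d) = (Re t + r) / (norm ?d)\<^sup>2" by (simp add: unit)
  have "(norm ?d)\<^sup>2 \<noteq> 0" using norm_1_plus_scaled_ge[of r t] r t by auto
  then have "1 - 2 * r * ((Re t + r) / (norm ?d)\<^sup>2) = ((norm ?d)\<^sup>2 - 2 * r * (Re t + r)) / (norm ?d)\<^sup>2"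
    by (simp add: diff_divide_distrib)
  also have "(norm ?d)\<^sup>2 - 2 * r * (Re t + r) = 1 - r\<^sup>2"
    unfolding norm_d by (simp add: power2_eq_square algebra_simps)
  finally show ?thesis unfolding Re_quotient poisson_kernel_def by simp
qed

lemma poisson_kernel_mult_le:
  assumes r: "0 \<le> r" "r < 1" and t: "norm t = 1"
  shows "poisson_kernel r t * (norm ((1 + t) / 2))\<^sup>2 \<le> 1 - r\<^sup>2"
proof -
  let ?d = "norm (1 + complex_of_real r * t)"
  have d: "1 - r \<le> ?d" using norm_1_plus_scaled_ge[of r t] r t by simp
  have "norm (1 + t) \<le> ?d + norm (complex_of_real (1 - r) * t)"
    using norm_triangle_ineq[of "1 + complex_of_real r * t" "complex_of_real (1 - r) * t"]
    by (simp add: algebra_simps)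
  also have "norm (complex_of_real (1 - r) * t) = 1 - r"
    using r t by (simp add: norm_mult del: of_real_diff)
  finally have "norm ((1 + t) / 2) \<le> ?d" using d by (simp add: norm_divide)
  then have "(1 - r\<^sup>2) * (norm ((1 + t) / 2))\<^sup>2 \<le> (1 - r\<^sup>2) * ?d\<^sup>2"
    using r by (intro mult_left_mono power_mono) (auto simp: power_le_one_iff)
  moreover have "?d > 0" using d r by linarith
  ultimately show ?thesis by (simp add: poisson_kernel_def divide_le_eq)
qed

subsection \<open>Hermite--Biehler functions without real zeros\<close>

lemma integrable_inverse_1_plus_square_UNIV: "integrable lborel (\<lambda>x::real. 1 / (1 + x\<^sup>2))"
  using integrable_inverse_1_plus_square by (simp add: set_integrable_def inverse_eq_divide)

locale zero_free_hermite_biehler =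
  fixes E :: "complex \<Rightarrow> complex"
  assumes hermite_biehler: "hermite_biehler E" and E_real_nonzero: "E (complex_of_real x) \<noteq> 0"
begin

abbreviation A :: "complex \<Rightarrow> complex" where
  "A \<equiv> dB_A E"

definition \<Theta> :: "complex \<Rightarrow> complex" where
  "\<Theta> z = star_fun E z / E z"

definition boundary :: "(complex \<Rightarrow> complex) \<Rightarrow> real \<Rightarrow> complex" where
  "boundary F x = F (complex_of_real x) / E (complex_of_real x)"

lemma E_holomorphic: "E holomorphic_on S"
  using hermite_biehler unfolding hermite_biehler_def entire_def by (blast intro: holomorphic_on_subset)

lemma star_E_holomorphic: "star_fun E holomorphic_on S"
  using star_fun_holomorphic[OF E_holomorphic] by (rule holomorphic_on_subset) simp

lemma A_holomorphic: "A holomorphic_on S"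
  unfolding dB_A_def[abs_def] by (intro holomorphic_intros E_holomorphic star_E_holomorphic) auto

lemma star_E_real: "star_fun E (complex_of_real x) = cnj (E (complex_of_real x))"
  by (simp add: star_fun_def)

lemma star_A: "star_fun A z = A z"
  by (simp add: dB_A_def star_fun_def add.commute)

lemma norm_star_E_less: "z \<in> UHP \<Longrightarrow> norm (star_fun E z) < norm (E z)"
  using hermite_biehler by (simp add: hermite_biehler_def UHP_def star_fun_def)

lemma E_nonzero: "0 \<le> Im z \<Longrightarrow> E z \<noteq> 0"
  by (erule closed_UHP_cases) (use norm_star_E_less E_real_nonzero in fastforce)+

lemma norm_\<Theta>_real: "norm (\<Theta> (complex_of_real x)) = 1"
  using E_real_nonzero[of x] by (simp add: \<Theta>_def norm_divide star_E_real)

lemma norm_\<Theta>_le: "0 \<le> Im z \<Longrightarrow> norm (\<Theta> z) \<le> 1"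
proof (erule closed_UHP_cases)
  assume "z \<in> UHP"
  then show ?thesis using norm_star_E_less[of z] by (simp add: \<Theta>_def norm_divide divide_le_eq)
qed (simp add: norm_\<Theta>_real)

lemma A_over_E: "0 \<le> Im z \<Longrightarrow> A z / E z = (1 + \<Theta> z) / 2"
  using E_nonzero[of z] by (simp add: dB_A_def \<Theta>_def field_simps)

lemma norm_A_over_E_le: "0 \<le> Im z \<Longrightarrow> norm (A z / E z) \<le> 1"
  using norm_triangle_ineq[of 1 "\<Theta> z"] norm_\<Theta>_le[of z] by (simp add: A_over_E norm_divide)

text \<open>\<open>(E + E\<^sup>*) / (E - E\<^sup>*)\<close> maps the upper half-plane into the right half-plane, so Hopf's lemma
  applies to it.\<close>
lemma real_zero_of_A_simple:
  assumes A0: "A (complex_of_real x) = 0" and deriv: "(A has_field_derivative d) (at (complex_of_real x))"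
  shows "d \<noteq> 0"
proof -
  let ?x = "complex_of_real x" and ?D = "\<lambda>z. E z - star_fun E z"
  define g where "g z = 2 * A z / ?D z" for z
  have ball: "z \<in> UHP" if "z \<in> ball (?x + \<i>) 1" for z
    using abs_Im_le_cmod[of "?x + \<i> - z"] that by (simp add: dist_norm UHP_def)
  have nz: "?D z \<noteq> 0" if "z \<in> UHP" for z using norm_star_E_less[OF that] by auto
  have star_E_x: "star_fun E ?x = - E ?x" using A0 by (simp add: dB_A_def add_eq_0_iff)
  have "2 * d / (2 * E ?x) \<noteq> 0"
  proof (rule Hopf_boundary_derivative[where g = g and c = "?x + \<i>" and p = ?x])
    show "g holomorphic_on ball (?x + \<i>) 1"
      unfolding g_def using nz ball
      by (intro holomorphic_intros A_holomorphic E_holomorphic star_E_holomorphic) auto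
    show "0 < Re (g z)" if "z \<in> ball (?x + \<i>) 1" for z
    proof -
      have "2 * A z = E z + star_fun E z" by (simp add: dB_A_def)
      then have "g z = (E z + star_fun E z) / ?D z" by (simp only: g_def)
      then have "Re (g z) = Re ((E z + star_fun E z) * cnj (?D z)) / (norm (?D z))\<^sup>2"
        by (subst (asm) complex_div_cnj) (simp add: Re_divide_of_real)
      also have "Re ((E z + star_fun E z) * cnj (?D z)) = (norm (E z))\<^sup>2 - (norm (star_fun E z))\<^sup>2"
        unfolding cmod_power2 by (simp add: power2_eq_square algebra_simps)
      also have "0 < \<dots> / (norm (?D z))\<^sup>2"
        using norm_star_E_less[OF ball[OF that]] nz[OF ball[OF that]] by (simp add: power_strict_mono)
      finally show ?thesis .
    qed
    have "(?D has_field_derivative deriv ?D ?x) (at ?x)"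
      by (rule holomorphic_derivI[of _ UNIV])
        (auto intro!: holomorphic_intros E_holomorphic star_E_holomorphic)
    then have "(g has_field_derivative (2 * d * ?D ?x - 2 * A ?x * deriv ?D ?x) / (?D ?x * ?D ?x)) (at ?x)"
      unfolding g_def using E_real_nonzero[of x] star_E_x
      by (intro DERIV_divide DERIV_cmult deriv) auto
    then show "(g has_field_derivative 2 * d / (2 * E ?x)) (at ?x)"
      using E_real_nonzero[of x] by (simp add: A0 star_E_x)
  qed (use A0 in \<open>auto simp: g_def dist_norm\<close>)
  then show ?thesis by simp
qed

lemma quotient_holomorphic_on_UHP:
  assumes "G holomorphic_on UNIV"
  shows "(\<lambda>z. G z / E z) holomorphic_on UHP"
  by (rule holomorphic_on_divide[OF holomorphic_on_subset[OF assms] E_holomorphic])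
     (use E_nonzero in \<open>auto simp: UHP_def\<close>)

lemma quotient_continuous_on_closed_UHP:
  assumes "G holomorphic_on UNIV"
  shows "continuous_on closed_UHP (\<lambda>z. G z / E z)"
  by (intro continuous_on_divide holomorphic_on_imp_continuous_on
    holomorphic_on_subset[OF assms] E_holomorphic)
     (use E_nonzero in auto)

lemma continuous_on_boundary:
  assumes "G holomorphic_on UNIV"
  shows "continuous_on S (boundary G)"
  unfolding boundary_def
  by (rule continuous_on_compose2[OF quotient_continuous_on_closed_UHP[OF assms]])
     (auto intro!: continuous_intros)

lemma measurable_boundary: "G holomorphic_on UNIV \<Longrightarrow> boundary G \<in> borel_measurable lborel"
  unfolding measurable_lborel2 by (intro borel_measurable_continuous_onI continuous_on_boundary)

lemma boundary_star: "boundary (star_fun G) x = cnj (boundary G x) * \<Theta> (complex_of_real x)"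
  using E_real_nonzero[of x] by (simp add: boundary_def \<Theta>_def star_E_real) (simp add: star_fun_def)

lemma boundary_A: "boundary A x = (1 + \<Theta> (complex_of_real x)) / 2"
  unfolding boundary_def by (rule A_over_E) simp

lemma norm_boundary_A_le: "norm (boundary A x) \<le> 1"
  unfolding boundary_def by (rule norm_A_over_E_le) simp

subsection \<open>Admissible functions and Poisson quadrature\<close>

definition admissible :: "(complex \<Rightarrow> complex) \<Rightarrow> bool" where
  "admissible G \<longleftrightarrow> G holomorphic_on UNIV \<and> tame (\<lambda>z. G z / E z)"

lemma admissible_add:
  assumes "admissible F" "admissible G"
  shows "admissible (\<lambda>z. F z + G z)"
  using assms tame_add[of "\<lambda>z. F z / E z" "\<lambda>z. G z / E z"]
  by (auto simp: admissible_def add_divide_distrib intro!: holomorphic_intros)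

lemma admissible_mult:
  assumes "p holomorphic_on UNIV" "tame p" "admissible G"
  shows "admissible (\<lambda>z. p z * G z)"
  using assms tame_mult[of p "\<lambda>z. G z / E z"] by (auto simp: admissible_def intro!: holomorphic_intros)

lemma admissible_divide_linear:
  assumes F: "admissible F" and H: "H holomorphic_on UNIV" and eq: "\<And>z. F z = (z - complex_of_real a) * H z"
  shows "admissible H"
proof -
  have "tame (\<lambda>z. F z / E z * (1 / (z - complex_of_real a)))"
    using F by (intro tame_mult tame_inverse_linear) (simp add: admissible_def)
  moreover have "F z / E z * (1 / (z - complex_of_real a)) = H z / E z" if "z \<in> UHP" for z
  proof -
    have "z - complex_of_real a \<noteq> 0" using that by (auto simp: UHP_def complex_eq_iff)
    then show ?thesis by (simp add: eq)
  qed
  ultimately have "tame (\<lambda>z. H z / E z)" by (rule tame_cong)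
  then show ?thesis using H by (simp add: admissible_def)
qed

lemma integral_boundary_eq_0:
  assumes "admissible G" "integrable lborel (boundary G)"
  shows "(LINT x|lborel. boundary G x) = 0"
  using assms unfolding boundary_def
  by (intro integral_eq_0_if_tame[where f = "\<lambda>z. G z / E z"] quotient_continuous_on_closed_UHP
      quotient_holomorphic_on_UHP) (auto simp: admissible_def)

lemma \<Theta>_holomorphic: "\<Theta> holomorphic_on UHP"
  unfolding \<Theta>_def[abs_def] by (rule quotient_holomorphic_on_UHP[OF star_E_holomorphic])

lemma \<Theta>_continuous: "continuous_on closed_UHP \<Theta>"
  unfolding \<Theta>_def[abs_def] by (rule quotient_continuous_on_closed_UHP[OF star_E_holomorphic])

lemma resolvent_denominator_nonzero:
  assumes "0 \<le> r" "r < 1" "0 \<le> Im z"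
  shows "1 + complex_of_real r * \<Theta> z \<noteq> 0"
  using norm_1_plus_scaled_ge[OF assms(1) norm_\<Theta>_le[OF assms(3)]] assms(2) by auto

lemma norm_resolvent_le:
  assumes "0 \<le> r" "r < 1" "0 \<le> Im z"
  shows "norm (1 / (1 + complex_of_real r * \<Theta> z)) \<le> 1 / (1 - r)"
  using norm_1_plus_scaled_ge[OF assms(1) norm_\<Theta>_le[OF assms(3)]] assms(2)
  by (simp add: norm_divide frac_le)

abbreviation Pois :: "real \<Rightarrow> real \<Rightarrow> real" where
  "Pois r x \<equiv> poisson_kernel r (\<Theta> (complex_of_real x))"

lemma integral_eq_0_resolvent:
  assumes F: "admissible F" and G: "admissible (star_fun G)" and r: "0 \<le> r" "r < 1"
    and q: "\<And>x. boundary F x * cnj (boundary G x) = complex_of_real (q x)"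
    and int_q: "integrable lborel q"
  defines "f \<equiv> \<lambda>x. complex_of_real (q x)
      * (\<Theta> (complex_of_real x) / (1 + complex_of_real r * \<Theta> (complex_of_real x)))"
  shows "integrable lborel f" "(LINT x|lborel. f x) = 0"
proof -
  define s where "s z = 1 / (1 + complex_of_real r * \<Theta> z)" for z
  define H where "H z = F z / E z * (star_fun G z / E z) * s z" for z
  have hol: "F holomorphic_on UNIV" "star_fun G holomorphic_on UNIV"
    and tame_quotients: "tame (\<lambda>z. F z / E z)" "tame (\<lambda>z. star_fun G z / E z)"
    using F G by (auto simp: admissible_def)
  note denominator = resolvent_denominator_nonzero[OF r]
  have cont: "continuous_on closed_UHP H"
    unfolding H_def s_def using denominator
    by (intro continuous_on_mult quotient_continuous_on_closed_UHP hol continuous_intros \<Theta>_continuous) auto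
  have hol_H: "H holomorphic_on UHP"
    unfolding H_def s_def using denominator
    by (intro holomorphic_on_mult quotient_holomorphic_on_UHP hol holomorphic_intros \<Theta>_holomorphic)
       (auto simp: UHP_def)
  have "tame s"
    unfolding s_def
    by (rule tame_bounded[where B = "1 / (1 - r)"]) (use norm_resolvent_le[OF r] in \<open>auto simp: UHP_def\<close>)
  then have tame_H: "tame H"
    unfolding H_def by (intro tame_mult tame_quotients)
  have H_real: "H (complex_of_real x) = f x" for x
    unfolding H_def f_def boundary_def[symmetric] boundary_star q[symmetric] s_def by simp
  show int_f: "integrable lborel f"
  proof (rule Bochner_Integration.integrable_bound)
    show "integrable lborel (\<lambda>x. 1 / (1 - r) * q x)" using int_q by simp
    have "continuous_on UNIV f"
      unfolding H_real[symmetric, abs_def]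
      by (rule continuous_on_compose2[OF cont]) (auto intro!: continuous_intros)
    then show "f \<in> borel_measurable lborel"
      unfolding measurable_lborel2 by (rule borel_measurable_continuous_onI)
    have "norm (f x) \<le> \<bar>q x\<bar> * (1 / (1 - r))" for x
      using norm_resolvent_le[OF r, of "complex_of_real x"]
      unfolding f_def norm_mult norm_of_real norm_divide norm_\<Theta>_real by (intro mult_left_mono) auto
    then show "AE x in lborel. norm (f x) \<le> norm (1 / (1 - r) * q x)"
      using r by (intro AE_I2) (simp add: abs_mult)
  qed
  show "(LINT x|lborel. f x) = 0"
    using integral_eq_0_if_tame[OF cont hol_H tame_H] int_f unfolding H_real by simp
qed

lemma Poisson_quadrature:
  assumes F: "admissible F" and G: "admissible (star_fun G)" and r: "0 \<le> r" "r < 1"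
    and q: "\<And>x. boundary F x * cnj (boundary G x) = complex_of_real (q x)"
    and int_q: "integrable lborel q"
  shows "integrable lborel (\<lambda>x. Pois r x * q x)"
    and "(LINT x|lborel. Pois r x * q x) = (LINT x|lborel. q x)"
proof -
  define f where "f x = complex_of_real (q x)
      * (\<Theta> (complex_of_real x) / (1 + complex_of_real r * \<Theta> (complex_of_real x)))" for x
  have int_f: "integrable lborel f" and integral_f: "(LINT x|lborel. f x) = 0"
    unfolding f_def using integral_eq_0_resolvent[OF F G r q int_q] by blast+
  have "Re (f x) = q x * Re (\<Theta> (complex_of_real x) / (1 + complex_of_real r * \<Theta> (complex_of_real x)))" for x
  proof -
    have "Re (complex_of_real t * w) = t * Re w" for t w by simp
    then show ?thesis unfolding f_def .
  qed
  then have poisson: "Pois r x * q x = q x - 2 * r * Re (f x)" for x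
    by (simp add: poisson_kernel_eq[OF r norm_\<Theta>_real] algebra_simps)
  show "integrable lborel (\<lambda>x. Pois r x * q x)"
    unfolding poisson using int_q int_f by simp
  have "(LINT x|lborel. Re (f x)) = 0"
    using integral_Re[OF int_f] integral_f by simp
  then show "(LINT x|lborel. Pois r x * q x) = (LINT x|lborel. q x)"
    unfolding poisson using int_q int_f by simp
qed

subsection \<open>The domain of multiplication by the variable\<close>

definition dB_density :: "(complex \<Rightarrow> complex) \<Rightarrow> real \<Rightarrow> real" where
  "dB_density F x = (norm (boundary F x))\<^sup>2"

definition dB_cross :: "(complex \<Rightarrow> complex) \<Rightarrow> (complex \<Rightarrow> complex) \<Rightarrow> real \<Rightarrow> real" where
  "dB_cross F G x = Re (boundary F x * cnj (boundary G x))"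

definition mult_domain :: "(complex \<Rightarrow> complex) set" where
  "mult_domain = {F. admissible F \<and> admissible (star_fun F) \<and>
    integrable lborel (\<lambda>x. (1 + x\<^sup>2) * dB_density F x)}"

lemma dB_density_nonneg: "0 \<le> dB_density F x"
  by (simp add: dB_density_def)

lemma dB_density_cmult: "dB_density (\<lambda>z. c * F z) x = (norm c)\<^sup>2 * dB_density F x"
  by (simp add: dB_density_def boundary_def norm_mult norm_divide power_mult_distrib power_divide)

lemma dB_density_add: "dB_density (\<lambda>z. F z + G z) x = dB_density F x + 2 * dB_cross F G x + dB_density G x"
proof -
  have "(norm (u + v))\<^sup>2 = (norm u)\<^sup>2 + 2 * Re (u * cnj v) + (norm v)\<^sup>2" for u v :: complex
    unfolding cmod_power2 by (simp add: power2_eq_square algebra_simps)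
  then show ?thesis unfolding dB_density_def dB_cross_def boundary_def add_divide_distrib .
qed

lemma dB_cross_le: "2 * \<bar>dB_cross F G x\<bar> \<le> dB_density F x + dB_density G x"
proof -
  let ?u = "boundary F x" and ?v = "boundary G x"
  have "2 * \<bar>Re (?u * cnj ?v)\<bar> \<le> 2 * norm ?u * norm ?v"
    using abs_Re_le_cmod[of "?u * cnj ?v"] by (simp add: norm_mult)
  also have "\<dots> \<le> (norm ?u)\<^sup>2 + (norm ?v)\<^sup>2" by (rule sum_squares_bound)
  finally show ?thesis by (simp add: dB_density_def dB_cross_def)
qed

lemma continuous_on_dB_density: "F holomorphic_on UNIV \<Longrightarrow> continuous_on S (dB_density F)"
  unfolding dB_density_def[abs_def] by (intro continuous_intros continuous_on_boundary)

lemma measurable_dB_density: "F holomorphic_on UNIV \<Longrightarrow> dB_density F \<in> borel_measurable lborel"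
  unfolding measurable_lborel2 by (intro borel_measurable_continuous_onI continuous_on_dB_density)

lemma measurable_dB_cross:
  "F holomorphic_on UNIV \<Longrightarrow> G holomorphic_on UNIV \<Longrightarrow> dB_cross F G \<in> borel_measurable lborel"
  unfolding measurable_lborel2 dB_cross_def[abs_def]
  by (intro borel_measurable_continuous_onI continuous_intros continuous_on_boundary)

lemma mult_domain_holomorphic: "F \<in> mult_domain \<Longrightarrow> F holomorphic_on UNIV"
  by (simp add: mult_domain_def admissible_def)

lemma integrable_dB_density_mult:
  assumes F: "F \<in> mult_domain" and g: "g \<in> borel_measurable lborel" "\<And>x. \<bar>g x\<bar> \<le> B * (1 + x\<^sup>2)"
  shows "integrable lborel (\<lambda>x. g x * dB_density F x)"
proof (rule Bochner_Integration.integrable_bound)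
  show "integrable lborel (\<lambda>x. B * ((1 + x\<^sup>2) * dB_density F x))" using F by (simp add: mult_domain_def)
  show "(\<lambda>x. g x * dB_density F x) \<in> borel_measurable lborel"
    using g(1) measurable_dB_density[OF mult_domain_holomorphic[OF F]] by (rule borel_measurable_times)
  have "norm (g x * dB_density F x) \<le> norm (B * ((1 + x\<^sup>2) * dB_density F x))" for x
  proof -
    have "norm (g x * dB_density F x) = \<bar>g x\<bar> * dB_density F x"
      using dB_density_nonneg by (simp add: abs_mult)
    also have "\<dots> \<le> B * (1 + x\<^sup>2) * dB_density F x"
      using g(2) dB_density_nonneg by (rule mult_right_mono)
    finally show ?thesis by (simp add: mult.assoc)
  qed
  then show "AE x in lborel. norm (g x * dB_density F x) \<le> norm (B * ((1 + x\<^sup>2) * dB_density F x))"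
    by (intro AE_I2)
qed

lemma abs_product_linear_le: "\<bar>(x - a) * (x - b)\<bar> \<le> (2 + a\<^sup>2 + b\<^sup>2) * (1 + x\<^sup>2)" for a b x :: real
proof -
  have "2 * \<bar>(x - a) * (x - b)\<bar> \<le> (x - a)\<^sup>2 + (x - b)\<^sup>2"
    using sum_squares_bound[of "\<bar>x - a\<bar>" "\<bar>x - b\<bar>"] by (simp add: abs_mult)
  also have "\<dots> \<le> 2 * (x\<^sup>2 + a\<^sup>2) + 2 * (x\<^sup>2 + b\<^sup>2)"
    using zero_le_power2[of "x + a"] zero_le_power2[of "x + b"] by (simp add: power2_eq_square algebra_simps)
  also have "\<dots> \<le> 2 * ((2 + a\<^sup>2 + b\<^sup>2) * (1 + x\<^sup>2))" by (simp add: algebra_simps)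
  finally show ?thesis by simp
qed

lemma integrable_product_linear_dB_density:
  "F \<in> mult_domain \<Longrightarrow> integrable lborel (\<lambda>x. (x - a) * (x - b) * dB_density F x)"
  by (rule integrable_dB_density_mult[OF _ _ abs_product_linear_le]) simp_all

lemma integrable_dB_density: "F \<in> mult_domain \<Longrightarrow> integrable lborel (dB_density F)"
  using integrable_dB_density_mult[of F "\<lambda>_. 1" 1] by simp

lemma integrable_product_linear_dB_cross:
  assumes F: "F \<in> mult_domain" and G: "G \<in> mult_domain"
  shows "integrable lborel (\<lambda>x. (x - a) * (x - b) * dB_cross F G x)"
proof (rule Bochner_Integration.integrable_bound)
  show "integrable lborel (\<lambda>x. \<bar>(x - a) * (x - b) * dB_density F x\<bar> + \<bar>(x - a) * (x - b) * dB_density G x\<bar>)"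
    by (intro Bochner_Integration.integrable_add integrable_abs integrable_product_linear_dB_density F G)
  show "(\<lambda>x. (x - a) * (x - b) * dB_cross F G x) \<in> borel_measurable lborel"
    by (intro borel_measurable_times measurable_dB_cross mult_domain_holomorphic F G) simp_all
  have "\<bar>dB_cross F G x\<bar> \<le> dB_density F x + dB_density G x" for x
    using dB_cross_le[of F G x] by linarith
  then have "\<bar>(x - a) * (x - b)\<bar> * \<bar>dB_cross F G x\<bar>
      \<le> \<bar>(x - a) * (x - b)\<bar> * (dB_density F x + dB_density G x)" for x
    by (rule mult_left_mono) simp
  then show "AE x in lborel. norm ((x - a) * (x - b) * dB_cross F G x)
      \<le> norm (\<bar>(x - a) * (x - b) * dB_density F x\<bar> + \<bar>(x - a) * (x - b) * dB_density G x\<bar>)"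
    using dB_density_nonneg by (intro AE_I2) (simp add: abs_mult distrib_left)
qed

lemma mult_domain_add:
  assumes F: "F \<in> mult_domain" and G: "G \<in> mult_domain"
  shows "(\<lambda>z. F z + G z) \<in> mult_domain"
proof -
  have adm: "admissible (\<lambda>z. F z + G z)" "admissible (star_fun (\<lambda>z. F z + G z))"
    using F G admissible_add by (auto simp: mult_domain_def star_fun_def[abs_def])
  have "integrable lborel (\<lambda>x. (1 + x\<^sup>2) * dB_density (\<lambda>z. F z + G z) x)"
  proof (rule Bochner_Integration.integrable_bound)
    show "integrable lborel (\<lambda>x. 2 * ((1 + x\<^sup>2) * dB_density F x) + 2 * ((1 + x\<^sup>2) * dB_density G x))"
      using F G by (auto simp: mult_domain_def)
    show "(\<lambda>x. (1 + x\<^sup>2) * dB_density (\<lambda>z. F z + G z) x) \<in> borel_measurable lborel"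
      using measurable_dB_density[of "\<lambda>z. F z + G z"] adm by (simp add: admissible_def)
    have "dB_density (\<lambda>z. F z + G z) x \<le> 2 * dB_density F x + 2 * dB_density G x" for x
      using dB_cross_le[of F G x] unfolding dB_density_add by linarith
    then have "(1 + x\<^sup>2) * dB_density (\<lambda>z. F z + G z) x
        \<le> (1 + x\<^sup>2) * (2 * dB_density F x + 2 * dB_density G x)" for x
      by (rule mult_left_mono) simp
    then show "AE x in lborel. norm ((1 + x\<^sup>2) * dB_density (\<lambda>z. F z + G z) x)
        \<le> norm (2 * ((1 + x\<^sup>2) * dB_density F x) + 2 * ((1 + x\<^sup>2) * dB_density G x))"
      using dB_density_nonneg by (intro AE_I2) (simp add: abs_mult algebra_simps)
  qed
  then show ?thesis using adm by (simp add: mult_domain_def)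
qed

lemma mult_domain_cmult:
  assumes F: "F \<in> mult_domain"
  shows "(\<lambda>z. c * F z) \<in> mult_domain"
proof -
  have "star_fun (\<lambda>z. c * F z) = (\<lambda>z. cnj c * star_fun F z)" by (simp add: star_fun_def[abs_def])
  then have "admissible (\<lambda>z. c * F z)" "admissible (star_fun (\<lambda>z. c * F z))"
    using F by (auto simp: mult_domain_def intro!: admissible_mult tame_const)
  moreover have "integrable lborel (\<lambda>x. (norm c)\<^sup>2 * ((1 + x\<^sup>2) * dB_density F x))"
    using F by (simp add: mult_domain_def)
  ultimately show ?thesis by (simp add: mult_domain_def dB_density_cmult mult.left_commute)
qed

lemma dB_density_linear_mult: "dB_density (\<lambda>z. (z - complex_of_real a) * H z) x = (x - a)\<^sup>2 * dB_density H x"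
proof -
  have "norm (complex_of_real x - complex_of_real a) = \<bar>x - a\<bar>"
    unfolding of_real_diff[symmetric] by (rule norm_of_real)
  then show ?thesis
    by (simp add: dB_density_def boundary_def norm_mult norm_divide power_mult_distrib power_divide)
qed

lemma dB_cross_linear_mult: "dB_cross (\<lambda>z. (z - complex_of_real a) * H z) H x = (x - a) * dB_density H x"
proof -
  have "dB_cross (\<lambda>z. (z - complex_of_real a) * H z) H x
      = Re (complex_of_real (x - a) * (boundary H x * cnj (boundary H x)))"
    by (simp add: dB_cross_def boundary_def mult.assoc)
  also have "\<dots> = (x - a) * (norm (boundary H x))\<^sup>2"
    unfolding complex_norm_square[symmetric] by simp
  finally show ?thesis by (simp add: dB_density_def)
qed

lemma dB_density_divide_linear_le:
  assumes H: "H holomorphic_on UNIV"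
  obtains K where "K > 0" "\<And>x. (1 + x\<^sup>2) * dB_density H x
    \<le> (1 + x\<^sup>2) * dB_density (\<lambda>z. (z - complex_of_real a) * H z) x + K * indicator {a - 1..a + 1} x"
proof -
  let ?I = "{a - 1..a + 1}"
  have "bounded ((\<lambda>x. (1 + x\<^sup>2) * dB_density H x) ` ?I)"
    by (intro compact_imp_bounded compact_continuous_image continuous_intros continuous_on_dB_density H) auto
  then obtain K where K: "K > 0" "\<And>x. x \<in> ?I \<Longrightarrow> norm ((1 + x\<^sup>2) * dB_density H x) \<le> K"
    unfolding bounded_pos by auto
  have "(1 + x\<^sup>2) * dB_density H x
      \<le> (1 + x\<^sup>2) * dB_density (\<lambda>z. (z - complex_of_real a) * H z) x + K * indicator ?I x" for x
  proof (cases "x \<in> ?I")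
    case True
    have "0 \<le> (1 + x\<^sup>2) * dB_density (\<lambda>z. (z - complex_of_real a) * H z) x"
      by (intro mult_nonneg_nonneg dB_density_nonneg) simp
    then show ?thesis using K(2)[OF True] True by simp
  next
    case False
    then have "1\<^sup>2 \<le> \<bar>x - a\<bar>\<^sup>2" by (intro power_mono) auto
    then have "(1 + x\<^sup>2) * (1 * dB_density H x) \<le> (1 + x\<^sup>2) * ((x - a)\<^sup>2 * dB_density H x)"
      by (intro mult_left_mono mult_right_mono dB_density_nonneg) auto
    then show ?thesis using False by (simp add: dB_density_linear_mult)
  qed
  with K(1) show thesis by (rule that)
qed

lemma mult_domain_divide_linear:
  assumes F: "F \<in> mult_domain" and H: "H holomorphic_on UNIV" and eq: "\<And>z. F z = (z - complex_of_real a) * H z"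
  shows "H \<in> mult_domain"
proof -
  have "star_fun F z = (z - complex_of_real a) * star_fun H z" for z by (simp add: star_fun_def eq)
  then have adm: "admissible H" "admissible (star_fun H)"
    using F H star_fun_holomorphic[OF H] admissible_divide_linear[OF _ _ eq]
      admissible_divide_linear[of "star_fun F" "star_fun H"]
    by (auto simp: mult_domain_def)
  have F_eq: "F = (\<lambda>z. (z - complex_of_real a) * H z)" using eq by (rule ext)
  let ?I = "{a - 1..a + 1}"
  obtain K where K: "K > 0" "\<And>x. (1 + x\<^sup>2) * dB_density H x \<le> (1 + x\<^sup>2) * dB_density F x + K * indicator ?I x"
    using dB_density_divide_linear_le[OF H, of a] unfolding F_eq by blast
  have "integrable lborel (\<lambda>x. (1 + x\<^sup>2) * dB_density H x)"
  proof (rule Bochner_Integration.integrable_bound)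
    have "integrable lborel (indicator ?I :: real \<Rightarrow> real)"
      by (intro integrable_real_indicator) (auto simp: emeasure_lborel_Icc_eq)
    then show "integrable lborel (\<lambda>x. (1 + x\<^sup>2) * dB_density F x + K * indicator ?I x)"
      using F by (auto simp: mult_domain_def)
    show "(\<lambda>x. (1 + x\<^sup>2) * dB_density H x) \<in> borel_measurable lborel"
      using measurable_dB_density[OF H] by simp
    show "AE x in lborel. norm ((1 + x\<^sup>2) * dB_density H x)
        \<le> norm ((1 + x\<^sup>2) * dB_density F x + K * indicator ?I x)"
      using K dB_density_nonneg by (intro AE_I2) (simp add: abs_mult)
  qed
  then show ?thesis using adm by (simp add: mult_domain_def)
qed

end

context zero_free_hermite_biehler
begin

subsection \<open>Norms and membership in the de Branges space\<close>

lemma dB_normsq_eq: "dB_normsq E F = (\<integral>\<^sup>+ x. ennreal (dB_density F x) \<partial>lborel)"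
  by (simp add: dB_normsq_def dB_density_def boundary_def norm_divide power_divide)

lemma dB_normsq_times_eq: "dB_normsq E (\<lambda>z. z * F z) = (\<integral>\<^sup>+ x. ennreal (x\<^sup>2 * dB_density F x) \<partial>lborel)"
  by (simp add: dB_normsq_def dB_density_def boundary_def norm_divide norm_mult
    power_divide power_mult_distrib)

lemma dB_space_admissible:
  assumes "F \<in> dB_space E"
  shows "admissible F" "admissible (star_fun F)"
proof -
  have F: "F holomorphic_on UNIV" using assms by (simp add: dB_space_def entire_def)
  show "admissible F" "admissible (star_fun F)"
    unfolding admissible_def using assms F star_fun_holomorphic[OF F]
    by (auto simp: dB_space_def intro!: bounded_type_imp_tame quotient_holomorphic_on_UHP)
qed

lemma eq_0_if_AE_dB_density_eq_0:
  assumes "F holomorphic_on UNIV" "AE x in lborel. dB_density F x = 0"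
  shows "F = (\<lambda>_. 0)"
proof (rule entire_eq_0_if_AE_zero[OF assms(1)])
  show "AE x in lborel. F (complex_of_real x) = 0"
    using assms(2) by eventually_elim (simp add: dB_density_def boundary_def E_real_nonzero)
qed

lemma dB_normsq_nonzero:
  assumes F: "F holomorphic_on UNIV" "F \<noteq> (\<lambda>_. 0)"
  shows "dB_normsq E F \<noteq> 0"
proof
  assume "dB_normsq E F = 0"
  moreover have "(\<lambda>x. ennreal (dB_density F x)) \<in> borel_measurable lborel"
    by (rule measurable_compose[OF measurable_dB_density[OF F(1)] measurable_ennreal])
  ultimately have "AE x in lborel. ennreal (dB_density F x) = 0"
    unfolding dB_normsq_eq by (simp add: nn_integral_0_iff_AE)
  then have "AE x in lborel. dB_density F x = 0"
  proof eventually_elim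
    case (elim x)
    then show ?case using dB_density_nonneg[of F x] by (simp add: ennreal_eq_0_iff)
  qed
  then show False using eq_0_if_AE_dB_density_eq_0 F by blast
qed

lemma dB_space_imp_mult_domain:
  assumes F: "F \<in> dB_space E" and finite: "dB_normsq E (\<lambda>z. z * F z) \<noteq> \<infinity>"
  shows "F \<in> mult_domain"
proof -
  note adm = dB_space_admissible[OF F]
  then have "F holomorphic_on UNIV" by (simp add: admissible_def)
  note meas = measurable_dB_density[OF this]
  have "integrable lborel (dB_density F)"
    using F meas dB_density_nonneg unfolding dB_space_def dB_normsq_eq
    by (intro integrableI_nonneg) auto
  moreover have "integrable lborel (\<lambda>x. x\<^sup>2 * dB_density F x)"
    using finite meas dB_density_nonneg unfolding dB_normsq_times_eq
    by (intro integrableI_nonneg) (auto simp: less_top)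
  ultimately have "integrable lborel (\<lambda>x. dB_density F x + x\<^sup>2 * dB_density F x)"
    by (rule Bochner_Integration.integrable_add)
  then show ?thesis using adm by (simp add: mult_domain_def distrib_right)
qed

lemma norm_ratio_mult_domain:
  assumes F: "F \<in> mult_domain" "F \<noteq> (\<lambda>_. 0)"
  defines "N \<equiv> (LINT x|lborel. dB_density F x)"
  shows "N > 0"
    "dB_norm E (\<lambda>z. z * F z) / dB_norm E F = ereal (sqrt ((LINT x|lborel. x\<^sup>2 * dB_density F x) / N))"
proof -
  define Z where "Z = (LINT x|lborel. x\<^sup>2 * dB_density F x)"
  have nonneg: "N \<ge> 0" "Z \<ge> 0" unfolding N_def Z_def by (simp_all add: dB_density_nonneg)
  have normsq: "dB_normsq E F = ennreal N"
    unfolding dB_normsq_eq N_def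
    using nn_integral_eq_integral[OF integrable_dB_density[OF F(1)]] dB_density_nonneg by simp
  have int_times: "integrable lborel (\<lambda>x. x\<^sup>2 * dB_density F x)"
    using integrable_product_linear_dB_density[OF F(1), of 0 0] by (simp add: power2_eq_square)
  have normsq_times: "dB_normsq E (\<lambda>z. z * F z) = ennreal Z"
    unfolding dB_normsq_times_eq Z_def using nn_integral_eq_integral[OF int_times] dB_density_nonneg by simp
  show "N > 0"
    using dB_normsq_nonzero[OF mult_domain_holomorphic[OF F(1)] F(2)] nonneg(1) unfolding normsq
    by (cases "N = 0") auto
  then show "dB_norm E (\<lambda>z. z * F z) / dB_norm E F = ereal (sqrt (Z / N))"
    unfolding dB_norm_def normsq normsq_times using nonneg by (simp add: real_sqrt_divide)
qed

lemma norm_ratio_infinite: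
  assumes F: "F \<in> dB_space E" "F \<noteq> (\<lambda>_. 0)" and inf: "dB_normsq E (\<lambda>z. z * F z) = \<infinity>"
  shows "dB_norm E (\<lambda>z. z * F z) / dB_norm E F = \<infinity>"
proof -
  have finite: "dB_normsq E F < \<infinity>" using F(1) by (simp add: dB_space_def)
  moreover have "dB_normsq E F \<noteq> 0"
    using dB_space_admissible(1)[OF F(1)] F(2) by (intro dB_normsq_nonzero) (auto simp: admissible_def)
  ultimately have "enn2real (dB_normsq E F) > 0" by (simp add: enn2real_positive_iff zero_less_iff_neq_zero)
  then show ?thesis using inf finite by (simp add: dB_norm_def divide_ereal_def)
qed

lemma A_quotient_bounded_type:
  assumes eq: "\<And>z. G z * ((z - complex_of_real a) * (z - complex_of_real b)) = c * A z"
  shows "bounded_type (\<lambda>z. G z / E z)"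
proof (rule bounded_type_divide_linear[where a = a])
  show "bounded_type (\<lambda>z. G z / E z * (z - complex_of_real a))"
  proof (rule bounded_type_divide_linear[where a = b])
    show "bounded_type (\<lambda>z. c * (A z / E z))"
    proof (rule bounded_type_if_bounded[where B = "norm c"])
      show "(\<lambda>z. c * (A z / E z)) holomorphic_on UHP"
        by (intro holomorphic_intros quotient_holomorphic_on_UHP A_holomorphic)
      show "norm (c * (A z / E z)) \<le> norm c" if "z \<in> UHP" for z
        using norm_A_over_E_le[of z] that unfolding norm_mult by (intro mult_left_le) (auto simp: UHP_def)
    qed
    show "G z / E z * (z - complex_of_real a) * (z - complex_of_real b) = c * (A z / E z)" for z
      using eq[of z] by (simp add: mult.assoc)
  qed
qed simp

lemma A_quotient_mean_type_nonpos:
  assumes eq: "\<And>z. G z * ((z - complex_of_real a) * (z - complex_of_real b)) = c * A z"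
  shows "mean_type_nonpos (\<lambda>z. G z / E z)"
proof (rule mean_type_nonpos_if_bounded)
  show "\<forall>\<^sub>F y in at_top. norm (G (\<i> * complex_of_real y) / E (\<i> * complex_of_real y)) \<le> norm c"
    using eventually_ge_at_top[of 1]
  proof eventually_elim
    case (elim y)
    let ?z = "\<i> * complex_of_real y"
    have ge_1: "1 \<le> norm (?z - complex_of_real t)" for t
      using abs_Im_le_cmod[of "?z - complex_of_real t"] elim by simp
    have "norm (G ?z / E ?z) * 1
        \<le> norm (G ?z / E ?z) * norm ((?z - complex_of_real a) * (?z - complex_of_real b))"
      unfolding norm_mult using mult_mono[OF ge_1 ge_1, of a b] by (intro mult_left_mono) auto
    also have "\<dots> = norm (c * (A ?z / E ?z))"
      using eq[of ?z] by (simp add: norm_mult[symmetric])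
    also have "\<dots> \<le> norm c"
      unfolding norm_mult using norm_A_over_E_le[of ?z] elim by (intro mult_left_le) auto
    finally show ?case by simp
  qed
qed

lemma A_quotient_in_dB_space:
  assumes G: "G holomorphic_on UNIV"
    and eq: "\<And>z. G z * ((z - complex_of_real a) * (z - complex_of_real b)) = c * A z"
    and finite: "dB_normsq E G < \<infinity>"
  shows "G \<in> dB_space E"
proof -
  have star_eq: "star_fun G z * ((z - complex_of_real a) * (z - complex_of_real b)) = cnj c * A z" for z
    using arg_cong[OF eq[of "cnj z"], of cnj] star_A[of z] by (simp add: star_fun_def)
  show ?thesis
    unfolding dB_space_def entire_def
    using G finite A_quotient_bounded_type[OF eq] A_quotient_mean_type_nonpos[OF eq]
      A_quotient_bounded_type[OF star_eq] A_quotient_mean_type_nonpos[OF star_eq] by blast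
qed

lemma dB_kernel_real:
  assumes A0: "A (complex_of_real x) = 0"
  shows "dB_kernel E (complex_of_real x) holomorphic_on UNIV"
    and "dB_kernel E (complex_of_real x) z * (z - complex_of_real x) = E (complex_of_real x) / (pi * \<i>) * A z"
proof -
  let ?x = "complex_of_real x" and ?c = "E (complex_of_real x) / (pi * \<i>)"
  have star_E: "star_fun E ?x = - E ?x" using A0 by (simp add: dB_A_def add_eq_0_iff)
  have "((\<lambda>z. (E z + star_fun E z) / 2) has_field_derivative (deriv E ?x + deriv (star_fun E) ?x) / 2) (at ?x)"
    by (intro DERIV_cdivide DERIV_add holomorphic_derivI[of _ UNIV] E_holomorphic star_E_holomorphic) auto
  then have deriv_A: "deriv A ?x = (deriv E ?x + deriv (star_fun E) ?x) / 2"
    unfolding dB_A_def[abs_def] by (rule DERIV_imp_deriv)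
  have kernel_eq: "dB_kernel E ?x z = ?c * (if z = ?x then deriv A ?x else (A z - A ?x) / (z - ?x))" for z
  proof (cases "z = ?x")
    case False
    then have "z - ?x \<noteq> 0" "?x - z \<noteq> 0" by auto
    then show ?thesis using False by (simp add: dB_kernel_def star_E A0 dB_A_def[of E z] field_simps)
  qed (simp add: dB_kernel_def star_E deriv_A field_simps)
  show "dB_kernel E ?x holomorphic_on UNIV"
    unfolding kernel_eq[abs_def] by (intro holomorphic_intros pole_lemma_open A_holomorphic) auto
  show "dB_kernel E ?x z * (z - ?x) = ?c * A z"
    by (cases "z = ?x") (simp_all add: kernel_eq A0)
qed

lemma dB_kernel_symmetrized:
  assumes A0: "A (complex_of_real x) = 0" and even: "\<And>z. A (- z) = A z"
  defines "\<phi> \<equiv> \<lambda>z. dB_kernel E (complex_of_real x) z + dB_kernel E (complex_of_real x) (- z)"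
  shows "\<phi> holomorphic_on UNIV"
    and "\<phi> z * ((z + complex_of_real x) * (z - complex_of_real x))
      = 2 * complex_of_real x * (E (complex_of_real x) / (pi * \<i>)) * A z"
proof -
  note K = dB_kernel_real[OF A0]
  show "\<phi> holomorphic_on UNIV"
    unfolding \<phi>_def
    by (intro holomorphic_on_add K(1) holomorphic_on_compose_gen[OF _ K(1), unfolded o_def])
       (auto intro!: holomorphic_intros)
  let ?x = "complex_of_real x" and ?K = "dB_kernel E (complex_of_real x)"
    and ?c = "E (complex_of_real x) / (pi * \<i>)"
  have "\<phi> z * ((z + ?x) * (z - ?x)) = (?K z * (z - ?x)) * (z + ?x) - (?K (- z) * (- z - ?x)) * (z - ?x)"
    by (simp add: \<phi>_def algebra_simps)
  also have "\<dots> = ?c * A z * (z + ?x) - ?c * A z * (z - ?x)" unfolding K(2) even ..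
  also have "\<dots> = ?c * A z * ((z + ?x) - (z - ?x))" by (rule right_diff_distrib[symmetric])
  also have "(z + ?x) - (z - ?x) = 2 * ?x" by simp
  finally show "\<phi> z * ((z + ?x) * (z - ?x)) = 2 * ?x * ?c * A z" by (simp only: mult_ac)
qed

end

subsection \<open>The spectral gap\<close>

lemma linear_coeff_eq_0_if_quadratic_nonneg:
  fixes a b :: real
  assumes nonneg: "\<And>t. 0 \<le> 2 * t * b + t\<^sup>2 * a"
  shows "b = 0"
proof (rule ccontr)
  assume "b \<noteq> 0"
  define s where "s = \<bar>a\<bar> + 1"
  have s: "s > 0" "a \<le> s" by (auto simp: s_def)
  have "2 * (- b / s) * b + (- b / s)\<^sup>2 * a \<le> 2 * (- b / s) * b + (- b / s)\<^sup>2 * s"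
    using s by (intro add_left_mono mult_left_mono) auto
  also have "\<dots> = - (b\<^sup>2 / s)" using s by (simp add: power2_eq_square)
  also have "\<dots> < 0" using s \<open>b \<noteq> 0\<close> by simp
  finally show False using nonneg[of "- b / s"] by simp
qed

locale spectral_gap = zero_free_hermite_biehler +
  fixes \<alpha> \<beta> :: real and \<phi> :: "complex \<Rightarrow> complex" and \<kappa> :: complex
  assumes \<alpha>_less_\<beta>: "\<alpha> < \<beta>" and A_\<alpha>: "A (complex_of_real \<alpha>) = 0" and A_\<beta>: "A (complex_of_real \<beta>) = 0"
    and A_between: "\<alpha> < x \<Longrightarrow> x < \<beta> \<Longrightarrow> A (complex_of_real x) \<noteq> 0"
    and \<phi>_holomorphic: "\<phi> holomorphic_on UNIV"
    and \<phi>_eq: "\<phi> z * ((z - complex_of_real \<alpha>) * (z - complex_of_real \<beta>)) = \<kappa> * A z"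
    and \<kappa>_nonzero: "\<kappa> \<noteq> 0"
begin

definition gap :: "real \<Rightarrow> real" where
  "gap x = (x - \<alpha>) * (x - \<beta>)"

definition gap_form :: "(complex \<Rightarrow> complex) \<Rightarrow> real" where
  "gap_form F = (LINT x|lborel. gap x * dB_density F x)"

definition gap_cross :: "(complex \<Rightarrow> complex) \<Rightarrow> (complex \<Rightarrow> complex) \<Rightarrow> real" where
  "gap_cross F G = (LINT x|lborel. gap x * dB_cross F G x)"

lemma integrable_gap_dB_density: "F \<in> mult_domain \<Longrightarrow> integrable lborel (\<lambda>x. gap x * dB_density F x)"
  unfolding gap_def by (rule integrable_product_linear_dB_density)

lemma integrable_gap_dB_cross:
  "F \<in> mult_domain \<Longrightarrow> G \<in> mult_domain \<Longrightarrow> integrable lborel (\<lambda>x. gap x * dB_cross F G x)"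
  unfolding gap_def by (rule integrable_product_linear_dB_cross)

lemma of_real_gap: "complex_of_real (gap x) = (complex_of_real x - \<alpha>) * (complex_of_real x - \<beta>)"
  by (simp add: gap_def)

lemma boundary_\<phi>_gap: "boundary \<phi> x * gap x = \<kappa> * boundary A x"
  using \<phi>_eq[of "complex_of_real x"] by (simp add: boundary_def of_real_gap)

lemma norm_boundary_\<phi>_gap: "norm (boundary \<phi> x) * \<bar>gap x\<bar> = norm \<kappa> * norm (boundary A x)"
  using arg_cong[OF boundary_\<phi>_gap[of x], of norm] unfolding norm_mult norm_of_real .

lemma gap_squared_dB_density_\<phi>: "(gap x)\<^sup>2 * dB_density \<phi> x = (norm \<kappa>)\<^sup>2 * (norm (boundary A x))\<^sup>2"
proof -
  have "(gap x)\<^sup>2 * dB_density \<phi> x = (norm (boundary \<phi> x) * \<bar>gap x\<bar>)\<^sup>2"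
    unfolding dB_density_def power_mult_distrib power2_abs by (rule mult.commute)
  then show ?thesis unfolding norm_boundary_\<phi>_gap power_mult_distrib .
qed

lemma \<phi>_nonzero_if_A_zero:
  assumes A0: "A (complex_of_real a) = 0" and eq: "\<And>z. \<phi> z * ((z - complex_of_real a) * (z - b)) = \<kappa> * A z"
  shows "\<phi> (complex_of_real a) \<noteq> 0"
proof
  assume "\<phi> (complex_of_real a) = 0"
  moreover have "(\<phi> has_field_derivative deriv \<phi> (complex_of_real a)) (at (complex_of_real a))"
    by (rule holomorphic_derivI[OF \<phi>_holomorphic]) auto
  ultimately have "((\<lambda>z. \<phi> z * ((z - complex_of_real a) * (z - b)) / \<kappa>) has_field_derivative 0)
      (at (complex_of_real a))"
    using \<kappa>_nonzero by (auto intro!: derivative_eq_intros)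
  then have "(A has_field_derivative 0) (at (complex_of_real a))"
    using \<kappa>_nonzero by (simp add: eq)
  then show False using real_zero_of_A_simple[OF A0] by blast
qed

lemma \<phi>_nonzero:
  assumes "\<alpha> \<le> x" "x \<le> \<beta>"
  shows "\<phi> (complex_of_real x) \<noteq> 0"
proof -
  consider "x = \<alpha>" | "x = \<beta>" | "\<alpha> < x" "x < \<beta>" using assms by linarith
  then show ?thesis
  proof cases
    case 1
    then show ?thesis using \<phi>_nonzero_if_A_zero[OF A_\<alpha> \<phi>_eq] by simp
  next
    case 2
    then show ?thesis using \<phi>_nonzero_if_A_zero[OF A_\<beta>, of "complex_of_real \<alpha>"] \<phi>_eq
      by (simp add: mult.commute)
  next
    case 3
    then show ?thesis using A_between[of x] \<phi>_eq[of "complex_of_real x"] \<kappa>_nonzero by auto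
  qed
qed

lemma boundary_\<phi>_decay:
  obtains C where "\<And>x. norm (boundary \<phi> x) \<le> C / (1 + x\<^sup>2)"
proof -
  have far: "norm (boundary \<phi> x) * (1 + x\<^sup>2) \<le> 2 * norm \<kappa>" if "1 + x\<^sup>2 \<le> 2 * gap x" for x
  proof -
    have "norm (boundary \<phi> x) * (1 + x\<^sup>2) \<le> norm (boundary \<phi> x) * (2 * \<bar>gap x\<bar>)"
      using that by (intro mult_left_mono) auto
    also have "\<dots> = 2 * (norm \<kappa> * norm (boundary A x))"
      unfolding norm_boundary_\<phi>_gap[symmetric] by simp
    also have "\<dots> \<le> 2 * (norm \<kappa> * 1)"
      by (intro mult_left_mono norm_boundary_A_le) auto
    finally show ?thesis by simp
  qed
  have "\<forall>\<^sub>F x in at_top. 1 + x\<^sup>2 \<le> 2 * gap x" "\<forall>\<^sub>F x in at_bot. 1 + x\<^sup>2 \<le> 2 * gap x"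
    unfolding gap_def by real_asymp+
  then obtain X1 X2 where X: "\<And>x. X1 \<le> x \<Longrightarrow> 1 + x\<^sup>2 \<le> 2 * gap x" "\<And>x. x \<le> X2 \<Longrightarrow> 1 + x\<^sup>2 \<le> 2 * gap x"
    unfolding eventually_at_top_linorder eventually_at_bot_linorder by blast
  have "bounded ((\<lambda>x. norm (boundary \<phi> x) * (1 + x\<^sup>2)) ` {X2..X1})"
    by (intro compact_imp_bounded compact_continuous_image continuous_intros
        continuous_on_boundary \<phi>_holomorphic) auto
  then obtain K where "K > 0" and K: "\<And>x. x \<in> {X2..X1} \<Longrightarrow> norm (norm (boundary \<phi> x) * (1 + x\<^sup>2)) \<le> K"
    unfolding bounded_pos by auto
  have "norm (boundary \<phi> x) \<le> max K (2 * norm \<kappa>) / (1 + x\<^sup>2)" for x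
  proof -
    have "norm (boundary \<phi> x) * (1 + x\<^sup>2) \<le> max K (2 * norm \<kappa>)"
    proof (cases "x \<in> {X2..X1}")
      case True
      then show ?thesis using K[OF True] by (simp add: abs_mult le_max_iff_disj)
    next
      case False
      then have "1 + x\<^sup>2 \<le> 2 * gap x" using X by (cases "x \<le> X2") auto
      then show ?thesis using far[of x] by simp
    qed
    moreover have "0 < 1 + x\<^sup>2" by (simp add: add_pos_nonneg)
    ultimately show ?thesis by (simp add: pos_le_divide_eq)
  qed
  then show thesis by (rule that)
qed

lemma integrable_boundary_\<phi>: "integrable lborel (boundary \<phi>)"
proof -
  obtain C where C: "\<And>x. norm (boundary \<phi> x) \<le> C / (1 + x\<^sup>2)" using boundary_\<phi>_decay by blast
  show ?thesis
  proof (rule Bochner_Integration.integrable_bound)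
    show "integrable lborel (\<lambda>x::real. C * (1 / (1 + x\<^sup>2)))"
      by (intro integrable_mult_right integrable_inverse_1_plus_square_UNIV)
    show "boundary \<phi> \<in> borel_measurable lborel" by (rule measurable_boundary[OF \<phi>_holomorphic])
    show "AE x in lborel. norm (boundary \<phi> x) \<le> norm (C * (1 / (1 + x\<^sup>2)))"
      using order_trans[OF C abs_ge_self] by (intro AE_I2) simp
  qed
qed

lemma integrable_1_plus_square_dB_density_\<phi>: "integrable lborel (\<lambda>x. (1 + x\<^sup>2) * dB_density \<phi> x)"
proof -
  obtain C where C: "\<And>x. norm (boundary \<phi> x) \<le> C / (1 + x\<^sup>2)" using boundary_\<phi>_decay by blast
  show ?thesis
  proof (rule Bochner_Integration.integrable_bound)
    show "integrable lborel (\<lambda>x::real. C\<^sup>2 * (1 / (1 + x\<^sup>2)))"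
      by (intro integrable_mult_right integrable_inverse_1_plus_square_UNIV)
    show "(\<lambda>x. (1 + x\<^sup>2) * dB_density \<phi> x) \<in> borel_measurable lborel"
      using measurable_dB_density[OF \<phi>_holomorphic] by simp
    have "(1 + x\<^sup>2) * dB_density \<phi> x \<le> C\<^sup>2 * (1 / (1 + x\<^sup>2))" for x
    proof -
      have pos: "0 < 1 + x\<^sup>2" by (simp add: add_pos_nonneg)
      have "(1 + x\<^sup>2) * dB_density \<phi> x \<le> (1 + x\<^sup>2) * (C / (1 + x\<^sup>2))\<^sup>2"
        unfolding dB_density_def using C[of x] pos by (intro mult_left_mono power_mono) auto
      also have "\<dots> = C\<^sup>2 * (1 / (1 + x\<^sup>2))" using pos by (simp add: power2_eq_square)
      finally show ?thesis .
    qed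
    then show "AE x in lborel. norm ((1 + x\<^sup>2) * dB_density \<phi> x) \<le> norm (C\<^sup>2 * (1 / (1 + x\<^sup>2)))"
      using dB_density_nonneg by (intro AE_I2) (simp add: abs_mult)
  qed
qed

lemma \<phi>_multiple_in_dB_space: "(\<lambda>z. c * \<phi> z) \<in> dB_space E"
proof (rule A_quotient_in_dB_space)
  show "(\<lambda>z. c * \<phi> z) holomorphic_on UNIV" by (intro holomorphic_intros \<phi>_holomorphic)
  show "c * \<phi> z * ((z - complex_of_real \<alpha>) * (z - complex_of_real \<beta>)) = c * \<kappa> * A z" for z
    using \<phi>_eq[of z] by (simp add: mult.assoc)
  have int: "integrable lborel (\<lambda>x. (norm c)\<^sup>2 * dB_density \<phi> x)"
  proof (rule Bochner_Integration.integrable_bound)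
    show "integrable lborel (\<lambda>x. (norm c)\<^sup>2 * ((1 + x\<^sup>2) * dB_density \<phi> x))"
      by (intro integrable_mult_right integrable_1_plus_square_dB_density_\<phi>)
    show "AE x in lborel. norm ((norm c)\<^sup>2 * dB_density \<phi> x)
        \<le> norm ((norm c)\<^sup>2 * ((1 + x\<^sup>2) * dB_density \<phi> x))"
      using dB_density_nonneg by (intro AE_I2) (simp add: abs_mult mult_left_mono distrib_right)
  qed (use measurable_dB_density[OF \<phi>_holomorphic] in simp)
  show "dB_normsq E (\<lambda>z. c * \<phi> z) < \<infinity>"
    unfolding dB_normsq_eq dB_density_cmult using nn_integral_eq_integral[OF int] dB_density_nonneg by simp
qed

lemma \<phi>_mult_domain: "\<phi> \<in> mult_domain"
  using dB_space_admissible[OF \<phi>_multiple_in_dB_space[of 1]] integrable_1_plus_square_dB_density_\<phi>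
  by (simp add: mult_domain_def)

text \<open>On the real line \<open>1 / E + 1 / E\<^sup>* = 2 A / |E|\<^sup>2\<close>, so \<open>gap x |\<phi> / E|\<^sup>2\<close> is a combination of
  \<open>\<phi> / E\<close> and \<open>\<phi>\<^sup>* / E\<close>.\<close>
lemma gap_form_\<phi>: "gap_form \<phi> = 0"
proof -
  have adm: "admissible \<phi>" "admissible (star_fun \<phi>)" using \<phi>_mult_domain by (auto simp: mult_domain_def)
  have int_star: "integrable lborel (boundary (star_fun \<phi>))"
  proof (rule Bochner_Integration.integrable_bound[OF integrable_boundary_\<phi>])
    show "boundary (star_fun \<phi>) \<in> borel_measurable lborel"
      using adm(2) by (intro measurable_boundary) (simp add: admissible_def)
  qed (simp add: boundary_star norm_mult norm_\<Theta>_real)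
  have density: "complex_of_real (gap x * dB_density \<phi> x)
      = \<kappa> / 2 * (cnj (boundary \<phi> x) + boundary (star_fun \<phi>) x)" for x
  proof -
    have "complex_of_real (gap x * dB_density \<phi> x) = boundary \<phi> x * gap x * cnj (boundary \<phi> x)"
      unfolding dB_density_def of_real_mult complex_norm_square by (simp only: mult_ac)
    also have "\<dots> = \<kappa> * ((1 + \<Theta> (complex_of_real x)) / 2) * cnj (boundary \<phi> x)"
      unfolding boundary_\<phi>_gap boundary_A ..
    also have "\<dots> = \<kappa> / 2 * (cnj (boundary \<phi> x) + boundary (star_fun \<phi>) x)"
      unfolding boundary_star by (simp add: field_simps)
    finally show ?thesis .
  qed
  have "complex_of_real (gap_form \<phi>) = (LINT x|lborel. \<kappa> / 2 * (cnj (boundary \<phi> x) + boundary (star_fun \<phi>) x))"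
    unfolding gap_form_def integral_complex_of_real[symmetric] density ..
  also have "\<dots> = \<kappa> / 2 * (cnj (LINT x|lborel. boundary \<phi> x) + (LINT x|lborel. boundary (star_fun \<phi>) x))"
    using integrable_boundary_\<phi> int_star by simp
  also have "\<dots> = 0"
    unfolding integral_boundary_eq_0[OF adm(1) integrable_boundary_\<phi>]
      integral_boundary_eq_0[OF adm(2) int_star] by simp
  finally show ?thesis by simp
qed

lemma dB_density_le_\<phi>:
  assumes F: "F holomorphic_on UNIV"
  obtains K where "K > 0" "\<And>x. \<alpha> \<le> x \<Longrightarrow> x \<le> \<beta> \<Longrightarrow> dB_density F x \<le> K * dB_density \<phi> x"
proof -
  have pos: "dB_density \<phi> x > 0" if "x \<in> {\<alpha>..\<beta>}" for x
    using \<phi>_nonzero[of x] that E_real_nonzero[of x] by (simp add: dB_density_def boundary_def)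
  have "bounded ((\<lambda>x. dB_density F x / dB_density \<phi> x) ` {\<alpha>..\<beta>})"
  proof (intro compact_imp_bounded compact_continuous_image continuous_on_divide
      continuous_on_dB_density F \<phi>_holomorphic)
    show "\<forall>x\<in>{\<alpha>..\<beta>}. dB_density \<phi> x \<noteq> 0" using pos by force
  qed simp
  then obtain K where K: "K > 0" "\<And>x. x \<in> {\<alpha>..\<beta>} \<Longrightarrow> norm (dB_density F x / dB_density \<phi> x) \<le> K"
    unfolding bounded_pos by auto
  have "dB_density F x \<le> K * dB_density \<phi> x" if "\<alpha> \<le> x" "x \<le> \<beta>" for x
    using K(2)[of x] pos[of x] that by (simp add: abs_le_iff divide_le_eq)
  with K(1) show thesis by (rule that)
qed

text \<open>With \<open>g = - gap x \<ge> 0\<close>, the inequality \<open>g \<le> \<eta> + g\<^sup>2 / (4 \<eta>)\<close> splits off \<open>\<eta> |\<phi>|\<^sup>2\<close>, whose Poisson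
  integral does not depend on \<open>r\<close>, from \<open>g\<^sup>2 |\<phi>|\<^sup>2 = |\<kappa> A|\<^sup>2\<close>, on whose zeros the Poisson kernel
  concentrates.\<close>
lemma poisson_gap_lower_bound:
  assumes K: "K > 0" "\<And>x. \<alpha> \<le> x \<Longrightarrow> x \<le> \<beta> \<Longrightarrow> dB_density F x \<le> K * dB_density \<phi> x"
    and r: "0 \<le> r" "r < 1" and \<eta>: "\<eta> > 0"
  shows "- (K * \<eta> * (Pois r x * dB_density \<phi> x) + K * (norm \<kappa>)\<^sup>2 * (1 - r\<^sup>2) / (4 * \<eta>) * indicator {\<alpha>..\<beta>} x)
    \<le> Pois r x * (gap x * dB_density F x)"
proof -
  have P: "0 \<le> Pois r x" by (rule poisson_kernel_nonneg[OF r])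
  show ?thesis
  proof (cases "x \<in> {\<alpha>..\<beta>}")
    case False
    then have "0 \<le> gap x"
      by (cases "x < \<alpha>") (use \<alpha>_less_\<beta> in \<open>auto simp: gap_def intro: mult_nonneg_nonneg mult_nonpos_nonpos\<close>)
    then have "0 \<le> Pois r x * (gap x * dB_density F x)" using P dB_density_nonneg by simp
    moreover have "0 \<le> K * \<eta> * (Pois r x * dB_density \<phi> x)" using K(1) \<eta> P dB_density_nonneg by simp
    ultimately show ?thesis using False by simp
  next
    case True
    define g where "g = - gap x"
    have g: "0 \<le> g" using True by (simp add: g_def gap_def mult_nonneg_nonpos)
    have "g \<le> \<eta> + g\<^sup>2 / (4 * \<eta>)"
      using \<eta> zero_le_power2[of "2 * \<eta> - g"] by (simp add: field_simps power2_eq_square)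
    have "Pois r x * (g * dB_density F x) \<le> Pois r x * (g * (K * dB_density \<phi> x))"
      using K(2)[of x] True g P by (intro mult_left_mono) auto
    also have "\<dots> = K * (Pois r x * dB_density \<phi> x) * g" by simp
    also have "\<dots> \<le> K * (Pois r x * dB_density \<phi> x) * (\<eta> + g\<^sup>2 / (4 * \<eta>))"
      using \<open>g \<le> \<eta> + g\<^sup>2 / (4 * \<eta>)\<close> K(1) P dB_density_nonneg by (intro mult_left_mono) auto
    also have "\<dots> = K * \<eta> * (Pois r x * dB_density \<phi> x)
        + K * (Pois r x * ((gap x)\<^sup>2 * dB_density \<phi> x)) / (4 * \<eta>)"
      by (simp add: g_def algebra_simps)
    also have "Pois r x * ((gap x)\<^sup>2 * dB_density \<phi> x)
        = (norm \<kappa>)\<^sup>2 * (Pois r x * (norm ((1 + \<Theta> (complex_of_real x)) / 2))\<^sup>2)"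
      by (simp only: gap_squared_dB_density_\<phi> boundary_A mult.left_commute)
    also have "K * \<eta> * (Pois r x * dB_density \<phi> x) + K * \<dots> / (4 * \<eta>)
        \<le> K * \<eta> * (Pois r x * dB_density \<phi> x) + K * ((norm \<kappa>)\<^sup>2 * (1 - r\<^sup>2)) / (4 * \<eta>)"
      using K(1) \<eta> poisson_kernel_mult_le[OF r norm_\<Theta>_real] 
      by (intro add_left_mono divide_right_mono mult_left_mono) auto
    finally show ?thesis using True by (simp add: g_def mult.assoc)
  qed
qed

lemma gap_form_poisson:
  assumes F: "F \<in> mult_domain" and r: "0 \<le> r" "r < 1"
  shows "integrable lborel (\<lambda>x. Pois r x * (gap x * dB_density F x))"
    and "(LINT x|lborel. Pois r x * (gap x * dB_density F x)) = gap_form F"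
proof -
  have tame_linear: "tame (\<lambda>z. z - complex_of_real a)" for a
    using tame_add[OF tame_ident tame_const[of "- complex_of_real a"]] by simp
  have adm: "admissible F" "admissible (star_fun F)" using F by (auto simp: mult_domain_def)
  have adm_gap: "admissible (\<lambda>z. (z - complex_of_real \<alpha>) * ((z - complex_of_real \<beta>) * F z))"
    by (intro admissible_mult tame_linear holomorphic_intros adm)
  have density: "boundary (\<lambda>z. (z - complex_of_real \<alpha>) * ((z - complex_of_real \<beta>) * F z)) x
      * cnj (boundary F x)
      = complex_of_real (gap x * dB_density F x)" for x
    unfolding dB_density_def of_real_mult of_real_gap complex_norm_square by (simp add: boundary_def mult_ac)
  from Poisson_quadrature[OF adm_gap adm(2) r density integrable_gap_dB_density[OF F]]
  show "integrable lborel (\<lambda>x. Pois r x * (gap x * dB_density F x))"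
    "(LINT x|lborel. Pois r x * (gap x * dB_density F x)) = gap_form F"
    unfolding gap_form_def .
qed

lemma \<phi>_poisson:
  assumes r: "0 \<le> r" "r < 1"
  shows "integrable lborel (\<lambda>x. Pois r x * dB_density \<phi> x)"
    and "(LINT x|lborel. Pois r x * dB_density \<phi> x) = (LINT x|lborel. dB_density \<phi> x)"
proof -
  have adm: "admissible \<phi>" "admissible (star_fun \<phi>)" using \<phi>_mult_domain by (auto simp: mult_domain_def)
  have density: "boundary \<phi> x * cnj (boundary \<phi> x) = complex_of_real (dB_density \<phi> x)" for x
    unfolding dB_density_def complex_norm_square ..
  from Poisson_quadrature[OF adm r density integrable_dB_density[OF \<phi>_mult_domain]]
  show "integrable lborel (\<lambda>x. Pois r x * dB_density \<phi> x)"
    "(LINT x|lborel. Pois r x * dB_density \<phi> x) = (LINT x|lborel. dB_density \<phi> x)" .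
qed

theorem gap_form_nonneg:
  assumes F: "F \<in> mult_domain"
  shows "0 \<le> gap_form F"
proof -
  obtain K where K: "K > 0" "\<And>x. \<alpha> \<le> x \<Longrightarrow> x \<le> \<beta> \<Longrightarrow> dB_density F x \<le> K * dB_density \<phi> x"
    using dB_density_le_\<phi>[OF mult_domain_holomorphic[OF F]] by blast
  define L where "L = (LINT x|lborel. dB_density \<phi> x)"
  define M where "M = K * (L + (norm \<kappa>)\<^sup>2 * (\<beta> - \<alpha>) / 4)"
  have lower: "- (\<eta> * M) \<le> gap_form F" if \<eta>: "0 < \<eta>" "\<eta> \<le> 1" for \<eta>
  proof -
    define r where "r = sqrt (1 - \<eta>\<^sup>2)"
    have "\<eta>\<^sup>2 \<le> 1" "0 < \<eta>\<^sup>2" using \<eta> by (auto simp: power_le_one)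
    then have r: "0 \<le> r" "r < 1" "1 - r\<^sup>2 = \<eta>\<^sup>2" by (auto simp: r_def)
    let ?lower = "\<lambda>x. - (K * \<eta> * (Pois r x * dB_density \<phi> x)
      + K * (norm \<kappa>)\<^sup>2 * (1 - r\<^sup>2) / (4 * \<eta>) * indicator {\<alpha>..\<beta>} x)"
    have int: "integrable lborel (\<lambda>x. Pois r x * dB_density \<phi> x)"
      "integrable lborel (indicator {\<alpha>..\<beta>} :: real \<Rightarrow> real)"
      by (rule \<phi>_poisson(1)[OF r(1,2)]) (intro integrable_real_indicator, auto simp: emeasure_lborel_Icc_eq)
    have "(LINT x|lborel. ?lower x) = - (K * \<eta> * L + K * (norm \<kappa>)\<^sup>2 * (1 - r\<^sup>2) / (4 * \<eta>) * (\<beta> - \<alpha>))"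
      using int \<alpha>_less_\<beta> \<phi>_poisson(2)[OF r(1,2)] by (simp add: L_def)
    also have "\<dots> = - (\<eta> * M)"
      unfolding r(3) M_def using \<eta> by (simp add: field_simps power2_eq_square)
    finally have "- (\<eta> * M) = (LINT x|lborel. ?lower x)" ..
    also have "\<dots> \<le> (LINT x|lborel. Pois r x * (gap x * dB_density F x))"
      using int gap_form_poisson(1)[OF F r(1,2)] poisson_gap_lower_bound[OF K r(1,2) \<eta>(1)]
      by (intro integral_mono) auto
    finally show ?thesis by (simp add: gap_form_poisson(2)[OF F r(1,2)])
  qed
  show ?thesis
  proof (rule tendsto_upperbound)
    show "\<forall>\<^sub>F \<eta> in at_right 0. - (\<eta> * M) \<le> gap_form F"
      using eventually_at_right_real[OF zero_less_one] by eventually_elim (use lower in auto)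
    have "((\<lambda>\<eta>. - (\<eta> * M)) \<longlongrightarrow> - (0 * M)) (at_right 0)" by (intro tendsto_intros)
    then show "((\<lambda>\<eta>. - (\<eta> * M)) \<longlongrightarrow> 0) (at_right 0)" by simp
  qed simp
qed

lemma gap_form_cmult: "gap_form (\<lambda>z. c * F z) = (norm c)\<^sup>2 * gap_form F"
  by (simp add: gap_form_def dB_density_cmult mult.left_commute[of _ "(norm c)\<^sup>2"])

lemma gap_form_add:
  assumes F: "F \<in> mult_domain" and G: "G \<in> mult_domain"
  shows "gap_form (\<lambda>z. F z + G z) = gap_form F + 2 * gap_cross F G + gap_form G"
proof -
  have "gap x * dB_density (\<lambda>z. F z + G z) x
      = gap x * dB_density F x + 2 * (gap x * dB_cross F G x) + gap x * dB_density G x" for x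
    by (simp add: dB_density_add algebra_simps)
  then show ?thesis
    unfolding gap_form_def gap_cross_def
    using integrable_gap_dB_density[OF F] integrable_gap_dB_density[OF G] integrable_gap_dB_cross[OF F G]
    by simp
qed

lemma gap_cross_cmult: "gap_cross F (\<lambda>z. complex_of_real t * G z) = t * gap_cross F G"
proof -
  have "dB_cross F (\<lambda>z. complex_of_real t * G z) x = t * dB_cross F G x" for x
  proof -
    have "Re (u * cnj (complex_of_real t * v)) = t * Re (u * cnj v)" for u v by (simp add: algebra_simps)
    then show ?thesis by (simp only: dB_cross_def boundary_def times_divide_eq_right[symmetric])
  qed
  then show ?thesis by (simp add: gap_cross_def mult.left_commute[of _ t])
qed

lemma gap_cross_eq_0_if_gap_form_eq_0:
  assumes F: "F \<in> mult_domain" "gap_form F = 0" and G: "G \<in> mult_domain"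
  shows "gap_cross F G = 0"
proof (rule linear_coeff_eq_0_if_quadratic_nonneg)
  fix t :: real
  have "0 \<le> gap_form (\<lambda>z. F z + complex_of_real t * G z)"
    by (intro gap_form_nonneg mult_domain_add mult_domain_cmult F G)
  also have "\<dots> = 2 * t * gap_cross F G + t\<^sup>2 * gap_form G"
    by (simp add: gap_form_add[OF F(1) mult_domain_cmult[OF G]] F(2) gap_cross_cmult gap_form_cmult)
  finally show "0 \<le> 2 * t * gap_cross F G + t\<^sup>2 * gap_form G" .
qed

text \<open>\<open>F\<close> is orthogonal to \<open>H = F / (z - \<beta>)\<close> with respect to the form, and
  \<open>(x - \<alpha>)\<^sup>2 |F|\<^sup>2 = gap x (|F|\<^sup>2 + (\<beta> - \<alpha>) Re F H\<^sup>*)\<close>.\<close>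
lemma eq_0_if_gap_form_eq_0:
  assumes F: "F \<in> mult_domain" "gap_form F = 0" and F\<beta>: "F (complex_of_real \<beta>) = 0"
  shows "F = (\<lambda>_. 0)"
proof -
  obtain H where H: "H holomorphic_on UNIV" "\<And>z. F z = (z - complex_of_real \<beta>) * H z"
    using holomorphic_factor_linear[OF mult_domain_holomorphic[OF F(1)] open_UNIV F\<beta>] by blast
  have H_dom: "H \<in> mult_domain" by (rule mult_domain_divide_linear[OF F(1) H])
  have F_eq: "F = (\<lambda>z. (z - complex_of_real \<beta>) * H z)" using H(2) by (rule ext)
  have "(x - \<alpha>) * (x - \<alpha>) * dB_density F x = gap x * dB_density F x + (\<beta> - \<alpha>) * (gap x * dB_cross F H x)" for x
    unfolding F_eq dB_density_linear_mult dB_cross_linear_mult gap_def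
    by (simp add: power2_eq_square algebra_simps)
  then have "(LINT x|lborel. (x - \<alpha>) * (x - \<alpha>) * dB_density F x) = gap_form F + (\<beta> - \<alpha>) * gap_cross F H"
    unfolding gap_form_def gap_cross_def
    using integrable_gap_dB_density[OF F(1)] integrable_gap_dB_cross[OF F(1) H_dom] by simp
  also have "\<dots> = 0" using F(2) gap_cross_eq_0_if_gap_form_eq_0[OF F H_dom] by simp
  finally have "AE x in lborel. (x - \<alpha>) * (x - \<alpha>) * dB_density F x = 0"
    using integral_nonneg_eq_0_iff_AE[OF integrable_product_linear_dB_density[OF F(1)]] dB_density_nonneg
    by simp
  moreover have "AE x in lborel. x \<noteq> \<alpha>" by (rule AE_lborel_singleton)
  ultimately have "AE x in lborel. dB_density F x = 0" by eventually_elim simp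
  then show ?thesis by (rule eq_0_if_AE_dB_density_eq_0[OF mult_domain_holomorphic[OF F(1)]])
qed

theorem gap_form_eq_0_iff:
  assumes F: "F \<in> mult_domain"
  shows "gap_form F = 0 \<longleftrightarrow> (\<exists>c. F = (\<lambda>z. c * \<phi> z))"
proof
  assume zero: "gap_form F = 0"
  define c where "c = F (complex_of_real \<beta>) / \<phi> (complex_of_real \<beta>)"
  have dom: "(\<lambda>z. - c * \<phi> z) \<in> mult_domain" by (rule mult_domain_cmult[OF \<phi>_mult_domain])
  have "(\<lambda>z. F z + - c * \<phi> z) = (\<lambda>_. 0)"
  proof (rule eq_0_if_gap_form_eq_0)
    show "(\<lambda>z. F z + - c * \<phi> z) \<in> mult_domain" by (rule mult_domain_add[OF F dom])
    show "gap_form (\<lambda>z. F z + - c * \<phi> z) = 0"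
      unfolding gap_form_add[OF F dom] gap_form_cmult gap_form_\<phi> gap_cross_eq_0_if_gap_form_eq_0[OF F zero dom]
      by (simp add: zero)
    show "F (complex_of_real \<beta>) + - c * \<phi> (complex_of_real \<beta>) = 0"
      using \<phi>_nonzero[of \<beta>] \<alpha>_less_\<beta> by (simp add: c_def)
  qed
  then have "F z + - c * \<phi> z = 0" for z by (rule fun_cong)
  then show "\<exists>c. F = (\<lambda>z. c * \<phi> z)" by (intro exI[of _ c]) (simp add: fun_eq_iff)
qed (auto simp: gap_form_cmult gap_form_\<phi>)

end

subsection \<open>The extremal problem\<close>

locale symmetric_spectral_gap = spectral_gap E "- \<xi>" \<xi> \<phi> \<kappa> for E \<xi> \<phi> \<kappa>
begin

lemma \<xi>_pos: "0 < \<xi>"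
  using \<alpha>_less_\<beta> by simp

lemma norm_ratio_eq_gap_form:
  assumes F: "F \<in> mult_domain" "F \<noteq> (\<lambda>_. 0)"
  shows "dB_norm E (\<lambda>z. z * F z) / dB_norm E F
      = ereal (sqrt (\<xi>\<^sup>2 + gap_form F / (LINT x|lborel. dB_density F x)))"
proof -
  let ?N = "LINT x|lborel. dB_density F x"
  have "x\<^sup>2 * dB_density F x = gap x * dB_density F x + \<xi>\<^sup>2 * dB_density F x" for x
    by (simp add: gap_def power2_eq_square algebra_simps)
  then have "(LINT x|lborel. x\<^sup>2 * dB_density F x) = gap_form F + \<xi>\<^sup>2 * ?N"
    unfolding gap_form_def using integrable_gap_dB_density integrable_dB_density F(1) by simp
  then show ?thesis
    using norm_ratio_mult_domain[OF F] by (simp add: add_divide_distrib add.commute)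
qed

lemma norm_ratio_ge:
  assumes F: "F \<in> dB_space E" "F \<noteq> (\<lambda>_. 0)"
  shows "ereal \<xi> \<le> dB_norm E (\<lambda>z. z * F z) / dB_norm E F"
proof (cases "dB_normsq E (\<lambda>z. z * F z) = \<infinity>")
  case False
  then have F_dom: "F \<in> mult_domain" using dB_space_imp_mult_domain F(1) by blast
  show ?thesis
    using gap_form_nonneg[OF F_dom] norm_ratio_mult_domain(1)[OF F_dom F(2)]
    unfolding norm_ratio_eq_gap_form[OF F_dom F(2)] by (simp add: real_le_rsqrt)
qed (simp add: norm_ratio_infinite[OF F])

lemma norm_ratio_eq_iff:
  assumes F: "F \<in> dB_space E" "F \<noteq> (\<lambda>_. 0)"
  shows "dB_norm E (\<lambda>z. z * F z) / dB_norm E F = ereal \<xi> \<longleftrightarrow> (\<exists>c. F = (\<lambda>z. c * \<phi> z))"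
proof (cases "F \<in> mult_domain")
  case True
  have "sqrt (\<xi>\<^sup>2 + t) = \<xi> \<longleftrightarrow> t = 0" if "0 \<le> t" for t
    using \<xi>_pos that real_sqrt_eq_iff[of "\<xi>\<^sup>2 + t" "\<xi>\<^sup>2"] by simp
  then show ?thesis
    using gap_form_nonneg[OF True] norm_ratio_mult_domain(1)[OF True F(2)]
    unfolding norm_ratio_eq_gap_form[OF True F(2)] gap_form_eq_0_iff[OF True, symmetric] by simp
next
  case False
  then have "dB_norm E (\<lambda>z. z * F z) / dB_norm E F = \<infinity>"
    using norm_ratio_infinite[OF F] dB_space_imp_mult_domain[OF F(1)] by blast
  moreover have "\<nexists>c. F = (\<lambda>z. c * \<phi> z)" using False mult_domain_cmult[OF \<phi>_mult_domain] by blast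
  ultimately show ?thesis by simp
qed

theorem extremal_iff:
  "F \<in> dB_space E \<and> F \<noteq> (\<lambda>_. 0) \<and> dB_norm E (\<lambda>z. z * F z) / dB_norm E F = ereal \<xi>
    \<longleftrightarrow> (\<exists>c. F = (\<lambda>z. c * \<phi> z) \<and> c \<noteq> 0)" (is "?extremal \<longleftrightarrow> ?multiple")
proof
  assume extremal: ?extremal
  then obtain c where c: "F = (\<lambda>z. c * \<phi> z)" using norm_ratio_eq_iff by blast
  moreover have "c \<noteq> 0" using extremal c by auto
  ultimately show ?multiple by blast
next
  assume ?multiple
  then obtain c where c: "F = (\<lambda>z. c * \<phi> z)" "c \<noteq> 0" by blast
  have "F \<in> dB_space E" unfolding c(1) by (rule \<phi>_multiple_in_dB_space)
  moreover have "F (complex_of_real \<xi>) \<noteq> 0" using c \<phi>_nonzero[of \<xi>] \<xi>_pos by simp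
  then have "F \<noteq> (\<lambda>_. 0)" by auto
  ultimately show ?extremal using norm_ratio_eq_iff[of F] c(1) by blast
qed

end

lemma star_fun_eq_minus_if_rotated_real:
  assumes E: "entire E" and real: "real_entire (\<lambda>z. E (\<i> * z))"
  shows "star_fun E z = E (- z)"
proof -
  define G where "G w = E (\<i> * w)" for w
  have G: "G holomorphic_on UNIV" "G (complex_of_real x) \<in> \<real>" for x
    using real by (auto simp: real_entire_def entire_def G_def[abs_def])
  have "star_fun G (\<i> * z) = G (\<i> * z)"
  proof (rule entire_eq_if_eq_on_Reals[where F = "star_fun G" and G = G])
    show "star_fun G (complex_of_real x) = G (complex_of_real x)" for x
      using G(2)[of x] by (simp add: star_fun_def Reals_cnj_iff)
  qed (auto intro: star_fun_holomorphic G(1))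
  then show ?thesis by (simp add: star_fun_def G_def flip: mult.assoc)
qed

lemma symmetric_spectral_gap_dB_kernel:
  assumes HB: "hermite_biehler E" and no_real_zeros: "\<forall>x::real. E (complex_of_real x) \<noteq> 0"
    and rot_real: "real_entire (\<lambda>z. E (\<i> * z))" and \<xi>: "\<xi> > 0" "dB_A E (complex_of_real \<xi>) = 0"
    and smallest: "\<forall>x::real. 0 < x \<and> x < \<xi> \<longrightarrow> dB_A E (complex_of_real x) \<noteq> 0"
  shows "symmetric_spectral_gap E \<xi>
    (\<lambda>z. dB_kernel E (complex_of_real \<xi>) z + dB_kernel E (complex_of_real \<xi>) (- z))
    (2 * complex_of_real \<xi> * (E (complex_of_real \<xi>) / (pi * \<i>)))"
proof -
  interpret zero_free_hermite_biehler E using HB no_real_zeros by unfold_locales blast+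
  have star_E: "star_fun E z = E (- z)" for z
    using star_fun_eq_minus_if_rotated_real HB rot_real unfolding hermite_biehler_def by blast
  have A_even: "A (- z) = A z" for z by (simp add: dB_A_def star_E add.commute)
  have A_between: "A (complex_of_real x) \<noteq> 0" if "- \<xi> < x" "x < \<xi>" for x
  proof -
    consider "0 < x" | "x = 0" | "0 < - x" by linarith
    then show ?thesis
    proof cases
      case 1
      then show ?thesis using smallest that by blast
    next
      case 2
      then show ?thesis using no_real_zeros[rule_format, of 0] by (simp add: dB_A_def star_E)
    next
      case 3
      then have "A (complex_of_real (- x)) \<noteq> 0" using smallest[rule_format, of "- x"] that(1) by simp
      then show ?thesis using A_even[of "complex_of_real x"] by simp
    qed
  qed
  show ?thesis
    using dB_kernel_symmetrized[OF \<xi>(2) A_even] \<xi> A_even[of "complex_of_real \<xi>"] A_between no_real_zeros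
    by unfold_locales auto
qed

theorem theorem14:
  fixes E :: "complex \<Rightarrow> complex" and \<xi>0 :: real
  assumes HB: "hermite_biehler E"
    and no_real_zeros: "\<forall>x::real. E (complex_of_real x) \<noteq> 0"
    and rot_real: "real_entire (\<lambda>z. E (\<i> * z))"
    and xi_pos: "\<xi>0 > 0"
    and xi_zero: "dB_A E (complex_of_real \<xi>0) = 0"
    and xi_smallest: "\<forall>x::real. 0 < x \<and> x < \<xi>0 \<longrightarrow> dB_A E (complex_of_real x) \<noteq> 0"
  shows "Inf {dB_norm E (\<lambda>z. z * F z) / dB_norm E F | F. F \<in> dB_space E \<and> F \<noteq> (\<lambda>_. 0)} = ereal \<xi>0
    \<and> {F. F \<in> dB_space E \<and> F \<noteq> (\<lambda>_. 0) \<and> dB_norm E (\<lambda>z. z * F z) / dB_norm E F = ereal \<xi>0}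
      = {(\<lambda>z. c * (dB_kernel E (complex_of_real \<xi>0) z + dB_kernel E (complex_of_real \<xi>0) (- z))) | c. c \<noteq> 0}"
proof -
  define \<phi> where "\<phi> = (\<lambda>z. dB_kernel E (complex_of_real \<xi>0) z + dB_kernel E (complex_of_real \<xi>0) (- z))"
  interpret symmetric_spectral_gap E \<xi>0 \<phi> "2 * complex_of_real \<xi>0 * (E (complex_of_real \<xi>0) / (pi * \<i>))"
    unfolding \<phi>_def by (rule symmetric_spectral_gap_dB_kernel[OF assms])
  have extremals: "{F. F \<in> dB_space E \<and> F \<noteq> (\<lambda>_. 0) \<and> dB_norm E (\<lambda>z. z * F z) / dB_norm E F = ereal \<xi>0}
      = {(\<lambda>z. c * \<phi> z) | c. c \<noteq> 0}"
    by (simp only: extremal_iff)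
  obtain F where "F \<in> dB_space E" "F \<noteq> (\<lambda>_. 0)" "dB_norm E (\<lambda>z. z * F z) / dB_norm E F = ereal \<xi>0"
    using extremal_iff[of "\<lambda>z. 1 * \<phi> z"] by (metis zero_neq_one)
  then have "ereal \<xi>0 \<in> {dB_norm E (\<lambda>z. z * F z) / dB_norm E F | F. F \<in> dB_space E \<and> F \<noteq> (\<lambda>_. 0)}"
    by (auto intro: sym)
  then have "Inf {dB_norm E (\<lambda>z. z * F z) / dB_norm E F | F. F \<in> dB_space E \<and> F \<noteq> (\<lambda>_. 0)} = ereal \<xi>0"
    by (rule cInf_eq_minimum) (use norm_ratio_ge in auto)
  with extremals show ?thesis by (simp add: \<phi>_def)
qed

end
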